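(* Let $0\neq\hbar\in\mathbb R$ and consider, in the Schrödinger representation on $L^2(\mathbb R,d\theta)$, the Rumin differentials $D_1$ and $D_2$ (matrices of differential operators given in the context), with $*$ denoting the formal adjoint, i.e. the transposed conjugate matrix of operators. Then the nonzero spectrum of $D_1^*D_1$ consists of the simple eigenvalues $$|\hbar|^3(2n+1)\left|(2n+1)^2-2\right|,\qquad n=0,1,2,3,\dotsc$$ and the nonzero spectrum of $D_2^*D_2$ consists of the mutually distinct, simple eigenvalues $$\lambda_n^\pm=\hbar^2\left(\frac{\sqrt{8(2n+1)^2+9}\pm5}4\right)^2,\qquad n=0,1,2,3,\dotsc$$
   Context: Let $X_1=\sqrt{|\hbar|}\,\partial_\theta$, $X_2=\mathbf i\operatorname{sgn}(\hbar)\sqrt{|\hbar|}\,\theta$, $X_3=[X_1,X_2]=\mathbf i\hbar$, acting on the Schwartz space $\mathcal S(\mathbb R)\subset L^2(\mathbb R,d\theta)$; formally $X_j^*=-X_j$. Write $X_{j_1\cdots j_k}=X_{j_1}\cdots X_{j_k}$. In the Schrödinger representation of the 5-dimensional graded nilpotent Lie group with Lie algebra relations $X_3=[X_1,X_2]$, $X_4=[X_1,X_3]$, $X_5=[X_2,X_3]$ (where $X_4=X_5=0$ in this representation) the Rumin differentials are $$D_1=\begin{pmatrix}-X_{112}-X_{13}&X_{111}\\-\sqrt2X_{122}&\sqrt2X_{211}\\-X_{222}&X_{221}-X_{23}\end{pmatrix},\qquad D_2=\begin{pmatrix}-X_{12}-X_3&X_{11}/\sqrt2&0\\-X_{22}/\sqrt2&-\tfrac32X_3&X_{11}/\sqrt2\\0&-X_{22}/\sqrt2&X_{21}-X_3\end{pmatrix},$$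 with respect to bases of the cohomology spaces that are orthonormal for the chosen inner product (the inner product induced from a graded Euclidean inner product $g$ on the Lie algebra with $X_1,X_2$ orthonormal, $a_g=1$ and $b_g=g_{-1}$, where $g_{-2}([X,Y],[X,Y])=a_g(g_{-1}(X,X)g_{-1}(Y,Y)-g_{-1}(X,Y)^2)$ and $g_{-3}([X,Z],[Y,Z])=g_{-2}(Z,Z)b_g(X,Y)$ for $X,Y$ of degree $-1$, $Z$ of degree $-2$). The operators $D_1^*D_1$ on $L^2(\mathbb R)\otimes\mathbb C^2$ and $D_2^*D_2$ on $L^2(\mathbb R)\otimes\mathbb C^3$ have infinite dimensional kernels, which are disregarded. *)

theory Defs
  imports "HOL-Analysis.Analysis" "HOL-Library.Function_Algebras"
begin

section \<open>Schwartz functions and square integrable functions on the line\<close>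

definition vderiv :: "(real \<Rightarrow> complex) \<Rightarrow> real \<Rightarrow> complex" where
  "vderiv f = (\<lambda>\<theta>. vector_derivative f (at \<theta>))"

definition schwartz :: "(real \<Rightarrow> complex) set" where
  "schwartz = {f. (\<forall>m. (vderiv ^^ m) f differentiable_on UNIV) \<and>
                  (\<forall>k m. bounded (range (\<lambda>\<theta>. \<theta> ^ k *\<^sub>R (vderiv ^^ m) f \<theta>)))}"

definition schwartz_vec :: "(real \<Rightarrow> complex ^ 'n) set" where
  "schwartz_vec = {f. \<forall>i. (\<lambda>\<theta>. f \<theta> $ i) \<in> schwartz}"

definition L2_inner :: "(real \<Rightarrow> complex) \<Rightarrow> (real \<Rightarrow> complex) \<Rightarrow> complex" where
  "L2_inner f g = (LINT \<theta>|lborel. f \<theta> * cnj (g \<theta>))"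

text \<open>Elements of \<open>L\<^sup>2(\<real>) \<otimes> \<complex>\<^sup>n\<close> are represented by square integrable functions with values
  in \<open>\<complex>\<^sup>n\<close>; equality of classes is written out as equality almost everywhere.\<close>

definition L2_space :: "(real \<Rightarrow> complex ^ 'n) set" where
  "L2_space = {f. f \<in> borel_measurable lborel \<and> integrable lborel (\<lambda>\<theta>. (norm (f \<theta>))\<^sup>2)}"

definition L2_norm :: "(real \<Rightarrow> complex ^ 'n) \<Rightarrow> real" where
  "L2_norm f = sqrt (LINT \<theta>|lborel. (norm (f \<theta>))\<^sup>2)"

definition L2_eq :: "(real \<Rightarrow> complex ^ 'n) \<Rightarrow> (real \<Rightarrow> complex ^ 'n) \<Rightarrow> bool" where
  "L2_eq f g \<longleftrightarrow> (AE \<theta> in lborel. f \<theta> = g \<theta>)"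


section \<open>Spectrum of a densely defined, closable operator on \<open>L\<^sup>2(\<real>) \<otimes> \<complex>\<^sup>n\<close>\<close>

text \<open>The graph of the closure of the operator \<open>T\<close> with domain \<open>S\<close>.\<close>

definition closure_graph ::
    "(real \<Rightarrow> complex ^ 'n) set \<Rightarrow> ((real \<Rightarrow> complex ^ 'n) \<Rightarrow> (real \<Rightarrow> complex ^ 'n))
       \<Rightarrow> ((real \<Rightarrow> complex ^ 'n) \<times> (real \<Rightarrow> complex ^ 'n)) set" where
  "closure_graph S T =
     {(u, v). u \<in> L2_space \<and> v \<in> L2_space \<and>
        (\<exists>f. (\<forall>k::nat. f k \<in> S) \<and>
             (\<lambda>k. L2_norm (\<lambda>\<theta>. f k \<theta> - u \<theta>)) \<longlonglongrightarrow> 0 \<and>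
             (\<lambda>k. L2_norm (\<lambda>\<theta>. T (f k) \<theta> - v \<theta>)) \<longlonglongrightarrow> 0)}"

text \<open>\<open>z\<close> is in the resolvent set if the operator minus \<open>z\<close> maps its domain bijectively
  onto \<open>L\<^sup>2\<close> with bounded inverse.\<close>

definition resolvent_set ::
    "((real \<Rightarrow> complex ^ 'n) \<times> (real \<Rightarrow> complex ^ 'n)) set \<Rightarrow> complex set" where
  "resolvent_set G =
     {z. (\<forall>(u, v) \<in> G. L2_eq v (\<lambda>\<theta>. z *s u \<theta>) \<longrightarrow> L2_eq u (\<lambda>_. 0)) \<and>
         (\<exists>C. \<forall>w \<in> L2_space. \<exists>(u, v) \<in> G.
            L2_eq (\<lambda>\<theta>. v \<theta> - z *s u \<theta>) w \<and> L2_norm u \<le> C * L2_norm w)}"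

definition op_spectrum ::
    "((real \<Rightarrow> complex ^ 'n) \<times> (real \<Rightarrow> complex ^ 'n)) set \<Rightarrow> complex set" where
  "op_spectrum G = - resolvent_set G"

definition eigenspace ::
    "((real \<Rightarrow> complex ^ 'n) \<times> (real \<Rightarrow> complex ^ 'n)) set \<Rightarrow> complex
       \<Rightarrow> (real \<Rightarrow> complex ^ 'n) set" where
  "eigenspace G z = {u. \<exists>v. (u, v) \<in> G \<and> L2_eq v (\<lambda>\<theta>. z *s u \<theta>)}"

definition simple_eigenvalue ::
    "((real \<Rightarrow> complex ^ 'n) \<times> (real \<Rightarrow> complex ^ 'n)) set \<Rightarrow> complex \<Rightarrow> bool" where
  "simple_eigenvalue G z \<longleftrightarrow>
     (\<exists>e \<in> eigenspace G z. \<not> L2_eq e (\<lambda>_. 0) \<and>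
        (\<forall>u \<in> eigenspace G z. \<exists>c. L2_eq u (\<lambda>\<theta>. c *s e \<theta>)))"


section \<open>Matrices of operators and formal adjoints\<close>

type_synonym sop = "(real \<Rightarrow> complex) \<Rightarrow> (real \<Rightarrow> complex)"

definition sop_scale :: "real \<Rightarrow> sop \<Rightarrow> sop" where
  "sop_scale c A = (\<lambda>f \<theta>. of_real c * A f \<theta>)"

text \<open>Formal adjoint with respect to \<open>L\<^sup>2(\<real>)\<close>, as an operator on Schwartz functions. The defining
  condition determines \<open>h\<close> uniquely; nothing is claimed about arguments \<open>g\<close> for which no such
  \<open>h\<close> exists.\<close>

definition sop_adjoint :: "sop \<Rightarrow> sop" where
  "sop_adjoint A g =
     (THE h. h \<in> schwartz \<and> (\<forall>f \<in> schwartz. L2_inner (A f) g = L2_inner f h))"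

definition opmat_apply ::
    "sop ^ 'n ^ 'm \<Rightarrow> (real \<Rightarrow> complex ^ 'n) \<Rightarrow> (real \<Rightarrow> complex ^ 'm)" where
  "opmat_apply M f = (\<lambda>\<theta>. \<chi> i. \<Sum>j\<in>UNIV. (M $ i $ j) (\<lambda>t. f t $ j) \<theta>)"

definition opmat_adjoint :: "sop ^ 'n ^ 'm \<Rightarrow> sop ^ 'm ^ 'n" where
  "opmat_adjoint M = (\<chi> i j. sop_adjoint (M $ j $ i))"

text \<open>The closure of \<open>M\<^sup>* M\<close>, where \<open>M\<^sup>* M\<close> has the Schwartz space as its domain.\<close>

definition adjoint_comp_graph ::
    "sop ^ 'n ^ 'm \<Rightarrow> ((real \<Rightarrow> complex ^ 'n) \<times> (real \<Rightarrow> complex ^ 'n)) set" where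
  "adjoint_comp_graph M =
     closure_graph schwartz_vec (\<lambda>f. opmat_apply (opmat_adjoint M) (opmat_apply M f))"


section \<open>The Schroedinger representation and the Rumin differentials\<close>

definition X1 :: "real \<Rightarrow> sop" where
  "X1 h f = (\<lambda>\<theta>. of_real (sqrt \<bar>h\<bar>) * vderiv f \<theta>)"

definition X2 :: "real \<Rightarrow> sop" where
  "X2 h f = (\<lambda>\<theta>. \<i> * of_real (sgn h * sqrt \<bar>h\<bar> * \<theta>) * f \<theta>)"

definition X3 :: "real \<Rightarrow> sop" where
  "X3 h f = (\<lambda>\<theta>. \<i> * of_real h * f \<theta>)"

lemma X3_eq_commutator:
  assumes "f \<in> schwartz"
  shows "X3 h f = X1 h (X2 h f) - X2 h (X1 h f)"
proof
  fix \<theta> :: real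
  have "(vderiv ^^ 0) f differentiable_on UNIV"
    using assms unfolding schwartz_def by blast
  then have "f differentiable (at \<theta>)"
    by (simp add: differentiable_on_def)
  then have f: "(f has_vector_derivative vderiv f \<theta>) (at \<theta>)"
    by (simp add: vderiv_def vector_derivative_works[symmetric])
  define c where "c = \<i> * of_real (sgn h * sqrt \<bar>h\<bar>)"
  have g: "((\<lambda>t. of_real t * f t) has_vector_derivative
         (of_real \<theta> * vderiv f \<theta> + of_real 1 * f \<theta>)) (at \<theta>)"
    by (rule has_vector_derivative_mult[OF has_vector_derivative_of_real f])
       (auto intro: DERIV_ident)
  have "((\<lambda>t. c * (of_real t * f t)) has_vector_derivative
         (c * (of_real \<theta> * vderiv f \<theta> + of_real 1 * f \<theta>))) (at \<theta>)"
    by (rule has_vector_derivative_mult_right[OF g])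
  then have d: "vderiv (X2 h f) \<theta> = c * (of_real \<theta> * vderiv f \<theta> + f \<theta>)"
    unfolding vderiv_def X2_def c_def
    by (intro vector_derivative_at) (simp add: mult.assoc)
  have "sqrt \<bar>h\<bar> * (sgn h * sqrt \<bar>h\<bar>) = h"
    by (metis abs_ge_zero mult.commute mult.left_commute real_sqrt_mult_self sgn_mult_abs abs_abs mult.assoc)
  then have "of_real (sqrt \<bar>h\<bar>) * c = \<i> * of_real h"
    unfolding c_def by (metis mult.left_commute of_real_mult)
  then have e: "\<i> * of_real h = c * of_real (sqrt \<bar>h\<bar>)"
    by (simp add: mult.commute)
  have "X1 h (X2 h f) \<theta> = of_real (sqrt \<bar>h\<bar>) * (c * (of_real \<theta> * vderiv f \<theta> + f \<theta>))"
    by (simp add: X1_def d)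
  moreover have "X2 h (X1 h f) \<theta> = of_real (sqrt \<bar>h\<bar>) * (c * (of_real \<theta> * vderiv f \<theta>))"
    by (simp add: X1_def X2_def c_def mult_ac)
  ultimately show "X3 h f \<theta> = (X1 h (X2 h f) - X2 h (X1 h f)) \<theta>"
    by (simp add: e X3_def algebra_simps)
qed

text \<open>\<open>Xw h [j\<^sub>1, \<dots>, j\<^sub>k]\<close> is the composition \<open>X\<^sub>j\<^sub>1 \<circ> \<dots> \<circ> X\<^sub>j\<^sub>k\<close>.\<close>

definition Xgen :: "real \<Rightarrow> nat \<Rightarrow> sop" where
  "Xgen h j = (if j = 1 then X1 h else if j = 2 then X2 h else X3 h)"

definition Xw :: "real \<Rightarrow> nat list \<Rightarrow> sop" where
  "Xw h js = foldr (\<lambda>j A. Xgen h j \<circ> A) js id"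

text \<open>Sums, differences and \<open>0\<close> of operators below are the pointwise ones.\<close>

definition D1 :: "real \<Rightarrow> sop ^ 2 ^ 3" where
  "D1 h = vector
     [vector [- Xw h [1,1,2] - Xw h [1,3],          Xw h [1,1,1]],
      vector [sop_scale (- sqrt 2) (Xw h [1,2,2]),  sop_scale (sqrt 2) (Xw h [2,1,1])],
      vector [- Xw h [2,2,2],                       Xw h [2,2,1] - Xw h [2,3]]]"

definition D2 :: "real \<Rightarrow> sop ^ 3 ^ 3" where
  "D2 h = vector
     [vector [- Xw h [1,2] - Xw h [3],
              sop_scale (1 / sqrt 2) (Xw h [1,1]),
              0],
      vector [sop_scale (- 1 / sqrt 2) (Xw h [2,2]),
              sop_scale (- 3 / 2) (Xw h [3]),
              sop_scale (1 / sqrt 2) (Xw h [1,1])],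
      vector [0,
              sop_scale (- 1 / sqrt 2) (Xw h [2,2]),
              Xw h [2,1] - Xw h [3]]]"

end

theory Submission
  imports Defs "HOL-Probability.Probability" "HOL-Real_Asymp.Real_Asymp"
begin

text \<open>In terms of \<open>A = d/dt + t\<close> and \<open>A\<^sup>* = t - d/dt\<close>, and after a unitary change of basis of \<open>\<complex>\<^sup>2\<close>
  and \<open>\<complex>\<^sup>3\<close>, the operators \<open>D\<^sup>* D\<close> preserve the finite-dimensional blocks spanned by
  \<open>(\<psi>\<^bsub>n-1\<^esub>, \<psi>\<^bsub>n+1\<^esub>)\<close> and \<open>(\<psi>\<^bsub>n-2\<^esub>, \<psi>\<^bsub>n\<^esub>, \<psi>\<^bsub>n+2\<^esub>)\<close>, where \<open>\<psi>\<^sub>k\<close> are Hermite functions, zero for negative \<open>k\<close>.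
  Each block contains at most one kernel vector in addition to one eigenvector (for \<open>D\<^sub>1\<close>) or two
  (for \<open>D\<^sub>2\<close>). The operator \<open>D\<^sub>2\<close> composed with \<open>(x, y, z) \<mapsto> (z, - y, x)\<close> is skew, so that \<open>D\<^sub>2\<^sup>* D\<^sub>2\<close> is
  minus the square of this composition, and in block \<open>n\<close> the eigenvalues of the latter are determined
  by the quadratic equation \<open>\<nu>\<^sup>2 + 10 \<nu> + 16 = 8 (2 n + 1)\<^sup>2\<close>. Since the Hermite functions are complete
  (Fourier transform and Levy uniqueness), this yields an orthogonal eigenbasis of Schwartz functions
  whose nonzero eigenvalues tend to infinity, and the resolvent is an explicit series.\<close>

section \<open>Square integrable vector-valued functions\<close>

text \<open>The blocks are weight spaces: rotating the plane of X_1 and X_2 preserves the bracket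
  relations, the harmonic oscillator implements the rotation on functions, and both differentials
  respect the total weight. The kernel vectors come from the complex itself: for D_1 they are the
  images of Hermite functions under the gradient (X_1, X_2), for D_2 the images of eigenvectors
  under D_1. Three obstacles shape the rest. The kernel is infinite dimensional, so orthogonality
  inside it cannot come from eigenvalues; it comes from kernel vectors of different blocks having no
  Hermite coordinate in common. Off the kernel, orthogonality and simplicity both rest on the
  nonzero eigenvalues being pairwise distinct, which for D_2 is an arithmetic fact about sqrt(8 m^2
  + 9) with m odd. Finally, Hermite functions of negative index vanish, so small blocks lose
  dimensions and the generic eigenvector may become zero; the missing eigenvalue then sits in a
  block of negative index.\<close>

definition cdot :: "complex ^ 'n \<Rightarrow> complex ^ 'n \<Rightarrow> complex" where
  "cdot x y = (\<Sum>i\<in>UNIV. x $ i * cnj (y $ i))"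

definition L2_ip :: "(real \<Rightarrow> complex ^ 'n) \<Rightarrow> (real \<Rightarrow> complex ^ 'n) \<Rightarrow> complex" where
  "L2_ip u v = (LINT t|lborel. cdot (u t) (v t))"

lemma cdot_add_left: "cdot (x + y) z = cdot x z + cdot y z"
  by (simp add: cdot_def sum.distrib algebra_simps)

lemma cdot_scale_left: "cdot (c *s x) z = c * cdot x z"
  by (simp add: cdot_def sum_distrib_left mult_ac)

lemma cnj_cdot: "cnj (cdot x y) = cdot y x"
  by (simp add: cdot_def mult.commute)

lemma cdot_self: "cdot x x = of_real ((norm x)\<^sup>2)"
  by (simp add: cdot_def norm_vec_def L2_set_def sum_nonneg complex_mult_cnj cmod_power2)

lemma norm_cdot_le: "norm (cdot x y) \<le> norm x * norm y"
proof -
  have "norm (cdot x y) \<le> (\<Sum>i\<in>UNIV. \<bar>norm (x $ i)\<bar> * \<bar>norm (y $ i)\<bar>)"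
    unfolding cdot_def by (rule order_trans[OF norm_sum]) (simp add: norm_mult)
  also have "\<dots> \<le> norm x * norm y"
    unfolding norm_vec_def by (rule L2_set_mult_ineq)
  finally show ?thesis .
qed

lemma norm_scale_vec: "norm (c *s (x :: complex ^ 'n)) = norm c * norm x"
  by (simp add: norm_vec_def norm_mult L2_set_right_distrib)

lemma measurable_vec_nth [measurable (raw)]:
  assumes "f \<in> borel_measurable M"
  shows "(\<lambda>t. (f t :: complex ^ 'n) $ i) \<in> borel_measurable M"
  by (rule borel_measurable_continuous_on[OF _ assms]) (intro continuous_intros)

lemma measurable_cdot [measurable (raw)]:
  assumes [measurable]: "f \<in> borel_measurable M" "g \<in> borel_measurable M"
  shows "(\<lambda>t. cdot (f t :: complex ^ 'n) (g t)) \<in> borel_measurable M"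
proof -
  have "continuous_on UNIV (\<lambda>z. cnj z)" by (intro continuous_intros)
  note [measurable (raw)] = borel_measurable_continuous_on[OF this]
  show ?thesis unfolding cdot_def by measurable
qed

lemma measurable_scale_vec [measurable (raw)]:
  assumes "f \<in> borel_measurable M"
  shows "(\<lambda>t. c *s (f t :: complex ^ 'n)) \<in> borel_measurable M"
proof -
  have "continuous_on UNIV (\<lambda>x :: complex ^ 'n. c *s x)"
    unfolding vector_scalar_mult_def by (intro continuous_intros)
  then show ?thesis
    by (rule borel_measurable_continuous_on[OF _ assms])
qed

lemma L2_spaceD:
  assumes "f \<in> L2_space"
  shows "f \<in> borel_measurable lborel" "integrable lborel (\<lambda>t. (norm (f t))\<^sup>2)"
  using assms by (auto simp: L2_space_def)

lemma norm_add_sq_le: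
  fixes x y :: "'a::real_normed_vector"
  shows "(norm (x + y))\<^sup>2 \<le> 2 * (norm x)\<^sup>2 + 2 * (norm y)\<^sup>2"
proof -
  have "(norm (x + y))\<^sup>2 \<le> (norm x + norm y)\<^sup>2"
    by (intro power_mono norm_triangle_ineq norm_ge_zero)
  moreover have "0 \<le> (norm x - norm y)\<^sup>2" by simp
  ultimately show ?thesis by (simp add: power2_eq_square algebra_simps)
qed

lemma L2_space_add:
  assumes "f \<in> L2_space" "g \<in> L2_space"
  shows "(\<lambda>t. f t + g t) \<in> L2_space"
proof -
  note [measurable] = L2_spaceD(1)[OF assms(1)] L2_spaceD(1)[OF assms(2)]
  have "integrable lborel (\<lambda>t. (norm (f t + g t))\<^sup>2)"
    by (rule Bochner_Integration.integrable_bound[where f = "\<lambda>t. 2 * (norm (f t))\<^sup>2 + 2 * (norm (g t))\<^sup>2"])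
       (use L2_spaceD(2)[OF assms(1)] L2_spaceD(2)[OF assms(2)] in \<open>auto intro!: norm_add_sq_le\<close>)
  then show ?thesis by (simp add: L2_space_def)
qed

lemma L2_space_scale:
  assumes "f \<in> L2_space"
  shows "(\<lambda>t. c *s f t) \<in> L2_space"
  using L2_spaceD[OF assms] by (auto simp: L2_space_def norm_scale_vec power_mult_distrib)

lemma L2_space_zero: "(\<lambda>t. 0) \<in> L2_space"
  by (simp add: L2_space_def)

lemma L2_space_diff:
  assumes "f \<in> L2_space" "g \<in> L2_space"
  shows "(\<lambda>t. f t - g t) \<in> L2_space"
proof -
  have "(- 1) *s g t = - g t" for t
    by (simp add: vec_eq_iff)
  then show ?thesis
    using L2_space_add[OF assms(1) L2_space_scale[OF assms(2), of "- 1"]] by simp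
qed

lemma L2_space_sum:
  assumes "\<And>i. i \<in> I \<Longrightarrow> f i \<in> L2_space"
  shows "(\<lambda>t. \<Sum>i\<in>I. f i t) \<in> L2_space"
  using assms
  by (induction I rule: infinite_finite_induct) (auto simp: L2_space_zero intro!: L2_space_add)

lemma integrable_cdot:
  assumes "f \<in> L2_space" "g \<in> L2_space"
  shows "integrable lborel (\<lambda>t. cdot (f t) (g t))"
proof -
  note [measurable] = L2_spaceD(1)[OF assms(1)] L2_spaceD(1)[OF assms(2)]
  have "norm (cdot (f t) (g t)) \<le> norm ((norm (f t))\<^sup>2 + (norm (g t))\<^sup>2)" for t
  proof -
    have "0 \<le> (norm (f t) - norm (g t))\<^sup>2" by simp
    moreover have "0 \<le> norm (f t) * norm (g t)" by simp
    ultimately have "norm (f t) * norm (g t) \<le> (norm (f t))\<^sup>2 + (norm (g t))\<^sup>2"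
      unfolding power2_diff by linarith
    then show ?thesis using norm_cdot_le[of "f t" "g t"] by simp
  qed
  note bound = this
  show ?thesis
  proof (rule Bochner_Integration.integrable_bound)
    show "integrable lborel (\<lambda>t. (norm (f t))\<^sup>2 + (norm (g t))\<^sup>2)"
      by (intro Bochner_Integration.integrable_add L2_spaceD(2) assms)
    show "AE t in lborel. norm (cdot (f t) (g t)) \<le> norm ((norm (f t))\<^sup>2 + (norm (g t))\<^sup>2)"
      by (intro AE_I2 bound)
  qed measurable
qed

lemma L2_ip_add_left:
  assumes "u \<in> L2_space" "v \<in> L2_space" "w \<in> L2_space"
  shows "L2_ip (\<lambda>t. u t + v t) w = L2_ip u w + L2_ip v w"
  by (simp add: L2_ip_def cdot_add_left integrable_cdot assms)

lemma L2_ip_scale_left: "L2_ip (\<lambda>t. c *s u t) w = c * L2_ip u w"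
  by (simp add: L2_ip_def cdot_scale_left)

lemma cnj_L2_ip: "cnj (L2_ip u v) = L2_ip v u"
  using Bochner_Integration.integral_cnj[of lborel "\<lambda>t. cdot (u t) (v t)"] by (simp add: L2_ip_def cnj_cdot)

lemma L2_ip_zero_left: "L2_ip (\<lambda>t. 0) w = 0"
  by (simp add: L2_ip_def cdot_def)

lemma L2_ip_diff_left:
  assumes "u \<in> L2_space" "v \<in> L2_space" "w \<in> L2_space"
  shows "L2_ip (\<lambda>t. u t - v t) w = L2_ip u w - L2_ip v w"
proof -
  have "L2_ip (\<lambda>t. (u t - v t) + v t) w = L2_ip (\<lambda>t. u t - v t) w + L2_ip v w"
    by (intro L2_ip_add_left L2_space_diff assms)
  then show ?thesis by simp
qed

lemma L2_ip_diff_right: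
  assumes "u \<in> L2_space" "v \<in> L2_space" "w \<in> L2_space"
  shows "L2_ip w (\<lambda>t. u t - v t) = L2_ip w u - L2_ip w v"
  by (metis L2_ip_diff_left[OF assms] cnj_L2_ip complex_cnj_diff)

lemma L2_ip_scale_right: "L2_ip w (\<lambda>t. c *s u t) = cnj c * L2_ip w u"
  by (metis L2_ip_scale_left cnj_L2_ip complex_cnj_mult)

lemma L2_ip_sum_left:
  assumes "\<And>i. i \<in> I \<Longrightarrow> f i \<in> L2_space" "w \<in> L2_space"
  shows "L2_ip (\<lambda>t. \<Sum>i\<in>I. f i t) w = (\<Sum>i\<in>I. L2_ip (f i) w)"
  using assms
  by (induction I rule: infinite_finite_induct)
     (auto simp: L2_ip_zero_left L2_ip_add_left L2_space_sum)

lemma L2_ip_self: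
  shows "L2_ip u u = of_real ((L2_norm u)\<^sup>2)"
  unfolding L2_ip_def cdot_self integral_complex_of_real by (simp add: L2_norm_def)

lemma L2_norm_nonneg: "0 \<le> L2_norm u"
  by (simp add: L2_norm_def)

lemma L2_norm_eq_0:
  assumes "u \<in> L2_space"
  shows "L2_norm u = 0 \<longleftrightarrow> L2_eq u (\<lambda>_. 0)"
  unfolding L2_norm_def L2_eq_def
  using integral_nonneg_eq_0_iff_AE[OF L2_spaceD(2)[OF assms]] by simp

text \<open>Cauchy-Schwarz, from the squared norm of \<open>u - s c v\<close> with
  \<open>c = L2_ip u v\<close>, which is a nonnegative quadratic polynomial in the real variable
  \<open>s\<close>.\<close>

lemma norm_L2_ip_le:
  assumes u: "u \<in> L2_space" and v: "v \<in> L2_space"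
  shows "norm (L2_ip u v) \<le> L2_norm u * L2_norm v"
proof (cases "L2_ip u v = 0")
  case True
  then show ?thesis by (simp add: L2_norm_nonneg)
next
  case False
  define c where "c = L2_ip u v"
  define a where "a = (L2_norm u)\<^sup>2"
  define b where "b = (L2_norm v)\<^sup>2"
  have key: "0 \<le> a - 2 * s * (norm c)\<^sup>2 + s\<^sup>2 * (norm c)\<^sup>2 * b" for s :: real
  proof -
    let ?z = "of_real s * c"
    have sv: "(\<lambda>t. ?z *s v t) \<in> L2_space" by (rule L2_space_scale[OF v])
    have "L2_ip (\<lambda>t. u t - ?z *s v t) (\<lambda>t. u t - ?z *s v t)
        = L2_ip u u - cnj ?z * L2_ip u v - ?z * L2_ip v u + ?z * cnj ?z * L2_ip v v"
      by (simp only: L2_ip_diff_left[OF u sv L2_space_diff[OF u sv]] L2_ip_diff_right[OF u sv u]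
          L2_ip_diff_right[OF u sv sv] L2_ip_scale_left L2_ip_scale_right) (simp add: algebra_simps)
    also have "\<dots> = of_real (a - 2 * s * (norm c)\<^sup>2 + s\<^sup>2 * (norm c)\<^sup>2 * b)"
      unfolding L2_ip_self a_def[symmetric] b_def[symmetric] cnj_L2_ip[of u v, symmetric] c_def[symmetric]
      by (simp add: complex_norm_square power2_eq_square[of s] mult_ac del: of_real_power)
    finally have "of_real ((L2_norm (\<lambda>t. u t - ?z *s v t))\<^sup>2)
        = (of_real (a - 2 * s * (norm c)\<^sup>2 + s\<^sup>2 * (norm c)\<^sup>2 * b) :: complex)"
      by (simp only: L2_ip_self)
    then have "(L2_norm (\<lambda>t. u t - ?z *s v t))\<^sup>2 = a - 2 * s * (norm c)\<^sup>2 + s\<^sup>2 * (norm c)\<^sup>2 * b"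
      by (simp only: of_real_eq_iff)
    then show ?thesis by (metis zero_le_power2)
  qed
  have c2: "0 < (norm c)\<^sup>2" using False by (simp add: c_def)
  \<comment> \<open>For \<open>b = 0\<close> the polynomial would be affine with negative slope; at
    \<open>s = (a + 1) / |c|^2\<close> its value would be \<open>- a - 2\<close>.\<close>
  have "b \<noteq> 0"
  proof
    assume "b = 0"
    then have "0 \<le> a - 2 * ((a + 1) / (norm c)\<^sup>2) * (norm c)\<^sup>2"
      using key[of "(a + 1) / (norm c)\<^sup>2"] by simp
    then have "0 \<le> a - 2 * (a + 1)" using c2 by simp
    moreover have "0 \<le> a" by (simp add: a_def)
    ultimately show False by simp
  qed
  then have b: "0 < b" by (simp add: b_def)
  \<comment> \<open>The quadratic attains its minimum at \<open>s = 1 / b\<close>.\<close>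
  have "0 \<le> a - (norm c)\<^sup>2 / b"
    using key[of "1 / b"] b by (simp add: power2_eq_square field_simps)
  then have "(norm c)\<^sup>2 \<le> a * b" using b by (simp add: field_simps)
  then have "(norm c)\<^sup>2 \<le> (L2_norm u * L2_norm v)\<^sup>2"
    by (simp add: a_def b_def power_mult_distrib)
  then show ?thesis
    unfolding c_def by (rule power2_le_imp_le) (simp add: L2_norm_nonneg)
qed

section \<open>Convergence in mean and completeness of the space\<close>

lemma L2_ip_tendsto_left:
  assumes "\<And>k. f k \<in> L2_space" "u \<in> L2_space" "w \<in> L2_space"
    and lim: "(\<lambda>k. L2_norm (\<lambda>t. f k t - u t)) \<longlonglongrightarrow> 0"
  shows "(\<lambda>k. L2_ip (f k) w) \<longlonglongrightarrow> L2_ip u w"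
proof -
  have "(\<lambda>k. L2_ip (f k) w - L2_ip u w) \<longlonglongrightarrow> 0"
  proof (rule Lim_null_comparison)
    show "\<forall>\<^sub>F k in sequentially. norm (L2_ip (f k) w - L2_ip u w)
            \<le> L2_norm (\<lambda>t. f k t - u t) * L2_norm w"
      by (intro always_eventually allI, subst L2_ip_diff_left[symmetric])
         (auto intro!: norm_L2_ip_le L2_space_diff assms(1-3))
    show "(\<lambda>k. L2_norm (\<lambda>t. f k t - u t) * L2_norm w) \<longlonglongrightarrow> 0"
      using tendsto_mult_right[OF lim, of "L2_norm w"] by simp
  qed
  then show ?thesis by (simp add: LIM_zero_iff)
qed

lemma nn_integral_norm_sq:
  assumes "u \<in> L2_space"
  shows "(\<integral>\<^sup>+t. ennreal ((norm (u t))\<^sup>2) \<partial>lborel) = ennreal ((L2_norm u)\<^sup>2)"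
  using nn_integral_eq_integral[OF L2_spaceD(2)[OF assms]] by (simp add: L2_norm_def)

text \<open>A rapidly converging subsequence converges pointwise almost everywhere, and Fatou's
  lemma turns its pointwise limit into a limit in mean of the whole sequence.\<close>

lemma L2_complete:
  fixes f :: "nat \<Rightarrow> real \<Rightarrow> complex ^ 'n"
  assumes f: "\<And>k. f k \<in> L2_space"
    and cauchy: "\<And>\<epsilon>. 0 < \<epsilon> \<Longrightarrow> \<exists>N. \<forall>m\<ge>N. \<forall>n\<ge>N. (L2_norm (\<lambda>t. f m t - f n t))\<^sup>2 \<le> \<epsilon>"
  obtains u where "u \<in> L2_space" "(\<lambda>k. L2_norm (\<lambda>t. f k t - u t)) \<longlonglongrightarrow> 0"
proof -
  note [measurable] = L2_spaceD(1)[OF f]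
  have "\<forall>k. \<exists>N. \<forall>m\<ge>N. \<forall>n\<ge>N. (L2_norm (\<lambda>t. f m t - f n t))\<^sup>2 \<le> (1/8::real)^k"
    using cauchy by simp
  then obtain N where N: "\<And>k m n. m \<ge> N k \<Longrightarrow> n \<ge> N k \<Longrightarrow> (L2_norm (\<lambda>t. f m t - f n t))\<^sup>2 \<le> (1/8::real)^k"
    by metis
  \<comment> \<open>Summing the thresholds makes \<open>r\<close> monotone and at least
    \<open>N k\<close>; the added \<open>k\<close> makes it tend to infinity.\<close>
  define r where "r k = (\<Sum>i\<le>k. N i) + k" for k
  have r: "N k \<le> r k" "r k \<le> r (Suc k)" "k \<le> r k" for k
    by (auto simp: r_def member_le_sum trans_le_add1)
  define g where "g k = f (r k)" for k
  have gL: "g k \<in> L2_space" for k by (simp add: g_def f)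
  note [measurable] = L2_spaceD(1)[OF gL]
  \<comment> \<open>The weight 2^k is affordable because the squared norms decay like (1/8)^k, and
    it is what turns summable squares into summable norms below.\<close>
  define a where "a k t = 2 ^ k * (norm (g (Suc k) t - g k t))\<^sup>2" for k t
  have [measurable]: "a k \<in> borel_measurable lborel" for k
    unfolding a_def by measurable
  have "(\<integral>\<^sup>+t. (\<Sum>k. ennreal (a k t)) \<partial>lborel) = (\<Sum>k. \<integral>\<^sup>+t. ennreal (a k t) \<partial>lborel)"
    by (rule nn_integral_suminf) measurable
  also have "\<dots> \<le> (\<Sum>k. ennreal ((1/4) ^ k))"
  proof (intro suminf_le)
    fix k
    have "(\<integral>\<^sup>+t. ennreal (a k t) \<partial>lborel)
        = ennreal (2 ^ k) * (\<integral>\<^sup>+t. ennreal ((norm (g (Suc k) t - g k t))\<^sup>2) \<partial>lborel)"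
      unfolding a_def by (subst nn_integral_cmult[symmetric]) (auto simp: ennreal_mult)
    also have "\<dots> = ennreal (2 ^ k) * ennreal ((L2_norm (\<lambda>t. g (Suc k) t - g k t))\<^sup>2)"
      by (subst nn_integral_norm_sq) (auto intro: L2_space_diff gL)
    also have "\<dots> \<le> ennreal (2 ^ k) * ennreal ((1/8) ^ k)"
      unfolding g_def using r by (intro mult_left_mono ennreal_leI N) (auto intro: order_trans)
    also have "\<dots> = ennreal ((1/4) ^ k)"
      by (subst ennreal_mult[symmetric]) (auto simp: power_mult_distrib[symmetric])
    finally show "(\<integral>\<^sup>+t. ennreal (a k t) \<partial>lborel) \<le> ennreal ((1/4) ^ k)" .
  qed auto
  also have "\<dots> = ennreal (\<Sum>k. (1/4) ^ k)"
    by (rule suminf_ennreal2) (auto intro: summable_geometric)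
  finally have "(\<integral>\<^sup>+t. (\<Sum>k. ennreal (a k t)) \<partial>lborel) \<noteq> \<infinity>"
    by (auto simp: top_unique)
  then have "AE t in lborel. (\<Sum>k. ennreal (a k t)) \<noteq> \<infinity>"
    by (intro nn_integral_noteq_infinite) auto
  then have conv: "AE t in lborel. convergent (\<lambda>k. g k t)"
  proof eventually_elim
    case (elim t)
    then have "summable (\<lambda>k. a k t)"
      by (intro summable_suminf_not_top) (auto simp: a_def)
    then have s: "summable (\<lambda>k. a k t + (1/2)^k)"
      by (intro summable_add summable_geometric) auto
    have "summable (\<lambda>k. g (Suc k) t - g k t)"
    proof (rule summable_comparison_test'[OF s])
      fix k
      let ?x = "norm (g (Suc k) t - g k t)"
      \<comment> \<open>Yields x <= 2^k x^2 + 2^(-k), so the increments are dominated by a summable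
        sequence.\<close>
      have "0 \<le> (2 ^ k * ?x - 1)\<^sup>2" by simp
      then have "2 * (2 ^ k * ?x) \<le> 2 ^ k * (2 ^ k * ?x\<^sup>2) + 1"
        by (simp add: power2_eq_square algebra_simps)
      moreover have "0 \<le> 2 ^ k * ?x" by simp
      ultimately have "2 ^ k * ?x \<le> 2 ^ k * (a k t) + 1"
        unfolding a_def by linarith
      then have "2 ^ k * ?x \<le> 2 ^ k * (a k t + (1/2)^k)"
        by (simp add: algebra_simps power_divide)
      then show "?x \<le> a k t + (1/2)^k"
        by simp
    qed
    then have "convergent (\<lambda>n. \<Sum>k<n. g (Suc k) t - g k t)"
      by (simp add: summable_iff_convergent)
    then have "convergent (\<lambda>n. (\<Sum>k<n. g (Suc k) t - g k t) + g 0 t)"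
      by (intro convergent_add convergent_const)
    moreover have "(\<Sum>k<n. g (Suc k) t - g k t) + g 0 t = g n t" for n
      using sum_lessThan_telescope[of "\<lambda>k. g k t" n] by simp
    ultimately show ?case by simp
  qed
  define u where "u t = lim (\<lambda>k. g k t)" for t
  have [measurable]: "u \<in> borel_measurable lborel"
    unfolding u_def by measurable
  have fatou: "(\<integral>\<^sup>+t. ennreal ((norm (f n t - u t))\<^sup>2) \<partial>lborel) \<le> ennreal ((1/8) ^ k)" if n: "n \<ge> N k" for n k
  proof -
    have "(\<integral>\<^sup>+t. ennreal ((norm (f n t - u t))\<^sup>2) \<partial>lborel)
        = (\<integral>\<^sup>+t. liminf (\<lambda>j. ennreal ((norm (f n t - g j t))\<^sup>2)) \<partial>lborel)"
    proof (rule nn_integral_cong_AE)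
      show "AE t in lborel. ennreal ((norm (f n t - u t))\<^sup>2) = liminf (\<lambda>j. ennreal ((norm (f n t - g j t))\<^sup>2))"
        using conv
      proof eventually_elim
        case (elim t)
        then have "(\<lambda>k. g k t) \<longlonglongrightarrow> u t"
          unfolding u_def by (simp add: convergent_LIMSEQ_iff)
        then have "(\<lambda>j. ennreal ((norm (f n t - g j t))\<^sup>2)) \<longlonglongrightarrow> ennreal ((norm (f n t - u t))\<^sup>2)"
          by (intro tendsto_intros)
        then show ?case
          by (intro lim_imp_Liminf[symmetric]) auto
      qed
    qed
    also have "\<dots> \<le> liminf (\<lambda>j. \<integral>\<^sup>+t. ennreal ((norm (f n t - g j t))\<^sup>2) \<partial>lborel)"
      by (rule nn_integral_liminf) measurable
    also have "\<dots> = liminf (\<lambda>j. ennreal ((L2_norm (\<lambda>t. f n t - g j t))\<^sup>2))"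
      by (subst nn_integral_norm_sq) (auto intro: L2_space_diff gL f)
    also have "\<dots> \<le> ennreal ((1/8) ^ k)"
    proof (rule Liminf_le)
      show "\<forall>\<^sub>F j in sequentially. ennreal ((L2_norm (\<lambda>t. f n t - g j t))\<^sup>2) \<le> ennreal ((1/8) ^ k)"
        unfolding g_def using n r(3)
        by (intro eventually_sequentiallyI[of "N k"] ennreal_leI N) (auto intro: order_trans)
    qed auto
    finally show ?thesis .
  qed
  have diffL: "(\<lambda>t. f n t - u t) \<in> L2_space" if "n \<ge> N k" for n k
    unfolding L2_space_def
    using fatou[OF that] by (auto intro!: integrableI_bounded intro: order_le_less_trans)
  have "(\<lambda>t. f (N 0) t - (f (N 0) t - u t)) \<in> L2_space"
    by (intro L2_space_diff f diffL[of 0]) simp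
  then have uL: "u \<in> L2_space" by simp
  have bound: "(L2_norm (\<lambda>t. f n t - u t))\<^sup>2 \<le> (1/8) ^ k" if n: "n \<ge> N k" for n k
    using fatou[OF n] nn_integral_norm_sq[OF diffL[OF n]] by simp
  have "(\<lambda>n. (L2_norm (\<lambda>t. f n t - u t))\<^sup>2) \<longlonglongrightarrow> 0"
  proof (rule LIMSEQ_I)
    fix e :: real assume "0 < e"
    then obtain k where "(1/8::real) ^ k < e"
      using real_arch_pow_inv[of e "1/8"] by auto
    then show "\<exists>no. \<forall>n\<ge>no. norm ((L2_norm (\<lambda>t. f n t - u t))\<^sup>2 - 0) < e"
      using bound[of k] by (intro exI[of _ "N k"]) (auto intro: order_le_less_trans)
  qed
  then have "(\<lambda>n. sqrt ((L2_norm (\<lambda>t. f n t - u t))\<^sup>2)) \<longlonglongrightarrow> sqrt 0"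
    by (rule tendsto_real_sqrt)
  then have "(\<lambda>n. L2_norm (\<lambda>t. f n t - u t)) \<longlonglongrightarrow> 0"
    by (simp add: L2_norm_nonneg)
  with uL show thesis by (rule that)
qed

section \<open>Operators with an orthogonal eigenbasis\<close>

lemma L2_ip_cong_AE:
  assumes "L2_eq u v" "u \<in> L2_space" "v \<in> L2_space" "w \<in> L2_space"
  shows "L2_ip u w = L2_ip v w"
proof -
  note [measurable] = assms(2-4)[THEN L2_spaceD(1)]
  show ?thesis
    unfolding L2_ip_def
  proof (rule integral_cong_AE)
    show "AE t in lborel. cdot (u t) (w t) = cdot (v t) (w t)"
      using assms(1) unfolding L2_eq_def by eventually_elim simp
  qed measurable
qed

lemma L2_ip_sum_right:
  assumes "\<And>i. i \<in> I \<Longrightarrow> f i \<in> L2_space" "w \<in> L2_space"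
  shows "L2_ip w (\<lambda>t. \<Sum>i\<in>I. f i t) = (\<Sum>i\<in>I. L2_ip w (f i))"
proof -
  have "L2_ip w (\<lambda>t. \<Sum>i\<in>I. f i t) = cnj (\<Sum>i\<in>I. L2_ip (f i) w)"
    using L2_ip_sum_left[of I f w] assms cnj_L2_ip[of "\<lambda>t. \<Sum>i\<in>I. f i t" w] by simp
  then show ?thesis by (simp add: cnj_L2_ip)
qed

text \<open>An orthogonal complete system may contain the zero vector; this allows index sets that are
  larger than the set of eigenvectors.\<close>

locale symmetric_eigenbasis =
  fixes S :: "(real \<Rightarrow> complex ^ 'n) set"
    and T :: "(real \<Rightarrow> complex ^ 'n) \<Rightarrow> real \<Rightarrow> complex ^ 'n"
    and e :: "nat \<Rightarrow> real \<Rightarrow> complex ^ 'n" and lam :: "nat \<Rightarrow> real"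
  assumes S_L2: "f \<in> S \<Longrightarrow> f \<in> L2_space"
    and T_L2: "f \<in> S \<Longrightarrow> T f \<in> L2_space"
    and S_add: "f \<in> S \<Longrightarrow> g \<in> S \<Longrightarrow> (\<lambda>t. f t + g t) \<in> S"
    and S_scale: "f \<in> S \<Longrightarrow> (\<lambda>t. c *s f t) \<in> S"
    and T_add: "f \<in> S \<Longrightarrow> g \<in> S \<Longrightarrow> T (\<lambda>t. f t + g t) = (\<lambda>t. T f t + T g t)"
    and T_scale: "f \<in> S \<Longrightarrow> T (\<lambda>t. c *s f t) = (\<lambda>t. c *s T f t)"
    and e_S: "e i \<in> S"
    and T_e: "T (e i) = (\<lambda>t. of_real (lam i) *s e i t)"
    and T_sym: "f \<in> S \<Longrightarrow> L2_ip (T f) (e i) = of_real (lam i) * L2_ip f (e i)"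
    and orth: "i \<noteq> j \<Longrightarrow> L2_ip (e i) (e j) = 0"
    and complete: "u \<in> L2_space \<Longrightarrow> (\<And>i. L2_ip u (e i) = 0) \<Longrightarrow> L2_eq u (\<lambda>_. 0)"
begin

abbreviation G where "G \<equiv> closure_graph S T"

definition lincomb :: "nat set \<Rightarrow> (nat \<Rightarrow> complex) \<Rightarrow> real \<Rightarrow> complex ^ 'n" where
  "lincomb I c t = (\<Sum>i\<in>I. c i *s e i t)"

text \<open>The vectors \<open>e i\<close> are not normalized and may vanish, so their squared norms
  enter all coefficient sums as weights.\<close>

definition nsq :: "nat \<Rightarrow> real" where "nsq i = (L2_norm (e i))\<^sup>2"

lemma nsq_nonneg [simp]: "0 \<le> nsq i" by (simp add: nsq_def)

lemma e_L2: "e i \<in> L2_space"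
  using e_S S_L2 by blast

lemma L2_lincomb: "lincomb I c \<in> L2_space"
  unfolding lincomb_def by (intro L2_space_sum L2_space_scale e_L2)

lemma T_lincomb:
  assumes "finite I"
  shows "lincomb I c \<in> S \<and> T (lincomb I c) = lincomb I (\<lambda>i. of_real (lam i) * c i)"
  using assms
proof induction
  case empty
  \<comment> \<open>The closure rules of the locale produce the zero function only as a multiple of
    some \<open>e i\<close>.\<close>
  have z: "lincomb {} c = (\<lambda>t. 0 *s e 0 t)" for c by (simp add: lincomb_def fun_eq_iff)
  show ?case
    unfolding z using S_scale[OF e_S] by (simp only: T_scale[OF e_S] T_e) simp
next
  case (insert i I)
  have ins: "lincomb (insert i I) c = (\<lambda>t. c i *s e i t + lincomb I c t)" for c
    using insert by (simp add: lincomb_def fun_eq_iff)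
  show ?case
    unfolding ins using insert
    by (auto simp: S_add S_scale e_S T_add T_scale T_e fun_eq_iff mult_ac)
qed

lemma lincomb_ip: "finite I \<Longrightarrow> L2_ip (lincomb I c) (e j) = (if j \<in> I then c j * of_real (nsq j) else 0)"
proof -
  assume I: "finite I"
  have "L2_ip (lincomb I c) (e j) = (\<Sum>i\<in>I. c i * L2_ip (e i) (e j))"
    unfolding lincomb_def by (subst L2_ip_sum_left) (auto intro: L2_space_scale e_L2 simp: L2_ip_scale_left)
  also have "\<dots> = (\<Sum>i\<in>I. if i = j then c j * of_real (nsq j) else 0)"
    by (intro sum.cong) (auto simp: orth L2_ip_self nsq_def)
  finally show ?thesis using I by simp
qed

lemma L2_norm_lincomb:
  assumes "finite I"
  shows "(L2_norm (lincomb I c))\<^sup>2 = (\<Sum>i\<in>I. (norm (c i))\<^sup>2 * nsq i)"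
proof -
  have "complex_of_real ((L2_norm (lincomb I c))\<^sup>2) = L2_ip (lincomb I c) (\<lambda>t. \<Sum>i\<in>I. c i *s e i t)"
    by (simp add: L2_ip_self lincomb_def[abs_def])
  also have "\<dots> = (\<Sum>i\<in>I. L2_ip (lincomb I c) (\<lambda>t. c i *s e i t))"
    by (intro L2_ip_sum_right L2_space_scale e_L2 L2_lincomb)
  also have "\<dots> = (\<Sum>i\<in>I. of_real ((norm (c i))\<^sup>2 * nsq i))"
    using assms
    by (intro sum.cong refl) (simp add: L2_ip_scale_right lincomb_ip complex_norm_square mult_ac del: of_real_power)
  finally show ?thesis by (simp only: of_real_sum[symmetric] of_real_eq_iff)
qed

text \<open>Boundedness of the weighted sums makes the partial expansions Cauchy; the coefficients
  pass to the limit because pairing with a fixed vector is continuous in mean.\<close>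

lemma riesz_fischer:
  assumes bound: "\<And>N. (\<Sum>i<N. (norm (c i))\<^sup>2 * nsq i) \<le> B"
  obtains u where "u \<in> L2_space" "(\<lambda>N. L2_norm (\<lambda>t. lincomb {..<N} c t - u t)) \<longlonglongrightarrow> 0"
    "\<And>j. L2_ip u (e j) = c j * of_real (nsq j)" "(L2_norm u)\<^sup>2 \<le> B"
proof -
  have B: "0 \<le> B" using bound[of 0] by simp
  have sm: "summable (\<lambda>i. (norm (c i))\<^sup>2 * nsq i)"
    by (rule summableI_nonneg_bounded[OF _ bound]) simp
  have diff: "(L2_norm (\<lambda>t. lincomb {..<n} c t - lincomb {..<m} c t))\<^sup>2 = (\<Sum>i\<in>{m..<n}. (norm (c i))\<^sup>2 * nsq i)"
    if "m \<le> n" for m n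
  proof -
    have "lincomb {..<n} c t - lincomb {..<m} c t = lincomb {m..<n} c t" for t
      unfolding lincomb_def using sum_diff_nat_ivl[of 0 m n "\<lambda>i. c i *s e i t"] that
      by (simp add: atLeast0LessThan)
    then have "(\<lambda>t. lincomb {..<n} c t - lincomb {..<m} c t) = lincomb {m..<n} c" by auto
    then show ?thesis by (simp add: L2_norm_lincomb)
  qed
  have comm: "L2_norm (\<lambda>t. f t - g t) = L2_norm (\<lambda>t. g t - f t)" for f g :: "real \<Rightarrow> complex ^ 'n"
    by (simp add: L2_norm_def norm_minus_commute)
  have cauchy: "\<exists>N. \<forall>m\<ge>N. \<forall>n\<ge>N. (L2_norm (\<lambda>t. lincomb {..<m} c t - lincomb {..<n} c t))\<^sup>2 \<le> \<epsilon>"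
    if eps: "0 < \<epsilon>" for \<epsilon> :: real
  proof -
    obtain N where N: "\<And>m n. m \<ge> N \<Longrightarrow> norm (\<Sum>i\<in>{m..<n}. (norm (c i))\<^sup>2 * nsq i) < \<epsilon>"
      using sm[unfolded summable_Cauchy] eps by blast
    have "(L2_norm (\<lambda>t. lincomb {..<m} c t - lincomb {..<n} c t))\<^sup>2 \<le> \<epsilon>" if "N \<le> m" "N \<le> n" for m n
    proof (cases "m \<le> n")
      case True
      show ?thesis
        unfolding comm[of "lincomb {..<m} c"] diff[OF True] using N[OF that(1), of n] by simp
    next
      case False
      then have "n \<le> m" by simp
      show ?thesis unfolding diff[OF \<open>n \<le> m\<close>] using N[OF that(2), of m] by simp
    qed
    then show ?thesis by blast
  qed
  obtain u where u: "u \<in> L2_space" "(\<lambda>N. L2_norm (\<lambda>t. lincomb {..<N} c t - u t)) \<longlonglongrightarrow> 0"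
    using L2_complete[OF L2_lincomb cauchy] by blast
  have ip: "(\<lambda>N. L2_ip (lincomb {..<N} c) w) \<longlonglongrightarrow> L2_ip u w" if "w \<in> L2_space" for w
    by (intro L2_ip_tendsto_left L2_lincomb u that)
  have coeff: "L2_ip u (e j) = c j * of_real (nsq j)" for j
  proof (rule LIMSEQ_unique[OF ip[OF e_L2]])
    show "(\<lambda>N. L2_ip (lincomb {..<N} c) (e j)) \<longlonglongrightarrow> c j * of_real (nsq j)"
      by (rule tendsto_eventually) (auto simp: lincomb_ip eventually_sequentially intro!: exI[of _ "Suc j"])
  qed
  \<comment> \<open>Pairing the partial expansions with \<open>u\<close> itself and passing to the
    limit bounds the norm without a continuity lemma for \<open>L2_norm\<close>.\<close>
  have "(L2_norm u)\<^sup>2 \<le> sqrt B * L2_norm u"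
  proof (rule LIMSEQ_le_const2)
    show "(\<lambda>N. norm (L2_ip (lincomb {..<N} c) u)) \<longlonglongrightarrow> (L2_norm u)\<^sup>2"
      using tendsto_norm[OF ip[OF u(1)]] by (simp add: L2_ip_self norm_power)
    have "norm (L2_ip (lincomb {..<N} c) u) \<le> sqrt B * L2_norm u" for N
    proof -
      have "L2_norm (lincomb {..<N} c) \<le> sqrt B"
        using bound[of N] by (intro real_le_rsqrt) (simp add: L2_norm_lincomb)
      then show ?thesis
        using norm_L2_ip_le[OF L2_lincomb u(1)] by (meson L2_norm_nonneg mult_right_mono order_trans)
    qed
    then show "\<exists>N. \<forall>n\<ge>N. norm (L2_ip (lincomb {..<n} c) u) \<le> sqrt B * L2_norm u" by blast
  qed
  then have "L2_norm u \<le> sqrt B"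
    using L2_norm_nonneg[of u] B by (cases "L2_norm u = 0") (auto simp: power2_eq_square)
  then have "(L2_norm u)\<^sup>2 \<le> B"
    using sqrt_ge_absD[of "L2_norm u" B] L2_norm_nonneg[of u] by simp
  with u coeff show thesis by (intro that)
qed

text \<open>Bessel's inequality, read off from the squared norm of \<open>w\<close> minus its
  partial expansion.\<close>

lemma bessel:
  assumes w: "w \<in> L2_space"
  obtains c where "\<And>j. L2_ip w (e j) = c j * of_real (nsq j)"
    "\<And>N. (\<Sum>i<N. (norm (c i))\<^sup>2 * nsq i) \<le> (L2_norm w)\<^sup>2"
proof -
  \<comment> \<open>If \<open>e j\<close> is zero, the division returns 0 and the identity for
    \<open>c j\<close> becomes 0 = 0.\<close>
  define c where "c j = L2_ip w (e j) / of_real (nsq j)" for j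
  have c: "L2_ip w (e j) = c j * of_real (nsq j)" for j
  proof (cases "nsq j = 0")
    case True
    then have "norm (L2_ip w (e j)) \<le> 0"
      using norm_L2_ip_le[OF w e_L2, of j] by (simp add: nsq_def)
    then show ?thesis by (simp add: c_def True)
  qed (simp add: c_def)
  have "(\<Sum>i<N. (norm (c i))\<^sup>2 * nsq i) \<le> (L2_norm w)\<^sup>2" for N
  proof -
    let ?L = "lincomb {..<N} c"
    let ?s = "\<Sum>i<N. (norm (c i))\<^sup>2 * nsq i"
    have "L2_ip w ?L = (\<Sum>i<N. cnj (c i) * L2_ip w (e i))"
      unfolding lincomb_def[abs_def]
      by (subst L2_ip_sum_right) (auto intro: L2_space_scale e_L2 w simp: L2_ip_scale_right)
    also have "\<dots> = (\<Sum>i<N. of_real ((norm (c i))\<^sup>2 * nsq i))"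
      by (intro sum.cong refl) (simp add: c complex_norm_square mult_ac del: of_real_power)
    finally have wL: "L2_ip w ?L = of_real ?s" by simp
    have LL: "L2_ip ?L ?L = of_real ?s"
      by (simp only: L2_ip_self L2_norm_lincomb[OF finite_lessThan])
    have Lw: "L2_ip ?L w = of_real ?s"
      using wL cnj_L2_ip[of w ?L] by simp
    have "L2_ip (\<lambda>t. w t - ?L t) (\<lambda>t. w t - ?L t) = L2_ip w w - of_real ?s"
      by (simp only: L2_ip_diff_left L2_ip_diff_right w L2_lincomb L2_space_diff wL LL Lw) simp
    then have "complex_of_real ((L2_norm (\<lambda>t. w t - ?L t))\<^sup>2) = of_real ((L2_norm w)\<^sup>2 - ?s)"
      by (simp only: L2_ip_self of_real_diff)
    then have "(L2_norm (\<lambda>t. w t - ?L t))\<^sup>2 = (L2_norm w)\<^sup>2 - ?s"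
      by (simp only: of_real_eq_iff)
    then show ?thesis
      using zero_le_power2[of "L2_norm (\<lambda>t. w t - ?L t)"] by linarith
  qed
  with c show thesis by (rule that)
qed

text \<open>Symmetry against the fixed vector \<open>e i\<close> survives limits in mean, so every
  pair in the closure acts diagonally on coefficients.\<close>

lemma closure_graph_ip:
  assumes "(u, v) \<in> G"
  shows "L2_ip v (e i) = of_real (lam i) * L2_ip u (e i)"
proof -
  obtain f where uv: "u \<in> L2_space" "v \<in> L2_space" and f: "\<And>k. f k \<in> S"
    and lim: "(\<lambda>k. L2_norm (\<lambda>\<theta>. f k \<theta> - u \<theta>)) \<longlonglongrightarrow> 0"
      "(\<lambda>k. L2_norm (\<lambda>\<theta>. T (f k) \<theta> - v \<theta>)) \<longlonglongrightarrow> 0"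
    using assms unfolding closure_graph_def by blast
  have "(\<lambda>k. L2_ip (T (f k)) (e i)) \<longlonglongrightarrow> L2_ip v (e i)"
    by (intro L2_ip_tendsto_left T_L2 f uv e_L2 lim)
  moreover have "(\<lambda>k. L2_ip (T (f k)) (e i)) \<longlonglongrightarrow> of_real (lam i) * L2_ip u (e i)"
    unfolding T_sym[OF f] by (intro tendsto_intros L2_ip_tendsto_left S_L2 f uv e_L2 lim)
  ultimately show ?thesis by (rule LIMSEQ_unique)
qed

lemma eigen_ip:
  assumes "(u, v) \<in> G" "L2_eq v (\<lambda>t. z *s u t)" "z \<noteq> of_real (lam i)"
  shows "L2_ip u (e i) = 0"
proof -
  have uv: "u \<in> L2_space" "v \<in> L2_space" using assms(1) by (auto simp: closure_graph_def)
  have "of_real (lam i) * L2_ip u (e i) = z * L2_ip u (e i)"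
    using closure_graph_ip[OF assms(1), of i] L2_ip_cong_AE[OF assms(2) uv(2) L2_space_scale[OF uv(1)] e_L2, of i]
    unfolding L2_ip_scale_left by metis
  then show ?thesis using assms(3) by (metis mult_cancel_right)
qed

lemma e_graph: "(e i, \<lambda>t. of_real (lam i) *s e i t) \<in> G"
  unfolding closure_graph_def using e_L2 e_S
  by (auto simp: T_e intro!: L2_space_scale exI[of _ "\<lambda>_. e i"]) (simp_all add: L2_norm_def)

lemma L2_eq_refl: "L2_eq u u" by (simp add: L2_eq_def)

lemma e_eigenspace: "e i \<in> eigenspace G (of_real (lam i))"
  unfolding eigenspace_def using e_graph L2_eq_refl by blast

text \<open>The resolvent divides the i-th coefficient by \<open>lam i - z\<close>, which costs at
  most a factor 1 / \<delta>. Membership in the closure also asks the images of the partial sums to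
  converge, hence a second use of \<open>riesz_fischer\<close>.\<close>

lemma in_resolvent_set:
  assumes \<delta>: "0 < \<delta>" "\<And>i. \<delta> \<le> norm (of_real (lam i) - z)"
  shows "z \<in> resolvent_set G"
  unfolding resolvent_set_def
proof (intro CollectI conjI)
  have z: "z \<noteq> of_real (lam i)" for i using \<delta>(1) \<delta>(2)[of i] by auto
  show "\<forall>(u, v)\<in>G. L2_eq v (\<lambda>\<theta>. z *s u \<theta>) \<longrightarrow> L2_eq u (\<lambda>_. 0)"
  proof (intro ballI, clarify)
    fix u v assume uv: "(u, v) \<in> G" "L2_eq v (\<lambda>\<theta>. z *s u \<theta>)"
    then have "u \<in> L2_space" by (simp add: closure_graph_def)
    then show "L2_eq u (\<lambda>_. 0)" by (rule complete) (rule eigen_ip[OF uv z])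
  qed
  have "\<exists>(u, v)\<in>G. L2_eq (\<lambda>\<theta>. v \<theta> - z *s u \<theta>) w \<and> L2_norm u \<le> (1 / \<delta>) * L2_norm w"
    if w: "w \<in> L2_space" for w
  proof -
    obtain c where c: "\<And>j. L2_ip w (e j) = c j * of_real (nsq j)"
      "\<And>N. (\<Sum>i<N. (norm (c i))\<^sup>2 * nsq i) \<le> (L2_norm w)\<^sup>2"
      using bessel[OF w] by blast
    define d where "d i = c i / (of_real (lam i) - z)" for i
    have d_le: "(norm (d i))\<^sup>2 * nsq i \<le> (1 / \<delta>)\<^sup>2 * ((norm (c i))\<^sup>2 * nsq i)" for i
    proof -
      have "norm (d i) \<le> norm (c i) / \<delta>"
        unfolding d_def norm_divide using \<delta> by (intro divide_left_mono) (auto intro: mult_pos_pos order_less_le_trans)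
      then have "(norm (d i))\<^sup>2 \<le> (norm (c i) / \<delta>)\<^sup>2" by (intro power_mono) auto
      then have "(norm (d i))\<^sup>2 * nsq i \<le> (norm (c i) / \<delta>)\<^sup>2 * nsq i" by (intro mult_right_mono) auto
      then show ?thesis by (simp add: power_divide)
    qed
    have d_bound: "(\<Sum>i<N. (norm (d i))\<^sup>2 * nsq i) \<le> (1 / \<delta>)\<^sup>2 * (L2_norm w)\<^sup>2" for N
    proof -
      have "(\<Sum>i<N. (norm (d i))\<^sup>2 * nsq i) \<le> (\<Sum>i<N. (1 / \<delta>)\<^sup>2 * ((norm (c i))\<^sup>2 * nsq i))"
        by (intro sum_mono d_le)
      also have "\<dots> \<le> (1 / \<delta>)\<^sup>2 * (L2_norm w)\<^sup>2"
        unfolding sum_distrib_left[symmetric] by (intro mult_left_mono c) auto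
      finally show ?thesis .
    qed
    \<comment> \<open>These are the coefficients of the image. The form \<open>c i + z * d i\<close>
      shows that they are square summable even when \<open>lam\<close> is unbounded.\<close>
    define l where "l i = of_real (lam i) * d i" for i
    have l: "l i = c i + z * d i" for i
      using z[of i] by (simp add: l_def d_def field_simps)
    have l_le: "(norm (l i))\<^sup>2 * nsq i \<le> 2 * ((norm (c i))\<^sup>2 * nsq i) + 2 * (norm z)\<^sup>2 * ((norm (d i))\<^sup>2 * nsq i)" for i
    proof -
      have "(norm (l i))\<^sup>2 \<le> 2 * (norm (c i))\<^sup>2 + 2 * (norm (z * d i))\<^sup>2"
        unfolding l by (rule norm_add_sq_le)
      then have "(norm (l i))\<^sup>2 * nsq i \<le> (2 * (norm (c i))\<^sup>2 + 2 * (norm (z * d i))\<^sup>2) * nsq i"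
        by (intro mult_right_mono) auto
      then show ?thesis by (simp add: algebra_simps norm_mult power_mult_distrib)
    qed
    have l_bound: "(\<Sum>i<N. (norm (l i))\<^sup>2 * nsq i)
        \<le> 2 * (L2_norm w)\<^sup>2 + 2 * (norm z)\<^sup>2 * ((1 / \<delta>)\<^sup>2 * (L2_norm w)\<^sup>2)" for N
    proof -
      have "(\<Sum>i<N. (norm (l i))\<^sup>2 * nsq i)
          \<le> 2 * (\<Sum>i<N. (norm (c i))\<^sup>2 * nsq i) + 2 * (norm z)\<^sup>2 * (\<Sum>i<N. (norm (d i))\<^sup>2 * nsq i)"
        unfolding sum_distrib_left sum.distrib[symmetric] by (intro sum_mono l_le)
      also have "\<dots> \<le> 2 * (L2_norm w)\<^sup>2 + 2 * (norm z)\<^sup>2 * ((1 / \<delta>)\<^sup>2 * (L2_norm w)\<^sup>2)"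
        by (intro add_mono mult_left_mono c d_bound) auto
      finally show ?thesis .
    qed
    obtain u where u: "u \<in> L2_space" "(\<lambda>N. L2_norm (\<lambda>t. lincomb {..<N} d t - u t)) \<longlonglongrightarrow> 0"
      "\<And>j. L2_ip u (e j) = d j * of_real (nsq j)" "(L2_norm u)\<^sup>2 \<le> (1 / \<delta>)\<^sup>2 * (L2_norm w)\<^sup>2"
      using riesz_fischer[OF d_bound] by blast
    obtain v where v: "v \<in> L2_space" "(\<lambda>N. L2_norm (\<lambda>t. lincomb {..<N} l t - v t)) \<longlonglongrightarrow> 0"
      "\<And>j. L2_ip v (e j) = l j * of_real (nsq j)"
      using riesz_fischer[OF l_bound] by blast
    have G: "(u, v) \<in> G"
      unfolding closure_graph_def using u(1,2) v(1,2) T_lincomb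
      by (auto simp: l_def[abs_def] intro!: exI[of _ "\<lambda>N. lincomb {..<N} d"])
    have zu: "(\<lambda>t. z *s u t) \<in> L2_space" by (rule L2_space_scale[OF u(1)])
    have vzu: "(\<lambda>t. v t - z *s u t) \<in> L2_space" by (rule L2_space_diff[OF v(1) zu])
    have "L2_eq (\<lambda>t. (v t - z *s u t) - w t) (\<lambda>_. 0)"
    proof (rule complete)
      show "L2_ip (\<lambda>t. (v t - z *s u t) - w t) (e i) = 0" for i
        unfolding L2_ip_diff_left[OF vzu w e_L2] L2_ip_diff_left[OF v(1) zu e_L2] L2_ip_scale_left u(3) v(3) c(1) l
        by (simp add: algebra_simps)
    qed (intro L2_space_diff vzu w)
    then have eq: "L2_eq (\<lambda>t. v t - z *s u t) w"
      by (simp add: L2_eq_def)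
    have "L2_norm u \<le> (1 / \<delta>) * L2_norm w"
      by (rule power2_le_imp_le) (use u(4) \<delta> in \<open>auto simp: power_mult_distrib power_divide L2_norm_nonneg\<close>)
    with G eq show ?thesis by blast
  qed
  then show "\<exists>C. \<forall>w\<in>L2_space. \<exists>(u, v)\<in>G. L2_eq (\<lambda>\<theta>. v \<theta> - z *s u \<theta>) w \<and> L2_norm u \<le> C * L2_norm w"
    by blast
qed

lemma in_op_spectrum:
  assumes "L2_norm (e i) \<noteq> 0"
  shows "of_real (lam i) \<in> op_spectrum G"
  unfolding op_spectrum_def resolvent_set_def
  using e_graph[of i] L2_eq_refl assms L2_norm_eq_0[OF e_L2, of i] by blast

text \<open>An eigenvector minus its component along \<open>e i\<close> is orthogonal to the whole
  system, hence zero by completeness. Repetitions of the eigenvalue are tolerated on zero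
  vectors.\<close>

lemma simple_eigenvalueI:
  assumes i: "L2_norm (e i) \<noteq> 0"
    and uniq: "\<And>j. j \<noteq> i \<Longrightarrow> lam j = lam i \<Longrightarrow> L2_norm (e j) = 0"
  shows "simple_eigenvalue G (of_real (lam i))"
  unfolding simple_eigenvalue_def
proof (intro bexI[of _ "e i"] conjI ballI)
  show "\<not> L2_eq (e i) (\<lambda>_. 0)" using i L2_norm_eq_0[OF e_L2] by blast
  fix u assume "u \<in> eigenspace G (of_real (lam i))"
  then obtain v where uv: "(u, v) \<in> G" "L2_eq v (\<lambda>t. of_real (lam i) *s u t)"
    by (auto simp: eigenspace_def)
  have u: "u \<in> L2_space" using uv(1) by (auto simp: closure_graph_def)
  have other: "L2_ip u (e j) = 0" if "j \<noteq> i" for j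
  proof (cases "lam j = lam i")
    case True
    then show ?thesis using norm_L2_ip_le[OF u e_L2, of j] uniq[OF that True] by simp
  next
    case False
    then show ?thesis using eigen_ip[OF uv, of j] by simp
  qed
  define c where "c = L2_ip u (e i) / of_real (nsq i)"
  have "L2_eq (\<lambda>t. u t - c *s e i t) (\<lambda>_. 0)"
  proof (rule complete)
    show "L2_ip (\<lambda>t. u t - c *s e i t) (e j) = 0" for j
    proof (cases "j = i")
      case True
      then show ?thesis
        using i by (simp add: L2_ip_diff_left u L2_space_scale e_L2 L2_ip_scale_left L2_ip_self c_def nsq_def)
    qed (simp add: L2_ip_diff_left u L2_space_scale e_L2 L2_ip_scale_left other orth)
  qed (intro L2_space_diff u L2_space_scale e_L2)
  then show "\<exists>c. L2_eq u (\<lambda>t. c *s e i t)"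
    by (intro exI[of _ c]) (simp add: L2_eq_def)
qed (rule e_eigenspace)

end

section \<open>Schwartz functions\<close>

lemma schwartzD:
  assumes "f \<in> schwartz"
  shows "(vderiv ^^ m) f differentiable_on UNIV"
    and "bounded (range (\<lambda>t. t ^ k *\<^sub>R (vderiv ^^ m) f t))"
  using assms by (auto simp: schwartz_def)

lemma funpow_vderiv_deriv:
  assumes "f \<in> schwartz"
  shows "((vderiv ^^ m) f has_vector_derivative (vderiv ^^ Suc m) f t) (at t)"
  using schwartzD(1)[OF assms, of m]
  by (simp add: vderiv_def vector_derivative_works[symmetric] differentiable_on_def)

lemma schwartz_deriv:
  assumes "f \<in> schwartz"
  shows "(f has_vector_derivative vderiv f t) (at t)"
  using funpow_vderiv_deriv[OF assms, of 0] by simp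

lemma vderivI:
  assumes "\<And>t. (f has_vector_derivative g t) (at t)"
  shows "vderiv f = g"
  unfolding vderiv_def by (intro ext vector_derivative_at assms)

lemma differentiable_onI_deriv:
  assumes "\<And>t. (f has_vector_derivative g t) (at t)"
  shows "f differentiable_on UNIV"
  using assms by (auto simp: differentiable_on_def intro: differentiableI_vector)

lemma schwartz_vderiv:
  assumes "f \<in> schwartz"
  shows "vderiv f \<in> schwartz"
proof -
  have "(vderiv ^^ m) (vderiv f) = (vderiv ^^ Suc m) f" for m
    by (simp add: funpow_swap1)
  then show ?thesis
    unfolding schwartz_def mem_Collect_eq using schwartzD[OF assms] by presburger
qed

lemma schwartz_lin:
  assumes f: "f \<in> schwartz" and g: "g \<in> schwartz"
  shows "(\<lambda>t. a * f t + b * g t) \<in> schwartz"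
proof -
  have d: "((\<lambda>t. a * (vderiv ^^ m) f t + b * (vderiv ^^ m) g t) has_vector_derivative
        a * (vderiv ^^ Suc m) f t + b * (vderiv ^^ Suc m) g t) (at t)" for m t
    by (intro has_vector_derivative_add has_vector_derivative_mult_right funpow_vderiv_deriv f g)
  have eq: "(vderiv ^^ m) (\<lambda>t. a * f t + b * g t) = (\<lambda>t. a * (vderiv ^^ m) f t + b * (vderiv ^^ m) g t)" for m
    by (induction m) (simp_all add: vderivI[OF d, simplified])
  have "bounded (range (\<lambda>t. t ^ k *\<^sub>R (a * (vderiv ^^ m) f t + b * (vderiv ^^ m) g t)))" for k m
  proof -
    obtain B where B: "\<And>t. norm (t ^ k *\<^sub>R (vderiv ^^ m) f t) \<le> B"
      using schwartzD(2)[OF f, of k m] by (auto simp: bounded_iff)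
    obtain C where C: "\<And>t. norm (t ^ k *\<^sub>R (vderiv ^^ m) g t) \<le> C"
      using schwartzD(2)[OF g, of k m] by (auto simp: bounded_iff)
    have "norm (t ^ k *\<^sub>R (a * (vderiv ^^ m) f t + b * (vderiv ^^ m) g t)) \<le> norm a * B + norm b * C" for t
    proof -
      have "t ^ k *\<^sub>R (a * (vderiv ^^ m) f t + b * (vderiv ^^ m) g t)
          = a * (t ^ k *\<^sub>R (vderiv ^^ m) f t) + b * (t ^ k *\<^sub>R (vderiv ^^ m) g t)"
        by (simp add: scaleR_add_right)
      also have "norm \<dots> \<le> norm a * norm (t ^ k *\<^sub>R (vderiv ^^ m) f t) + norm b * norm (t ^ k *\<^sub>R (vderiv ^^ m) g t)"
        by (rule norm_triangle_le) (simp add: norm_mult)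
      also have "\<dots> \<le> norm a * B + norm b * C"
        by (intro add_mono mult_left_mono B C) auto
      finally show ?thesis .
    qed
    then show ?thesis by (auto simp: bounded_iff)
  qed
  then show ?thesis
    unfolding schwartz_def mem_Collect_eq eq using differentiable_onI_deriv[OF d] by blast
qed

lemma vderiv_lin:
  assumes "f \<in> schwartz" "g \<in> schwartz"
  shows "vderiv (\<lambda>t. a * f t + b * g t) = (\<lambda>t. a * vderiv f t + b * vderiv g t)"
  by (intro vderivI has_vector_derivative_add has_vector_derivative_mult_right schwartz_deriv assms)

lemma schwartz_add: "f \<in> schwartz \<Longrightarrow> g \<in> schwartz \<Longrightarrow> (\<lambda>t. f t + g t) \<in> schwartz"
  using schwartz_lin[of f g 1 1] by simp

lemma schwartz_scale: "f \<in> schwartz \<Longrightarrow> (\<lambda>t. a * f t) \<in> schwartz"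
  using schwartz_lin[of f f a 0] by simp

lemma vderiv_zero: "vderiv (\<lambda>t. 0) = (\<lambda>t. 0)"
  by (intro vderivI) auto

lemma schwartz_zero: "(\<lambda>t. 0) \<in> schwartz"
proof -
  have "(vderiv ^^ m) (\<lambda>t. 0) = (\<lambda>t. 0)" for m
    by (induction m) (simp_all add: vderiv_zero)
  then show ?thesis by (simp add: schwartz_def image_constant_conv)
qed

lemma schwartz_mult_ident:
  assumes f: "f \<in> schwartz"
  shows "(\<lambda>t. of_real t * f t) \<in> schwartz"
proof -
  \<comment> \<open>The m-th derivative of \<open>t f\<close> by the Leibniz rule. For
    \<open>m = 0\<close> the truncated index \<open>m - 1\<close> is harmless, its factor being
    0.\<close>
  define F where "F m t = of_real t * (vderiv ^^ m) f t + of_nat m * (vderiv ^^ (m - 1)) f t" for m and t :: real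
  have d: "(F m has_vector_derivative F (Suc m) t) (at t)" for m t
  proof (cases m)
    case 0
    show ?thesis
      unfolding F_def 0
      by (rule has_vector_derivative_eq_rhs)
         (rule derivative_intros funpow_vderiv_deriv[OF f] has_vector_derivative_of_real | simp)+
  next
    case (Suc n)
    show ?thesis
      unfolding F_def Suc
      by (rule has_vector_derivative_eq_rhs)
         (rule derivative_intros funpow_vderiv_deriv[OF f] has_vector_derivative_of_real | simp add: algebra_simps)+
  qed
  have eq: "(vderiv ^^ m) (\<lambda>t. of_real t * f t) = F m" for m
  proof (induction m)
    case 0
    show ?case by (simp add: F_def fun_eq_iff)
  next
    case (Suc m)
    then show ?case by (simp add: vderivI[OF d])
  qed
  have "bounded (range (\<lambda>t. t ^ k *\<^sub>R F m t))" for k m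
  proof -
    obtain B where B: "\<And>t. norm (t ^ Suc k *\<^sub>R (vderiv ^^ m) f t) \<le> B"
      using schwartzD(2)[OF f, of "Suc k" m] by (auto simp: bounded_iff)
    obtain C where C: "\<And>t. norm (t ^ k *\<^sub>R (vderiv ^^ (m - 1)) f t) \<le> C"
      using schwartzD(2)[OF f, of k "m - 1"] by (auto simp: bounded_iff)
    have "norm (t ^ k *\<^sub>R F m t) \<le> B + of_nat m * C" for t
    proof -
      have "t ^ k *\<^sub>R F m t = t ^ Suc k *\<^sub>R (vderiv ^^ m) f t + of_nat m * (t ^ k *\<^sub>R (vderiv ^^ (m - 1)) f t)"
        by (simp add: F_def scaleR_conv_of_real algebra_simps)
      also have "norm \<dots> \<le> norm (t ^ Suc k *\<^sub>R (vderiv ^^ m) f t) + of_nat m * norm (t ^ k *\<^sub>R (vderiv ^^ (m - 1)) f t)"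
        by (rule norm_triangle_le) (simp add: norm_mult)
      also have "\<dots> \<le> B + of_nat m * C"
        by (intro add_mono mult_left_mono B C) auto
      finally show ?thesis .
    qed
    then show ?thesis by (auto simp: bounded_iff)
  qed
  then show ?thesis
    unfolding schwartz_def mem_Collect_eq eq using differentiable_onI_deriv[OF d] by blast
qed

lemma continuous_on_schwartz: "f \<in> schwartz \<Longrightarrow> continuous_on A f"
  using schwartz_deriv
  by (meson continuous_at_imp_continuous_on has_vector_derivative_continuous)

lemma schwartz_bounded:
  assumes "f \<in> schwartz"
  shows "\<exists>B. \<forall>t. norm (f t) \<le> B"
  using schwartzD(2)[OF assms, of 0 0] by (simp add: bounded_iff)

text \<open>Supplies an integrable majorant that also tends to 0 at both ends; the bounds with k = 0
  and k = 2 combine to it.\<close>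

lemma schwartz_decay:
  assumes "f \<in> schwartz"
  shows "\<exists>B. \<forall>t. norm (f t) \<le> B * inverse (1 + t\<^sup>2)"
proof -
  obtain B where B: "\<And>t. norm (t ^ 2 *\<^sub>R f t) \<le> B"
    using schwartzD(2)[OF assms, of 2 0] by (auto simp: bounded_iff)
  obtain C where C: "\<And>t. norm (f t) \<le> C"
    using schwartz_bounded[OF assms] by auto
  have "norm (f t) \<le> (B + C) * inverse (1 + t\<^sup>2)" for t
  proof -
    have "norm (f t) * (1 + t\<^sup>2) \<le> B + C"
      using B[of t] C[of t] by (simp add: algebra_simps)
    moreover have "0 < 1 + t\<^sup>2" by (simp add: add_pos_nonneg)
    ultimately show ?thesis by (simp add: field_simps)
  qed
  then show ?thesis by auto
qed

lemma integrable_schwartz_mult: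
  assumes f: "f \<in> schwartz" and g: "g \<in> schwartz"
  shows "integrable lborel (\<lambda>t. f t * cnj (g t))"
proof -
  obtain B where B: "\<And>t. norm (f t) \<le> B * inverse (1 + t\<^sup>2)" using schwartz_decay[OF f] by auto
  obtain C where C: "\<And>t. norm (g t) \<le> C" using schwartz_bounded[OF g] by auto
  have "(\<lambda>t. f t * cnj (g t)) \<in> borel_measurable borel"
    by (intro borel_measurable_continuous_onI continuous_intros continuous_on_schwartz f g)
  then have m: "(\<lambda>t. f t * cnj (g t)) \<in> borel_measurable lborel" by simp
  have "integrable lborel (\<lambda>t::real. inverse (1 + t\<^sup>2))"
    using integrable_inverse_1_plus_square by (simp add: set_integrable_def einterval_def)
  then have i: "integrable lborel (\<lambda>t::real. (B * inverse (1 + t\<^sup>2)) * C)"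
    by simp
  have "norm (f t * cnj (g t)) \<le> norm ((B * inverse (1 + t\<^sup>2)) * C)" for t
  proof -
    have "norm (f t * cnj (g t)) \<le> (B * inverse (1 + t\<^sup>2)) * C"
      unfolding norm_mult complex_mod_cnj
      by (intro mult_mono B C norm_ge_zero order_trans[OF norm_ge_zero B])
    then show ?thesis by simp
  qed
  then show ?thesis
    by (intro Bochner_Integration.integrable_bound[OF i m] AE_I2)
qed

lemma L2_inner_lin_left:
  assumes "f \<in> schwartz" "g \<in> schwartz" "k \<in> schwartz"
  shows "L2_inner (\<lambda>t. a * f t + b * g t) k = a * L2_inner f k + b * L2_inner g k"
proof -
  have "L2_inner (\<lambda>t. a * f t + b * g t) k = (LINT t|lborel. a * (f t * cnj (k t)) + b * (g t * cnj (k t)))"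
    unfolding L2_inner_def by (intro Bochner_Integration.integral_cong refl) (simp add: algebra_simps)
  also have "\<dots> = a * L2_inner f k + b * L2_inner g k"
    by (subst Bochner_Integration.integral_add)
       (simp_all add: L2_inner_def integrable_schwartz_mult assms)
  finally show ?thesis .
qed

lemma cnj_L2_inner: "cnj (L2_inner f g) = L2_inner g f"
  using Bochner_Integration.integral_cnj[of lborel "\<lambda>t. f t * cnj (g t)"]
  by (simp add: L2_inner_def mult.commute)

lemma L2_inner_lin_right:
  assumes "f \<in> schwartz" "g \<in> schwartz" "k \<in> schwartz"
  shows "L2_inner k (\<lambda>t. a * f t + b * g t) = cnj a * L2_inner k f + cnj b * L2_inner k g"
  using arg_cong[OF L2_inner_lin_left[OF assms, of a b], of cnj] by (simp add: cnj_L2_inner)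

text \<open>Integration by parts on the whole line; the boundary terms vanish because the product of
  the functions decays.\<close>

lemma L2_inner_vderiv:
  assumes f: "f \<in> schwartz" and g: "g \<in> schwartz"
  shows "L2_inner (vderiv f) g = - L2_inner f (vderiv g)"
proof -
  let ?F = "\<lambda>t. f t * cnj (g t)"
  let ?F' = "\<lambda>t. f t * cnj (vderiv g t) + vderiv f t * cnj (g t)"
  have i1: "integrable lborel (\<lambda>t. f t * cnj (vderiv g t))"
    and i2: "integrable lborel (\<lambda>t. vderiv f t * cnj (g t))"
    by (intro integrable_schwartz_mult schwartz_vderiv f g)+
  obtain B where B: "\<And>t. norm (f t) \<le> B * inverse (1 + t\<^sup>2)" using schwartz_decay[OF f] by auto
  obtain C where C: "\<And>t. norm (g t) \<le> C" using schwartz_bounded[OF g] by auto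
  have F_le: "norm (?F t) \<le> (B * inverse (1 + t\<^sup>2)) * C" for t
    unfolding norm_mult complex_mod_cnj
    by (intro mult_mono B C norm_ge_zero order_trans[OF norm_ge_zero B])
  have "((\<lambda>t::real. (B * inverse (1 + t\<^sup>2)) * C) \<longlongrightarrow> 0) at_top"
    by real_asymp
  then have top: "(?F \<longlongrightarrow> 0) at_top"
    by (rule Lim_null_comparison[rotated]) (intro always_eventually allI F_le)
  have "((\<lambda>t::real. (B * inverse (1 + t\<^sup>2)) * C) \<longlongrightarrow> 0) at_bot"
    by real_asymp
  then have bot: "(?F \<longlongrightarrow> 0) at_bot"
    by (rule Lim_null_comparison[rotated]) (intro always_eventually allI F_le)
  have "(LBINT t=-\<infinity>..\<infinity>. ?F' t) = 0 - 0"
  proof (rule interval_integral_FTC_integrable)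
    show "(?F has_vector_derivative ?F' t) (at t)" for t
      by (intro has_vector_derivative_mult has_vector_derivative_cnj schwartz_deriv f g)
    show "isCont ?F' t" for t
      by (rule continuous_on_interior[of UNIV])
         (auto intro!: continuous_intros continuous_on_schwartz[OF f] continuous_on_schwartz[OF g]
           continuous_on_schwartz[OF schwartz_vderiv[OF f]] continuous_on_schwartz[OF schwartz_vderiv[OF g]])
    show "set_integrable lborel (einterval (- \<infinity>) \<infinity>) ?F'"
      using i1 i2 by (simp add: set_integrable_def einterval_def)
    show "((?F \<circ> real_of_ereal) \<longlongrightarrow> 0) (at_right (- \<infinity>))"
      using bot by (simp add: ereal_tendsto_simps)
    show "((?F \<circ> real_of_ereal) \<longlongrightarrow> 0) (at_left \<infinity>)"
      using top by (simp add: ereal_tendsto_simps)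
  qed auto
  then have "(LINT t|lborel. ?F' t) = 0"
    by (simp add: interval_lebesgue_integral_def set_lebesgue_integral_def einterval_def)
  then show ?thesis
    using i1 i2 by (simp add: L2_inner_def add_eq_0_iff)
qed

text \<open>The set where \<open>f\<close> is nonzero is open and null, hence empty. This provides
  the uniqueness behind the definite description in \<open>sop_adjoint\<close>.\<close>

lemma schwartz_inner_self_eq_0:
  assumes f: "f \<in> schwartz" and z: "L2_inner f f = 0"
  shows "f = (\<lambda>t. 0)"
proof -
  have "integrable lborel (\<lambda>t. complex_of_real ((norm (f t))\<^sup>2))"
    using integrable_schwartz_mult[OF f f] by (simp add: complex_norm_square del: of_real_power)
  then have i: "integrable lborel (\<lambda>t. (norm (f t))\<^sup>2)"
    by (simp only: complex_of_real_integrable_eq)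
  have "L2_inner f f = of_real (LINT t|lborel. (norm (f t))\<^sup>2)"
    unfolding L2_inner_def by (simp add: complex_norm_square[symmetric] del: of_real_power flip: integral_complex_of_real)
  with z have "(LINT t|lborel. (norm (f t))\<^sup>2) = 0" by simp
  then have "AE t in lborel. f t = 0"
    using integral_nonneg_eq_0_iff_AE[OF i] by simp
  then have ae: "AE t in lborel. t \<notin> f -` (- {0})" by simp
  have "open (f -` (- {0}))"
    using continuous_on_schwartz[OF f, of UNIV] by (intro open_vimage) auto
  moreover from this have "f -` (- {0}) \<in> null_sets lborel"
    using ae by (subst AE_iff_null_sets) auto
  then have "negligible (f -` (- {0}))"
    unfolding negligible_iff_null_sets by (rule null_sets_completionI)
  ultimately have "f -` (- {0}) = {}"
    using open_not_negligible by blast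
  then show ?thesis by (auto simp: fun_eq_iff)
qed

section \<open>Formal adjoints\<close>

text \<open>Invariance of the Schwartz space and linearity are bundled with the adjoint relation, so
  that the predicate is stable under composition and linear combination and the adjoint of each
  matrix entry can be assembled from those of the generators.\<close>

definition adj_pair :: "sop \<Rightarrow> sop \<Rightarrow> bool" where
  "adj_pair A A' \<longleftrightarrow>
     (\<forall>f\<in>schwartz. A f \<in> schwartz \<and> A' f \<in> schwartz) \<and>
     (\<forall>f\<in>schwartz. \<forall>g\<in>schwartz. \<forall>a b. A (\<lambda>t. a * f t + b * g t) = (\<lambda>t. a * A f t + b * A g t)) \<and>
     (\<forall>f\<in>schwartz. \<forall>g\<in>schwartz. \<forall>a b. A' (\<lambda>t. a * f t + b * g t) = (\<lambda>t. a * A' f t + b * A' g t)) \<and>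
     (\<forall>f\<in>schwartz. \<forall>g\<in>schwartz. L2_inner (A f) g = L2_inner f (A' g))"

lemma adj_pairD:
  assumes "adj_pair A A'" "f \<in> schwartz"
  shows "A f \<in> schwartz" "A' f \<in> schwartz"
    and "g \<in> schwartz \<Longrightarrow> A (\<lambda>t. a * f t + b * g t) = (\<lambda>t. a * A f t + b * A g t)"
    and "g \<in> schwartz \<Longrightarrow> A' (\<lambda>t. a * f t + b * g t) = (\<lambda>t. a * A' f t + b * A' g t)"
    and "g \<in> schwartz \<Longrightarrow> L2_inner (A f) g = L2_inner f (A' g)"
  using assms by (auto simp: adj_pair_def)

lemma adj_pair_lin:
  assumes A: "adj_pair A A'" and B: "adj_pair B B'"
  shows "adj_pair (\<lambda>f t. of_real a * A f t + of_real b * B f t) (\<lambda>f t. of_real a * A' f t + of_real b * B' f t)"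
  unfolding adj_pair_def
proof (intro conjI ballI allI)
  fix f g c d assume f: "f \<in> schwartz" and g: "g \<in> schwartz"
  note Af = adj_pairD[OF A f] adj_pairD[OF B f]
  note Ag = adj_pairD[OF A g] adj_pairD[OF B g]
  show "(\<lambda>t. of_real a * A f t + of_real b * B f t) \<in> schwartz"
    "(\<lambda>t. of_real a * A' f t + of_real b * B' f t) \<in> schwartz"
    by (intro schwartz_lin Af)+
  show "(\<lambda>t. of_real a * A (\<lambda>t. c * f t + d * g t) t + of_real b * B (\<lambda>t. c * f t + d * g t) t)
      = (\<lambda>t. c * (of_real a * A f t + of_real b * B f t) + d * (of_real a * A g t + of_real b * B g t))"
    by (simp only: adj_pairD(3)[OF A f g] adj_pairD(3)[OF B f g]) (simp add: fun_eq_iff algebra_simps)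
  show "(\<lambda>t. of_real a * A' (\<lambda>t. c * f t + d * g t) t + of_real b * B' (\<lambda>t. c * f t + d * g t) t)
      = (\<lambda>t. c * (of_real a * A' f t + of_real b * B' f t) + d * (of_real a * A' g t + of_real b * B' g t))"
    by (simp only: adj_pairD(4)[OF A f g] adj_pairD(4)[OF B f g]) (simp add: fun_eq_iff algebra_simps)
  show "L2_inner (\<lambda>t. of_real a * A f t + of_real b * B f t) g
      = L2_inner f (\<lambda>t. of_real a * A' g t + of_real b * B' g t)"
    by (simp only: L2_inner_lin_left[OF Af(1) Af(6) g] L2_inner_lin_right[OF Ag(2) Ag(7) f]
        adj_pairD(5)[OF A f g] adj_pairD(5)[OF B f g] complex_cnj_complex_of_real)
qed

lemma adj_pair_comp:
  assumes A: "adj_pair A A'" and B: "adj_pair B B'"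
  shows "adj_pair (A \<circ> B) (B' \<circ> A')"
  using A B unfolding adj_pair_def o_def by simp

lemma adj_pair_id: "adj_pair id id"
  by (simp add: adj_pair_def)

lemma adj_pair_add:
  "adj_pair A A' \<Longrightarrow> adj_pair B B' \<Longrightarrow> adj_pair (A + B) (A' + B')"
  using adj_pair_lin[of A A' B B' 1 1] by (simp add: plus_fun_def)

lemma adj_pair_diff:
  "adj_pair A A' \<Longrightarrow> adj_pair B B' \<Longrightarrow> adj_pair (A - B) (A' - B')"
  using adj_pair_lin[of A A' B B' 1 "- 1"] by (simp add: fun_diff_def)

lemma adj_pair_uminus: "adj_pair A A' \<Longrightarrow> adj_pair (- A) (- A')"
  using adj_pair_lin[of A A' A A' "- 1" 0] by (simp add: fun_Compl_def)

lemma adj_pair_scale: "adj_pair A A' \<Longrightarrow> adj_pair (sop_scale c A) (sop_scale c A')"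
  using adj_pair_lin[of A A' A A' c 0] by (simp add: sop_scale_def)

lemma adj_pair_0: "adj_pair 0 0"
  using adj_pair_scale[OF adj_pair_id, of 0] by (simp add: sop_scale_def zero_fun_def)

lemma adj_pair_X1: "adj_pair (X1 h) (- X1 h)"
  unfolding adj_pair_def
proof (intro conjI ballI allI)
  fix f g a b assume f: "f \<in> schwartz" and g: "g \<in> schwartz"
  let ?c = "complex_of_real (sqrt \<bar>h\<bar>)"
  show 1: "X1 h f \<in> schwartz"
    unfolding X1_def by (intro schwartz_scale schwartz_vderiv f)
  show "(- X1 h) f \<in> schwartz"
    using schwartz_scale[OF 1, of "- 1"] by (simp add: fun_Compl_def)
  show lin: "X1 h (\<lambda>t. a * f t + b * g t) = (\<lambda>t. a * X1 h f t + b * X1 h g t)"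
    by (simp add: X1_def vderiv_lin[OF f g] algebra_simps)
  show "(- X1 h) (\<lambda>t. a * f t + b * g t) = (\<lambda>t. a * (- X1 h) f t + b * (- X1 h) g t)"
    using lin by (simp add: fun_eq_iff)
  have "L2_inner (X1 h f) g = L2_inner (\<lambda>t. ?c * vderiv f t + 0 * vderiv f t) g"
    by (simp add: X1_def)
  also have "\<dots> = - ?c * L2_inner f (vderiv g)"
    by (simp only: L2_inner_lin_left[OF schwartz_vderiv[OF f] schwartz_vderiv[OF f] g] L2_inner_vderiv[OF f g]) simp
  also have "\<dots> = L2_inner f (\<lambda>t. (- ?c) * vderiv g t + 0 * vderiv g t)"
    by (simp only: L2_inner_lin_right[OF schwartz_vderiv[OF g] schwartz_vderiv[OF g] f]) simp
  finally show "L2_inner (X1 h f) g = L2_inner f ((- X1 h) g)"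
    by (simp add: X1_def fun_Compl_def)
qed

lemma adj_pair_X2: "adj_pair (X2 h) (- X2 h)"
  unfolding adj_pair_def
proof (intro conjI ballI allI)
  fix f g a b assume f: "f \<in> schwartz" and g: "g \<in> schwartz"
  have "X2 h f = (\<lambda>t. (\<i> * of_real (sgn h * sqrt \<bar>h\<bar>)) * (of_real t * f t))"
    by (simp add: X2_def fun_eq_iff)
  then show 1: "X2 h f \<in> schwartz"
    using schwartz_scale[OF schwartz_mult_ident[OF f]] by metis
  show "(- X2 h) f \<in> schwartz"
    using schwartz_scale[OF 1, of "- 1"] by (simp add: fun_Compl_def)
  show lin: "X2 h (\<lambda>t. a * f t + b * g t) = (\<lambda>t. a * X2 h f t + b * X2 h g t)"
    by (simp add: X2_def algebra_simps)
  show "(- X2 h) (\<lambda>t. a * f t + b * g t) = (\<lambda>t. a * (- X2 h) f t + b * (- X2 h) g t)"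
    using lin by (simp add: fun_eq_iff)
  show "L2_inner (X2 h f) g = L2_inner f ((- X2 h) g)"
    unfolding L2_inner_def by (rule Bochner_Integration.integral_cong) (simp_all add: X2_def)
qed

lemma adj_pair_X3: "adj_pair (X3 h) (- X3 h)"
  unfolding adj_pair_def
proof (intro conjI ballI allI)
  fix f g a b assume f: "f \<in> schwartz" and g: "g \<in> schwartz"
  show 1: "X3 h f \<in> schwartz"
    unfolding X3_def by (intro schwartz_scale f)
  show "(- X3 h) f \<in> schwartz"
    using schwartz_scale[OF 1, of "- 1"] by (simp add: fun_Compl_def)
  show lin: "X3 h (\<lambda>t. a * f t + b * g t) = (\<lambda>t. a * X3 h f t + b * X3 h g t)"
    by (simp add: X3_def algebra_simps)
  show "(- X3 h) (\<lambda>t. a * f t + b * g t) = (\<lambda>t. a * (- X3 h) f t + b * (- X3 h) g t)"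
    using lin by (simp add: fun_eq_iff)
  show "L2_inner (X3 h f) g = L2_inner f ((- X3 h) g)"
    unfolding L2_inner_def by (rule Bochner_Integration.integral_cong) (simp_all add: X3_def)
qed

text \<open>Words in the generators are known to be linear on Schwartz functions only, so a sign can
  be moved through them only there.\<close>

lemma adj_pair_cong:
  assumes "adj_pair A A'" "\<And>f. f \<in> schwartz \<Longrightarrow> A' f = A'' f"
  shows "adj_pair A A''"
  using assms schwartz_lin unfolding adj_pair_def by simp

lemma Xw_Nil: "Xw h [] = id" and Xw_Cons: "Xw h (j # js) = Xgen h j \<circ> Xw h js"
  by (simp_all add: Xw_def)

lemma Xw_append: "Xw h (js @ ks) = Xw h js \<circ> Xw h ks"
  by (induction js) (simp_all add: Xw_Nil Xw_Cons o_assoc)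

lemma adj_pair_Xgen: "adj_pair (Xgen h j) (- Xgen h j)"
  by (simp add: Xgen_def adj_pair_X1 adj_pair_X2 adj_pair_X3)

text \<open>Every generator is formally skew: taking adjoints reverses the word and contributes one
  sign per letter.\<close>

lemma adj_pair_Xw:
  "adj_pair (Xw h js) (sop_scale ((- 1) ^ length js) (Xw h (rev js)))"
proof (induction js)
  case Nil
  show ?case by (simp add: Xw_Nil sop_scale_def adj_pair_id[unfolded id_def] id_def)
next
  case (Cons j js)
  have "adj_pair (Xw h (j # js)) (sop_scale ((- 1) ^ length js) (Xw h (rev js)) \<circ> - Xgen h j)"
    unfolding Xw_Cons by (rule adj_pair_comp[OF adj_pair_Xgen Cons])
  then show ?case
  proof (rule adj_pair_cong)
    fix f assume f: "f \<in> schwartz"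
    have g: "Xgen h j f \<in> schwartz" using adj_pairD(1)[OF adj_pair_Xgen f] .
    have "- Xgen h j f = (\<lambda>t. (- 1) * Xgen h j f t + 0 * Xgen h j f t)"
      by (simp add: fun_eq_iff)
    then have "sop_scale ((- 1) ^ length js) (Xw h (rev js)) (- Xgen h j f)
        = (\<lambda>t. (- 1) * sop_scale ((- 1) ^ length js) (Xw h (rev js)) (Xgen h j f) t
             + 0 * sop_scale ((- 1) ^ length js) (Xw h (rev js)) (Xgen h j f) t)"
      using adj_pairD(4)[OF Cons g g] by metis
    then show "(sop_scale ((- 1) ^ length js) (Xw h (rev js)) \<circ> - Xgen h j) f
        = sop_scale ((- 1) ^ length (j # js)) (Xw h (rev (j # js))) f"
      by (simp add: sop_scale_def Xw_append Xw_Cons Xw_Nil fun_eq_iff)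
  qed
qed

lemma sop_adjoint_eq:
  assumes A: "adj_pair A A'" and g: "g \<in> schwartz"
  shows "sop_adjoint A g = A' g"
  unfolding sop_adjoint_def
proof (rule the_equality)
  have Ag: "A' g \<in> schwartz" using adj_pairD(2)[OF A g] .
  show "A' g \<in> schwartz \<and> (\<forall>f\<in>schwartz. L2_inner (A f) g = L2_inner f (A' g))"
    using A g Ag by (simp add: adj_pair_def)
  fix k assume k: "k \<in> schwartz \<and> (\<forall>f\<in>schwartz. L2_inner (A f) g = L2_inner f k)"
  \<comment> \<open>Two candidates for the adjoint, tested against their own difference, show that
    this difference has norm zero.\<close>
  let ?d = "\<lambda>t. 1 * k t + (- 1) * A' g t"
  have d: "?d \<in> schwartz" by (intro schwartz_lin) (use k Ag in auto)
  have "L2_inner ?d k = L2_inner ?d (A' g)"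
    using k d adj_pairD(5)[OF A d g] by metis
  then have "L2_inner ?d ?d = 0"
    using L2_inner_lin_right[of k "A' g" ?d 1 "- 1"] k Ag d by simp
  from schwartz_inner_self_eq_0[OF d this] show "k = A' g"
    by (simp add: fun_eq_iff)
qed

section \<open>Adjoints of operator matrices and the operator composed with its adjoint\<close>

lemma schwartz_vec_L2:
  assumes "f \<in> schwartz_vec"
  shows "f \<in> L2_space"
proof -
  have f: "(\<lambda>t. f t $ i) \<in> schwartz" for i using assms by (simp add: schwartz_vec_def)
  have "continuous_on UNIV (\<lambda>t. \<chi> i. f t $ i)"
    by (intro continuous_on_vec_lambda continuous_on_schwartz f)
  then have "f \<in> borel_measurable borel"
    by (intro borel_measurable_continuous_onI) simp
  moreover have "integrable lborel (\<lambda>t. (norm (f t))\<^sup>2)"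
  proof -
    have "integrable lborel (\<lambda>t. cdot (f t) (f t))"
      unfolding cdot_def by (intro Bochner_Integration.integrable_sum integrable_schwartz_mult f)
    then show ?thesis by (simp only: cdot_self complex_of_real_integrable_eq)
  qed
  ultimately show ?thesis by (simp add: L2_space_def)
qed

lemma L2_ip_schwartz:
  assumes "f \<in> schwartz_vec" "g \<in> schwartz_vec"
  shows "L2_ip f g = (\<Sum>i\<in>UNIV. L2_inner (\<lambda>t. f t $ i) (\<lambda>t. g t $ i))"
proof -
  have "(\<lambda>t. f t $ i) \<in> schwartz" "(\<lambda>t. g t $ i) \<in> schwartz" for i
    using assms by (simp_all add: schwartz_vec_def)
  then show ?thesis
    unfolding L2_ip_def L2_inner_def cdot_def
    by (intro Bochner_Integration.integral_sum integrable_schwartz_mult)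
qed

lemma schwartz_sum:
  assumes "\<And>i. i \<in> I \<Longrightarrow> f i \<in> schwartz"
  shows "(\<lambda>t. \<Sum>i\<in>I. f i t) \<in> schwartz"
  using assms by (induction I rule: infinite_finite_induct) (auto intro: schwartz_add schwartz_zero)

lemma L2_inner_sum_left:
  assumes "\<And>i. i \<in> I \<Longrightarrow> f i \<in> schwartz" "g \<in> schwartz"
  shows "L2_inner (\<lambda>t. \<Sum>i\<in>I. f i t) g = (\<Sum>i\<in>I. L2_inner (f i) g)"
  unfolding L2_inner_def sum_distrib_right
  by (intro Bochner_Integration.integral_sum integrable_schwartz_mult assms)

lemma L2_inner_sum_right:
  assumes "\<And>i. i \<in> I \<Longrightarrow> f i \<in> schwartz" "g \<in> schwartz"
  shows "L2_inner g (\<lambda>t. \<Sum>i\<in>I. f i t) = (\<Sum>i\<in>I. L2_inner g (f i))"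
  using arg_cong[where f = cnj, OF L2_inner_sum_left[OF assms]] by (simp add: cnj_L2_inner)

definition adj_mats :: "sop ^ 'n ^ 'm \<Rightarrow> sop ^ 'm ^ 'n \<Rightarrow> bool" where
  "adj_mats M N \<longleftrightarrow> (\<forall>i j. adj_pair (M $ i $ j) (N $ j $ i))"

lemma opmat_apply_schwartz:
  assumes M: "adj_mats M N" and f: "f \<in> schwartz_vec"
  shows "opmat_apply M f \<in> schwartz_vec"
proof -
  have "(M $ i $ j) (\<lambda>t. f t $ j) \<in> schwartz" for i j
    by (rule adj_pairD(1)[where A' = "N $ j $ i"]) (use M f in \<open>simp_all add: adj_mats_def schwartz_vec_def\<close>)
  then show ?thesis
    by (simp add: schwartz_vec_def opmat_apply_def schwartz_sum)
qed

lemma opmat_apply_schwartz':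
  assumes M: "adj_mats M N" and f: "f \<in> schwartz_vec"
  shows "opmat_apply N f \<in> schwartz_vec"
proof -
  have "(N $ i $ j) (\<lambda>t. f t $ j) \<in> schwartz" for i j
    by (rule adj_pairD(2)[where A = "M $ j $ i"]) (use M f in \<open>simp_all add: adj_mats_def schwartz_vec_def\<close>)
  then show ?thesis
    by (simp add: schwartz_vec_def opmat_apply_def schwartz_sum)
qed

lemma opmat_apply_adjoint:
  assumes M: "adj_mats M N" and f: "f \<in> schwartz_vec"
  shows "opmat_apply (opmat_adjoint M) f = opmat_apply N f"
proof -
  have "sop_adjoint (M $ j $ i) (\<lambda>t. f t $ j) = (N $ i $ j) (\<lambda>t. f t $ j)" for i j
    using M f by (intro sop_adjoint_eq) (auto simp: adj_mats_def schwartz_vec_def)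
  then show ?thesis
    by (simp add: opmat_apply_def opmat_adjoint_def)
qed

lemma opmat_apply_ip:
  assumes M: "adj_mats M N" and f: "f \<in> schwartz_vec" and g: "g \<in> schwartz_vec"
  shows "L2_ip (opmat_apply M f) g = L2_ip f (opmat_apply N g)"
proof -
  have M': "adj_pair (M $ i $ j) (N $ j $ i)" for i j using M by (simp add: adj_mats_def)
  have f': "(\<lambda>t. f t $ i) \<in> schwartz" and g': "(\<lambda>t. g t $ k) \<in> schwartz" for i k
    using f g by (simp_all add: schwartz_vec_def)
  have "L2_ip (opmat_apply M f) g
      = (\<Sum>i\<in>UNIV. \<Sum>j\<in>UNIV. L2_inner ((M $ i $ j) (\<lambda>t. f t $ j)) (\<lambda>t. g t $ i))"
    by (subst L2_ip_schwartz[OF opmat_apply_schwartz[OF M f] g])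
       (simp add: opmat_apply_def L2_inner_sum_left adj_pairD(1)[OF M' f'] g')
  also have "\<dots> = (\<Sum>j\<in>UNIV. \<Sum>i\<in>UNIV. L2_inner (\<lambda>t. f t $ j) ((N $ j $ i) (\<lambda>t. g t $ i)))"
    by (subst sum.swap) (simp add: adj_pairD(5)[OF M' f' g'])
  also have "\<dots> = L2_ip f (opmat_apply N g)"
    by (subst L2_ip_schwartz[OF f opmat_apply_schwartz'[OF M g]])
       (simp add: opmat_apply_def L2_inner_sum_right adj_pairD(2)[OF M' g'] f')
  finally show ?thesis .
qed

lemma schwartz_vec_lin:
  assumes "f \<in> schwartz_vec" "g \<in> schwartz_vec"
  shows "(\<lambda>t. a *s f t + b *s g t) \<in> schwartz_vec"
  using assms by (simp add: schwartz_vec_def schwartz_lin)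

lemma opmat_apply_lin:
  assumes M: "adj_mats M N" and f: "f \<in> schwartz_vec" and g: "g \<in> schwartz_vec"
  shows "opmat_apply M (\<lambda>t. a *s f t + b *s g t) = (\<lambda>t. a *s opmat_apply M f t + b *s opmat_apply M g t)"
proof -
  have M': "adj_pair (M $ i $ j) (N $ j $ i)" for i j using M by (simp add: adj_mats_def)
  have f': "(\<lambda>t. f t $ i) \<in> schwartz" and g': "(\<lambda>t. g t $ i) \<in> schwartz" for i
    using f g by (simp_all add: schwartz_vec_def)
  show ?thesis
    by (simp add: opmat_apply_def adj_pairD(3)[OF M' f' g'] vec_eq_iff fun_eq_iff sum.distrib sum_distrib_left)
qed

lemma opmat_apply_lin':
  assumes M: "adj_mats M N" and f: "f \<in> schwartz_vec" and g: "g \<in> schwartz_vec"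
  shows "opmat_apply N (\<lambda>t. a *s f t + b *s g t) = (\<lambda>t. a *s opmat_apply N f t + b *s opmat_apply N g t)"
proof -
  have M': "adj_pair (M $ i $ j) (N $ j $ i)" for i j using M by (simp add: adj_mats_def)
  have f': "(\<lambda>t. f t $ i) \<in> schwartz" and g': "(\<lambda>t. g t $ i) \<in> schwartz" for i
    using f g by (simp_all add: schwartz_vec_def)
  show ?thesis
    by (simp add: opmat_apply_def adj_pairD(4)[OF M' f' g'] vec_eq_iff fun_eq_iff sum.distrib sum_distrib_left)
qed

definition gram :: "sop ^ 'n ^ 'm \<Rightarrow> (real \<Rightarrow> complex ^ 'n) \<Rightarrow> real \<Rightarrow> complex ^ 'n" where
  "gram M f = opmat_apply (opmat_adjoint M) (opmat_apply M f)"

lemma gram_eq: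
  assumes "adj_mats M N" "f \<in> schwartz_vec"
  shows "gram M f = opmat_apply N (opmat_apply M f)"
  unfolding gram_def by (intro opmat_apply_adjoint assms opmat_apply_schwartz[OF assms])

lemma gram_symmetric:
  assumes M: "adj_mats M N" and f: "f \<in> schwartz_vec" and g: "g \<in> schwartz_vec"
  shows "L2_ip (gram M f) g = L2_ip f (gram M g)"
proof -
  let ?M = "opmat_apply M" and ?N = "opmat_apply N"
  have "L2_ip (?N (?M f)) g = cnj (L2_ip g (?N (?M f)))" by (simp add: cnj_L2_ip)
  also have "\<dots> = cnj (L2_ip (?M g) (?M f))"
    by (simp only: opmat_apply_ip[OF M g opmat_apply_schwartz[OF M f]])
  also have "\<dots> = L2_ip f (?N (?M g))"
    by (simp only: cnj_L2_ip opmat_apply_ip[OF M f opmat_apply_schwartz[OF M g]])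
  finally show ?thesis by (simp only: gram_eq[OF M f] gram_eq[OF M g])
qed

lemma symmetric_eigenbasis_gram:
  assumes M: "adj_mats M N"
    and e: "\<And>i. e i \<in> schwartz_vec"
    and eig: "\<And>i. gram M (e i) = (\<lambda>t. of_real (lam i) *s e i t)"
    and orth: "\<And>i j. i \<noteq> j \<Longrightarrow> L2_ip (e i) (e j) = 0"
    and complete: "\<And>u. u \<in> L2_space \<Longrightarrow> (\<And>i. L2_ip u (e i) = 0) \<Longrightarrow> L2_eq u (\<lambda>_. 0)"
  shows "symmetric_eigenbasis schwartz_vec (gram M) e lam"
proof
  fix f g :: "real \<Rightarrow> complex ^ 'a" and c i
  assume f: "f \<in> schwartz_vec"
  show "f \<in> L2_space" by (rule schwartz_vec_L2[OF f])
  have Mf: "opmat_apply M f \<in> schwartz_vec" by (rule opmat_apply_schwartz[OF M f])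
  show "gram M f \<in> L2_space"
    unfolding gram_eq[OF M f] by (intro schwartz_vec_L2 opmat_apply_schwartz'[OF M Mf])
  show "(\<lambda>t. c *s f t) \<in> schwartz_vec"
    using schwartz_vec_lin[OF f f, of c 0] by simp
  have lin: "gram M (\<lambda>t. a *s f t + b *s g t) = (\<lambda>t. a *s gram M f t + b *s gram M g t)"
    if "g \<in> schwartz_vec" for g a b
    by (simp only: gram_eq[OF M schwartz_vec_lin[OF f that]] gram_eq[OF M f] gram_eq[OF M that]
        opmat_apply_lin[OF M f that] opmat_apply_lin'[OF M Mf opmat_apply_schwartz[OF M that]])
  show "gram M (\<lambda>t. c *s f t) = (\<lambda>t. c *s gram M f t)"
    using lin[OF f, of c 0] by simp
  show "L2_ip (gram M f) (e i) = of_real (lam i) * L2_ip f (e i)"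
    by (simp add: gram_symmetric[OF M f e] eig L2_ip_scale_right)
  assume g: "g \<in> schwartz_vec"
  show "(\<lambda>t. f t + g t) \<in> schwartz_vec" using schwartz_vec_lin[OF f g, of 1 1] by simp
  show "gram M (\<lambda>t. f t + g t) = (\<lambda>t. gram M f t + gram M g t)" using lin[OF g, of 1 1] by simp
qed (fact e eig orth complete)+

section \<open>Completeness of the Hermite functions\<close>

text \<open>The positive and negative parts of \<open>w\<close> have equal Fourier transforms, and
  equal mass by frequency 0. Normalized to probability densities they have the same characteristic
  function, so Levy uniqueness identifies them.\<close>

lemma fourier_transform_zero:
  fixes w :: "real \<Rightarrow> real"
  assumes w: "integrable lborel w"
    and F: "\<And>\<xi>. (LINT t|lborel. w t *\<^sub>R iexp (\<xi> * t)) = 0"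
  shows "AE t in lborel. w t = 0"
proof -
  define p where "p t = max 0 (w t)" for t
  define q where "q t = max 0 (- w t)" for t
  have p: "integrable lborel p" and q: "integrable lborel q"
    unfolding p_def[abs_def] q_def[abs_def] using w by auto
  note [measurable] = borel_measurable_integrable[OF p] borel_measurable_integrable[OF q]
  have pq0: "0 \<le> p t" "0 \<le> q t" for t by (auto simp: p_def q_def)
  have wpq: "w t = p t - q t" for t by (auto simp: p_def q_def)
  have int: "integrable lborel (\<lambda>t. r t *\<^sub>R iexp (\<xi> * t))" if "integrable lborel r" for r :: "real \<Rightarrow> real" and \<xi>
  proof (rule Bochner_Integration.integrable_bound[OF that])
    show "(\<lambda>t. r t *\<^sub>R iexp (\<xi> * t)) \<in> borel_measurable lborel"
      using that by measurable
  qed simp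
  have F': "(LINT t|lborel. p t *\<^sub>R iexp (\<xi> * t)) = (LINT t|lborel. q t *\<^sub>R iexp (\<xi> * t))" for \<xi>
    using F[of \<xi>] int[OF p, of \<xi>] int[OF q, of \<xi>]
    by (simp add: wpq scaleR_diff_left)
  define c where "c = (LINT t|lborel. p t)"
  have cq: "c = (LINT t|lborel. q t)"
  proof -
    have "(LINT t|lborel. complex_of_real (p t)) = (LINT t|lborel. complex_of_real (q t))"
      using F'[of 0] by (simp add: scaleR_conv_of_real)
    then show ?thesis by (simp add: c_def)
  qed
  have c0: "0 \<le> c" unfolding c_def by (intro integral_nonneg_AE) (auto simp: p_def)
  show ?thesis
  \<comment> \<open>Without mass there is nothing to normalize, but then both parts vanish almost
    everywhere.\<close>
  proof (cases "c = 0")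
    case True
    have "AE t in lborel. p t = 0"
      using integral_nonneg_eq_0_iff_AE[OF p] pq0 True c_def by simp
    moreover have "AE t in lborel. q t = 0"
      using integral_nonneg_eq_0_iff_AE[OF q] pq0 True cq by simp
    ultimately show ?thesis by eventually_elim (simp add: wpq)
  next
    case False
    with c0 have c: "0 < c" by simp
    have dist: "real_distribution (density lborel (\<lambda>t. ennreal (r t / c)))"
      if r: "integrable lborel r" "\<And>t. 0 \<le> r t" "(LINT t|lborel. r t) = c" for r
    proof -
      have [measurable]: "r \<in> borel_measurable lborel" using r(1) by measurable
      have "(\<integral>\<^sup>+t. ennreal (r t / c) \<partial>lborel) = ennreal (LINT t|lborel. r t / c)"
        using r c by (intro nn_integral_eq_integral) auto
      also have "\<dots> = 1" using r(3) c by simp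
      finally have "prob_space (density lborel (\<lambda>t. ennreal (r t / c)))"
        by (intro prob_spaceI) (simp add: emeasure_density)
      then show ?thesis
        by (simp add: real_distribution_def real_distribution_axioms_def)
    qed
    have char: "char (density lborel (\<lambda>t. ennreal (r t / c))) \<xi> = (LINT t|lborel. r t *\<^sub>R iexp (\<xi> * t)) / c"
      if r: "integrable lborel r" "\<And>t. 0 \<le> r t" for r \<xi>
    proof -
      have [measurable]: "r \<in> borel_measurable lborel" using r(1) by measurable
      have "char (density lborel (\<lambda>t. ennreal (r t / c))) \<xi> = (LINT t|lborel. (r t / c) *\<^sub>R iexp (\<xi> * t))"
        unfolding char_def using r(2) c by (intro integral_density) auto
      also have "\<dots> = (LINT t|lborel. (1 / c) *\<^sub>R (r t *\<^sub>R iexp (\<xi> * t)))"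
        by (intro Bochner_Integration.integral_cong refl) (simp add: field_simps)
      also have "\<dots> = (LINT t|lborel. r t *\<^sub>R iexp (\<xi> * t)) / c"
        by (simp only: integral_scaleR_right) (simp add: scaleR_conv_of_real)
      finally show ?thesis .
    qed
    have "density lborel (\<lambda>t. ennreal (p t / c)) = density lborel (\<lambda>t. ennreal (q t / c))"
    proof (rule Levy_uniqueness)
      show "char (density lborel (\<lambda>t. ennreal (p t / c))) = char (density lborel (\<lambda>t. ennreal (q t / c)))"
        using char[OF p pq0(1)] char[OF q pq0(2)] F' by (simp add: fun_eq_iff)
    qed (intro dist p q pq0 c_def[symmetric] cq[symmetric])+
    then have "AE t in lborel. ennreal (p t / c) = ennreal (q t / c)"
      by (intro sigma_finite_measure.density_unique) (auto intro: lborel.sigma_finite_measure_axioms)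
    then show ?thesis
    proof eventually_elim
      case (elim t)
      then have "p t / c = q t / c" using pq0[of t] c by simp
      then have "p t = q t" using c by simp
      then show ?case by (simp add: wpq)
    qed
  qed
qed

lemma integrable_gauss: "integrable lborel (\<lambda>t::real. exp (- t\<^sup>2 / 2))"
proof -
  have "integrable lborel (\<lambda>t. sqrt (2 * pi) * std_normal_density t)"
    by (intro integrable_mult_right integrable_normal_density) auto
  then show ?thesis by (simp add: std_normal_density_def)
qed

lemma power_le_fact_exp:
  fixes x :: real
  assumes "0 \<le> x"
  shows "x ^ n \<le> fact n * exp x"
proof -
  have "(\<Sum>k\<in>{n}. x ^ k /\<^sub>R fact k) \<le> (\<Sum>k. x ^ k /\<^sub>R fact k)"
    using assms by (intro sum_le_suminf summable_exp_generic) auto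
  then show ?thesis by (simp add: exp_def field_simps)
qed

text \<open>A square integrable function orthogonal to all \<open>t\<^sup>n exp (- t\<^sup>2 / 2)\<close> vanishes: expanding the
  exponential shows that the Fourier transform of \<open>v t * exp (- t\<^sup>2 / 2)\<close> is zero.\<close>

lemma gaussian_moments_zero:
  fixes v :: "real \<Rightarrow> real"
  assumes [measurable]: "v \<in> borel_measurable lborel"
    and v2: "integrable lborel (\<lambda>t. (v t)\<^sup>2)"
    and mom: "\<And>n. (LINT t|lborel. v t * (t ^ n * exp (- t\<^sup>2 / 2))) = 0"
  shows "AE t in lborel. v t = 0"
proof -
  define w where "w t = v t * exp (- t\<^sup>2 / 2)" for t
  have [measurable]: "w \<in> borel_measurable lborel" unfolding w_def by measurable
  \<comment> \<open>The product is split by the inequality between xy and x^2 + y^2, and (2 |\<xi>|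
    - |t|)^2 >= 0 absorbs the exponential into half of the Gaussian decay. The same majorant gives
    integrability of all moments and dominates the partial sums of the exponential series.\<close>
  have bound: "exp \<bar>\<xi> * t\<bar> * \<bar>w t\<bar> \<le> (v t)\<^sup>2 + exp (2 * \<xi>\<^sup>2) * exp (- t\<^sup>2 / 2)" for \<xi> t
  proof -
    let ?E = "exp (\<bar>\<xi> * t\<bar> - t\<^sup>2 / 2)"
    have "?E = exp \<bar>\<xi> * t\<bar> * exp (- t\<^sup>2 / 2)"
      by (simp flip: exp_add)
    then have "exp \<bar>\<xi> * t\<bar> * \<bar>w t\<bar> = \<bar>v t\<bar> * ?E"
      by (simp only: w_def abs_mult abs_exp_cancel mult_ac)
    also have "\<dots> \<le> \<bar>v t\<bar>\<^sup>2 + ?E\<^sup>2"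
    proof -
      have "0 \<le> (\<bar>v t\<bar> - ?E)\<^sup>2" by simp
      moreover have "0 \<le> \<bar>v t\<bar> * ?E" by simp
      ultimately show ?thesis unfolding power2_diff by linarith
    qed
    also have "?E\<^sup>2 = exp (2 * \<bar>\<xi> * t\<bar> - t\<^sup>2)"
      by (simp add: power2_eq_square flip: exp_add)
    also have "\<dots> \<le> exp (2 * \<xi>\<^sup>2 - t\<^sup>2 / 2)"
    proof -
      have "0 \<le> (2 * \<bar>\<xi>\<bar> - \<bar>t\<bar>)\<^sup>2" by simp
      then have "4 * (\<bar>\<xi>\<bar> * \<bar>t\<bar>) \<le> 4 * \<xi>\<^sup>2 + t\<^sup>2"
        by (simp add: power2_diff power_mult_distrib)
      then show ?thesis by (simp add: abs_mult)
    qed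
    also have "\<dots> = exp (2 * \<xi>\<^sup>2) * exp (- t\<^sup>2 / 2)"
      by (simp flip: exp_add)
    finally show ?thesis by simp
  qed
  have dom: "integrable lborel (\<lambda>t. (v t)\<^sup>2 + exp (2 * \<xi>\<^sup>2) * exp (- t\<^sup>2 / 2))" for \<xi> :: real
    by (intro Bochner_Integration.integrable_add v2 integrable_mult_right integrable_gauss)
  have w: "integrable lborel w"
    by (rule Bochner_Integration.integrable_bound[OF dom[of 0]]) (use bound[of 0] in \<open>auto intro: order_trans[OF _ abs_ge_self]\<close>)
  have wn: "integrable lborel (\<lambda>t. w t * t ^ n)" for n
  proof (rule Bochner_Integration.integrable_bound[OF integrable_mult_right[OF dom[of 1], of "fact n"]])
    have "norm (w t * t ^ n) \<le> norm (fact n * ((v t)\<^sup>2 + exp (2 * 1\<^sup>2) * exp (- t\<^sup>2 / 2)))" for t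
    proof -
      have "\<bar>t\<bar> ^ n \<le> fact n * exp \<bar>t\<bar>" by (rule power_le_fact_exp) simp
      then have "\<bar>t\<bar> ^ n * \<bar>w t\<bar> \<le> fact n * exp \<bar>t\<bar> * \<bar>w t\<bar>"
        by (intro mult_right_mono) auto
      also have "\<dots> \<le> fact n * ((v t)\<^sup>2 + exp (2 * 1\<^sup>2) * exp (- t\<^sup>2 / 2))"
        using bound[of 1 t] by (simp add: mult.assoc)
      finally have "\<bar>t\<bar> ^ n * \<bar>w t\<bar> \<le> fact n * ((v t)\<^sup>2 + exp (2 * 1\<^sup>2) * exp (- t\<^sup>2 / 2))" .
      moreover have "norm (w t * t ^ n) = \<bar>t\<bar> ^ n * \<bar>w t\<bar>"
        by (simp add: abs_mult power_abs)
      ultimately show ?thesis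
        unfolding real_norm_def by linarith
    qed
    then show "AE t in lborel. norm (w t * t ^ n) \<le> norm (fact n * ((v t)\<^sup>2 + exp (2 * 1\<^sup>2) * exp (- t\<^sup>2 / 2)))"
      by (intro AE_I2)
  qed measurable
  have wn0: "(LINT t|lborel. w t * t ^ n) = 0" for n
    using mom[of n] by (simp add: w_def mult_ac)
  have "(LINT t|lborel. w t *\<^sub>R iexp (\<xi> * t)) = 0" for \<xi>
  proof -
    define z where "z t = \<i> * complex_of_real (\<xi> * t)" for t
    define s where "s N t = w t *\<^sub>R (\<Sum>n<N. z t ^ n /\<^sub>R fact n)" for N t
    have zm [measurable]: "z \<in> borel_measurable lborel" unfolding z_def by measurable
    have "(\<lambda>N. LINT t|lborel. s N t) \<longlonglongrightarrow> (LINT t|lborel. w t *\<^sub>R iexp (\<xi> * t))"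
    proof (rule integral_dominated_convergence[OF _ _ dom[of \<xi>]])
      show "AE t in lborel. (\<lambda>N. s N t) \<longlonglongrightarrow> w t *\<^sub>R iexp (\<xi> * t)"
      proof (intro AE_I2)
        fix t
        have "(\<lambda>N. \<Sum>n<N. z t ^ n /\<^sub>R fact n) \<longlonglongrightarrow> exp (z t)"
          using exp_converges[of "z t"] by (simp add: sums_def)
        then show "(\<lambda>N. s N t) \<longlonglongrightarrow> w t *\<^sub>R iexp (\<xi> * t)"
          unfolding s_def z_def[symmetric] by (intro tendsto_intros)
      qed
      show "AE t in lborel. norm (s N t) \<le> (v t)\<^sup>2 + exp (2 * \<xi>\<^sup>2) * exp (- t\<^sup>2 / 2)" for N
      proof (intro AE_I2)
        fix t
        have "norm (\<Sum>n<N. z t ^ n /\<^sub>R fact n) \<le> (\<Sum>n<N. \<bar>\<xi> * t\<bar> ^ n /\<^sub>R fact n)"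
          by (rule order_trans[OF norm_sum]) (simp add: z_def norm_mult norm_power abs_mult)
        also have "\<dots> \<le> exp \<bar>\<xi> * t\<bar>"
          unfolding exp_def by (intro sum_le_suminf summable_exp_generic) auto
        finally have "norm (s N t) \<le> exp \<bar>\<xi> * t\<bar> * \<bar>w t\<bar>"
          unfolding s_def norm_scaleR by (subst mult.commute) (intro mult_right_mono, auto)
        also note bound
        finally show "norm (s N t) \<le> (v t)\<^sup>2 + exp (2 * \<xi>\<^sup>2) * exp (- t\<^sup>2 / 2)" .
      qed
    qed (unfold s_def, measurable)
    moreover have "(LINT t|lborel. s N t) = 0" for N
    proof -
      have "s N t = (\<Sum>n<N. ((\<i> * of_real \<xi>) ^ n / fact n) * of_real (w t * t ^ n))" for t
        by (simp add: s_def z_def scaleR_conv_of_real sum_distrib_left power_mult_distrib field_simps)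
      then have "(LINT t|lborel. s N t)
          = (\<Sum>n<N. LINT t|lborel. ((\<i> * of_real \<xi>) ^ n / fact n) * complex_of_real (w t * t ^ n))"
        by (simp only:) (intro Bochner_Integration.integral_sum integrable_mult_right integrable_of_real wn)
      also have "\<dots> = 0"
        by (simp only: integral_mult_right_zero integral_complex_of_real wn0) simp
      finally show ?thesis .
    qed
    ultimately show ?thesis by (simp add: LIMSEQ_const_iff)
  qed
  then have "AE t in lborel. w t = 0"
    by (intro fourier_transform_zero w)
  then show ?thesis by eventually_elim (simp add: w_def)
qed

section \<open>Polynomials times the Gaussian\<close>

definition gauss_poly :: "real poly \<Rightarrow> real \<Rightarrow> complex" where
  "gauss_poly p t = of_real (poly p t * exp (- t\<^sup>2 / 2))"

lemma gauss_poly_deriv: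
  "(gauss_poly p has_vector_derivative gauss_poly (pderiv p - [:0, 1:] * p) t) (at t)"
proof -
  have "((\<lambda>t. poly p t * exp (- t\<^sup>2 / 2)) has_real_derivative
      poly (pderiv p - [:0, 1:] * p) t * exp (- t\<^sup>2 / 2)) (at t)"
    by (auto intro!: derivative_eq_intros simp: algebra_simps)
  then show ?thesis
    unfolding gauss_poly_def[abs_def]
    by (intro has_vector_derivative_of_real) (simp add: has_real_derivative_iff_has_vector_derivative)
qed

lemma gauss_poly_bounded: "\<exists>C. \<forall>t. norm (gauss_poly p t) \<le> C"
proof (intro exI allI)
  fix t :: real
  have le: "\<bar>t ^ i\<bar> * exp (- t\<^sup>2 / 2) \<le> fact i * exp (1 / 2)" for i
  proof -
    have "\<bar>t ^ i\<bar> * exp (- t\<^sup>2 / 2) \<le> (fact i * exp \<bar>t\<bar>) * exp (- t\<^sup>2 / 2)"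
      unfolding power_abs by (intro mult_right_mono power_le_fact_exp) auto
    also have "\<dots> = fact i * exp (\<bar>t\<bar> - t\<^sup>2 / 2)"
      by (simp flip: exp_add add: mult.assoc)
    also have "\<dots> \<le> fact i * exp (1 / 2)"
    proof -
      have "0 \<le> (\<bar>t\<bar> - 1)\<^sup>2" by simp
      then show ?thesis by (simp add: power2_diff)
    qed
    finally show ?thesis .
  qed
  have "norm (gauss_poly p t) = \<bar>\<Sum>i\<le>degree p. coeff p i * t ^ i\<bar> * exp (- t\<^sup>2 / 2)"
    unfolding gauss_poly_def norm_of_real abs_mult poly_altdef by simp
  also have "\<dots> \<le> (\<Sum>i\<le>degree p. \<bar>coeff p i * t ^ i\<bar>) * exp (- t\<^sup>2 / 2)"
    by (intro mult_right_mono sum_abs) auto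
  also have "\<dots> = (\<Sum>i\<le>degree p. \<bar>coeff p i\<bar> * (\<bar>t ^ i\<bar> * exp (- t\<^sup>2 / 2)))"
    by (simp add: sum_distrib_right abs_mult mult.assoc)
  also have "\<dots> \<le> (\<Sum>i\<le>degree p. \<bar>coeff p i\<bar> * (fact i * exp (1 / 2)))"
    by (intro sum_mono mult_left_mono le) auto
  finally show "norm (gauss_poly p t) \<le> (\<Sum>i\<le>degree p. \<bar>coeff p i\<bar> * (fact i * exp (1 / 2)))" .
qed

text \<open>Differentiation and multiplication by t preserve the form polynomial times Gaussian, so
  each Schwartz bound reduces to boundedness of such a function.\<close>

lemma gauss_poly_schwartz: "gauss_poly p \<in> schwartz"
proof -
  have ex: "\<exists>q. (vderiv ^^ m) (gauss_poly p) = gauss_poly q" for m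
  proof (induction m)
    case (Suc m)
    then show ?case using vderivI[OF gauss_poly_deriv] by auto
  qed auto
  have "(vderiv ^^ m) (gauss_poly p) differentiable_on UNIV" for m
    using ex[of m] differentiable_onI_deriv[OF gauss_poly_deriv] by auto
  moreover have "bounded (range (\<lambda>t. t ^ k *\<^sub>R (vderiv ^^ m) (gauss_poly p) t))" for k m
  proof -
    obtain q where q: "(vderiv ^^ m) (gauss_poly p) = gauss_poly q" using ex by blast
    have "t ^ k *\<^sub>R gauss_poly q t = gauss_poly (monom 1 k * q) t" for t
      by (simp add: gauss_poly_def poly_monom scaleR_conv_of_real)
    then show ?thesis
      unfolding q using gauss_poly_bounded[of "monom 1 k * q"] by (auto simp: bounded_iff)
  qed
  ultimately show ?thesis by (simp add: schwartz_def)
qed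

text \<open>With \<open>H\<^sub>k\<close> the physicists' Hermite polynomials, \<open>her k t = H\<^sub>k t * exp (- t\<^sup>2 / 2) / k!\<close>.
  This normalization makes the actions of \<open>d/dt + t\<close> and \<open>t - d/dt\<close> polynomial in \<open>k\<close> and compatible
  with the extension by zero to negative \<open>k\<close>.\<close>

fun her :: "nat \<Rightarrow> real \<Rightarrow> real" where
  "her 0 t = exp (- t\<^sup>2 / 2)"
| "her (Suc 0) t = 2 * t * exp (- t\<^sup>2 / 2)"
| "her (Suc (Suc k)) t = 2 * (t * her (Suc k) t - her k t) / (real k + 2)"

definition psi :: "int \<Rightarrow> real \<Rightarrow> complex" where
  "psi k t = (if k < 0 then 0 else of_real (her (nat k) t))"

section \<open>Recurrences of the Hermite functions\<close>

lemma her_deriv: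
  "(her k has_real_derivative 2 * (if k = 0 then 0 else her (k - 1) t) - t * her k t) (at t)"
proof (induction k t rule: her.induct)
  case (1 t)
  show ?case by (auto intro!: derivative_eq_intros)
next
  case (2 t)
  show ?case by (auto intro!: derivative_eq_intros simp: power2_eq_square algebra_simps)
next
  case (3 k t)
  have rec: "her (Suc (Suc k)) = (\<lambda>t. 2 * (t * her (Suc k) t - her k t) / (real k + 2))"
    by (simp add: fun_eq_iff)
  have k: "real k + 2 \<noteq> 0" by linarith
  \<comment> \<open>The three-term recurrence one index lower, cleared of its denominator; it
    removes the index \<open>k - 1\<close> from the derivative.\<close>
  have e: "2 * (t * her k t - (if k = 0 then 0 else her (k - 1) t)) = (real k + 1) * her (Suc k) t"
  proof (cases k)
    case (Suc j)
    have "real j + 2 \<noteq> 0" by linarith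
    then show ?thesis by (simp add: Suc add.commute[of "2::real" "real j"])
  qed simp
  have "(her (Suc (Suc k)) has_real_derivative
      2 * ((her (Suc k) t + t * (2 * her k t - t * her (Suc k) t))
        - (2 * (if k = 0 then 0 else her (k - 1) t) - t * her k t)) / (real k + 2)) (at t)"
    unfolding rec by (rule derivative_eq_intros 3 refl | use k in simp)+
  also have "2 * ((her (Suc k) t + t * (2 * her k t - t * her (Suc k) t))
        - (2 * (if k = 0 then 0 else her (k - 1) t) - t * her k t))
      = 2 * (her (Suc k) t + 2 * (t * her k t - (if k = 0 then 0 else her (k - 1) t)))
        + 2 * (t * her k t - t * (t * her (Suc k) t)) - 2 * (2 * t * her k t) + 2 * (t * her k t) + 2 * (t * her k t)"
    by (simp add: algebra_simps)
  also have "\<dots> / (real k + 2) = 2 * her (Suc k) t - t * her (Suc (Suc k)) t"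
    unfolding e using k by (simp add: field_simps)
  finally show ?case by simp
qed

lemma her_step: "t * her k t = (if k = 0 then 0 else her (k - 1) t) + (real k + 1) / 2 * her (Suc k) t"
proof (cases k)
  case (Suc j)
  have "real j + 2 \<noteq> 0" by linarith
  then show ?thesis by (simp add: Suc field_simps)
qed simp

lemma psi_neg: "k < 0 \<Longrightarrow> psi k = (\<lambda>t. 0)"
  by (simp add: psi_def fun_eq_iff)

text \<open>Valid for every integer: at \<open>k = - 1\<close> the factor \<open>k + 1\<close>
  cancels \<open>psi 0\<close>. This is what allows blocks reaching into negative indices to be
  treated by the same formulas.\<close>

lemma psi_mult_ident: "of_real t * psi k t = psi (k - 1) t + (of_int k + 1) / 2 * psi (k + 1) t"
proof (cases "k < 0")
  case True
  then show ?thesis by (cases "k = - 1") (simp_all add: psi_def)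
next
  case False
  then obtain n where n: "k = int n" by (metis nonneg_int_cases not_less)
  show ?thesis
  proof (cases n)
    case 0
    then show ?thesis by (simp add: n psi_def)
  next
    case (Suc j)
    have "nat (1 + int j) = Suc j" "nat (2 + int j) = Suc (Suc j)" by linarith+
    then show ?thesis
      using arg_cong[where f = complex_of_real, OF her_step[of t "Suc j"]]
      by (simp add: n Suc psi_def add_ac del: her.simps)
  qed
qed

lemma psi_deriv: "(psi k has_vector_derivative psi (k - 1) t - (of_int k + 1) / 2 * psi (k + 1) t) (at t)"
proof (cases "k < 0")
  case True
  then show ?thesis by (cases "k = - 1") (simp_all add: psi_neg)
next
  case False
  then obtain n where n: "k = int n" by (metis nonneg_int_cases not_less)
  have eq: "psi k = (\<lambda>t. complex_of_real (her n t))"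
    by (simp add: n psi_def fun_eq_iff)
  have prev: "psi (k - 1) t = complex_of_real (if n = 0 then 0 else her (n - 1) t)"
  proof (cases n)
    case (Suc j)
    then show ?thesis by (simp add: n psi_def)
  qed (simp add: n psi_def)
  have "((\<lambda>t. complex_of_real (her n t)) has_vector_derivative
      complex_of_real (2 * (if n = 0 then 0 else her (n - 1) t) - t * her n t)) (at t)"
    using her_deriv[of n t]
    by (intro has_vector_derivative_of_real) (simp add: has_real_derivative_iff_has_vector_derivative)
  also have "complex_of_real (2 * (if n = 0 then 0 else her (n - 1) t) - t * her n t)
      = 2 * psi (k - 1) t - of_real t * psi k t"
    unfolding of_real_diff of_real_mult prev eq by simp
  also have "\<dots> = psi (k - 1) t - (of_int k + 1) / 2 * psi (k + 1) t"
    unfolding psi_mult_ident by simp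
  finally show ?thesis unfolding eq .
qed

lemma psi_schwartz: "psi k \<in> schwartz"
proof (cases "k < 0")
  case True
  then show ?thesis by (simp add: psi_neg schwartz_zero)
next
  case False
  have step: "psi (int n) \<in> schwartz \<and> psi (int n - 1) \<in> schwartz" for n
  proof (induction n)
    case 0
    have "psi 0 = gauss_poly 1" by (simp add: psi_def gauss_poly_def fun_eq_iff)
    then show ?case by (simp add: gauss_poly_schwartz psi_neg schwartz_zero)
  next
    case (Suc n)
    have n: "of_int (int n) + 1 \<noteq> (0 :: complex)"
      by (metis of_int_of_nat_eq of_nat_Suc of_nat_eq_0_iff add.commute nat.distinct(1))
    have "psi (int n + 1) = (\<lambda>t. (2 / (of_int (int n) + 1)) * (of_real t * psi (int n) t)
        + (- 2 / (of_int (int n) + 1)) * psi (int n - 1) t)"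
    proof
      fix t
      have "X = (2 / c) * (Y + c / 2 * X) + (- 2 / c) * Y" if "c \<noteq> 0" for c X Y :: complex
        using that by (simp add: field_simps)
      from this[OF n] show "psi (int n + 1) t = (2 / (of_int (int n) + 1)) * (of_real t * psi (int n) t)
        + (- 2 / (of_int (int n) + 1)) * psi (int n - 1) t"
        unfolding psi_mult_ident .
    qed
    then have "psi (int n + 1) \<in> schwartz"
      using schwartz_lin[OF schwartz_mult_ident] Suc by metis
    then show ?case using Suc by (simp add: add.commute)
  qed
  from False obtain n where "k = int n" by (metis nonneg_int_cases not_less)
  then show ?thesis using step by blast
qed

section \<open>Orthogonality of the Hermite functions\<close>

lemma vderiv_psi: "vderiv (psi k) = (\<lambda>t. psi (k - 1) t - (of_int k + 1) / 2 * psi (k + 1) t)"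
  by (rule vderivI[OF psi_deriv])

text \<open>Adjointness of d/dt + t and t - d/dt, which send \<open>psi j\<close> to
  \<open>2 psi (j - 1)\<close> and \<open>psi k\<close> to \<open>(k + 1) psi (k + 1)\<close>. It is
  obtained by adding integration by parts to the symmetry of multiplication by t.\<close>

lemma psi_recurrence:
  "(of_int k + 1) * L2_inner (psi j) (psi (k + 1)) = 2 * L2_inner (psi (j - 1)) (psi k)"
proof -
  let ?I = "\<lambda>j k. L2_inner (psi j) (psi k)"
  let ?a = "\<lambda>k. (of_int k + 1) / (2 :: complex)"
  have A: "(\<lambda>t. psi (j - 1) t - ?a j * psi (j + 1) t) = (\<lambda>t. 1 * psi (j - 1) t + (- ?a j) * psi (j + 1) t)"
    and B: "(\<lambda>t. psi (j - 1) t + ?a j * psi (j + 1) t) = (\<lambda>t. 1 * psi (j - 1) t + ?a j * psi (j + 1) t)" for j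
    by (simp_all add: fun_eq_iff)
  have "?I (j - 1) k - ?a j * ?I (j + 1) k = L2_inner (vderiv (psi j)) (psi k)"
    unfolding vderiv_psi A by (subst L2_inner_lin_left) (simp_all add: psi_schwartz)
  also have "\<dots> = - L2_inner (psi j) (vderiv (psi k))"
    by (intro L2_inner_vderiv psi_schwartz)
  also have "\<dots> = - ?I j (k - 1) + ?a k * ?I j (k + 1)"
    unfolding vderiv_psi A by (subst L2_inner_lin_right) (simp_all add: psi_schwartz)
  finally have 1: "?I (j - 1) k - ?a j * ?I (j + 1) k = - ?I j (k - 1) + ?a k * ?I j (k + 1)" .
  have "?I (j - 1) k + ?a j * ?I (j + 1) k = L2_inner (\<lambda>t. of_real t * psi j t) (psi k)"
    unfolding psi_mult_ident B by (subst L2_inner_lin_left) (simp_all add: psi_schwartz)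
  also have "\<dots> = L2_inner (psi j) (\<lambda>t. of_real t * psi k t)"
    by (simp add: L2_inner_def mult_ac)
  also have "\<dots> = ?I j (k - 1) + ?a k * ?I j (k + 1)"
    unfolding psi_mult_ident B by (subst L2_inner_lin_right) (simp_all add: psi_schwartz)
  finally have 2: "?I (j - 1) k + ?a j * ?I (j + 1) k = ?I j (k - 1) + ?a k * ?I j (k + 1)" .
  have "2 * ?I (j - 1) k = 2 * (?a k * ?I j (k + 1))"
    using arg_cong2[where f = "(+)", OF 1 2] by (simp add: algebra_simps)
  then show ?thesis by simp
qed

text \<open>The recurrence lowers both indices together until the smaller one becomes
  negative.\<close>

lemma psi_orth:
  assumes "j \<noteq> k"
  shows "L2_inner (psi j) (psi k) = 0"
proof -
  have less: "L2_inner (psi j) (psi k) = 0" if jk: "j < k" for j k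
  proof (cases "j < 0")
    case False
    then obtain n where n: "j = int n" by (metis nonneg_int_cases not_less)
    have "L2_inner (psi (int n)) (psi k) = 0" if "int n < k" for k
      using that
    proof (induction n arbitrary: k)
      case 0
      then show ?case using psi_recurrence[of "k - 1" 0] by (simp add: psi_neg L2_inner_def)
    next
      case (Suc n)
      have "L2_inner (psi (int n)) (psi (k - 1)) = 0" by (rule Suc.IH) (use Suc.prems in simp)
      then show ?case using psi_recurrence[of "k - 1" "int (Suc n)"] Suc.prems by simp
    qed
    then show ?thesis using jk n by simp
  qed (simp add: psi_neg L2_inner_def)
  show ?thesis
  proof (cases "j < k")
    case False
    then have "L2_inner (psi k) (psi j) = 0" using less assms by simp
    then show ?thesis using cnj_L2_inner[of "psi k" "psi j"] by simp
  qed (rule less)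
qed

text \<open>On the diagonal the recurrence carries nonvanishing upwards from the Gaussian.\<close>

lemma psi_norm_neq_0:
  assumes "0 \<le> k"
  shows "L2_inner (psi k) (psi k) \<noteq> 0"
proof -
  have "L2_inner (psi (int n)) (psi (int n)) \<noteq> 0" for n
  proof (induction n)
    case 0
    have "psi 0 0 \<noteq> 0" by (simp add: psi_def)
    then have "psi 0 \<noteq> (\<lambda>t. 0)" by (auto simp: fun_eq_iff)
    then show ?case using schwartz_inner_self_eq_0[OF psi_schwartz] by auto
  next
    case (Suc n)
    then show ?case using psi_recurrence[of "int n" "int (Suc n)"] by (auto simp: add.commute)
  qed
  then show ?thesis using assms by (metis nonneg_int_cases)
qed

section \<open>Completeness for square integrable functions\<close>

lemma integrable_L2_schwartz:
  assumes u: "u \<in> borel_measurable lborel" "integrable lborel (\<lambda>t. (norm (u t :: complex))\<^sup>2)"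
    and g: "g \<in> schwartz"
  shows "integrable lborel (\<lambda>t. u t * cnj (g t))"
proof (rule Bochner_Integration.integrable_bound)
  have "(\<lambda>t. cnj (g t)) \<in> borel_measurable borel"
    by (intro borel_measurable_continuous_onI continuous_intros continuous_on_schwartz g)
  then show "(\<lambda>t. u t * cnj (g t)) \<in> borel_measurable lborel"
    by (intro borel_measurable_times u) simp
  have "integrable lborel (\<lambda>t. complex_of_real ((norm (g t))\<^sup>2))"
    using integrable_schwartz_mult[OF g g] by (simp add: complex_norm_square del: of_real_power)
  then have "integrable lborel (\<lambda>t. (norm (g t))\<^sup>2)"
    by (simp only: complex_of_real_integrable_eq)
  then show "integrable lborel (\<lambda>t. (norm (u t))\<^sup>2 + (norm (g t))\<^sup>2)"
    by (intro Bochner_Integration.integrable_add u)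
  have "norm (u t * cnj (g t)) \<le> norm ((norm (u t))\<^sup>2 + (norm (g t))\<^sup>2)" for t
  proof -
    have "0 \<le> (norm (u t) - norm (g t))\<^sup>2" by simp
    moreover have "0 \<le> norm (u t) * norm (g t)" by simp
    ultimately have "norm (u t) * norm (g t) \<le> (norm (u t))\<^sup>2 + (norm (g t))\<^sup>2"
      unfolding power2_diff by linarith
    then show ?thesis by (simp add: norm_mult)
  qed
  then show "AE t in lborel. norm (u t * cnj (g t)) \<le> norm ((norm (u t))\<^sup>2 + (norm (g t))\<^sup>2)"
    by (intro AE_I2)
qed

lemma L2_inner_lin_right':
  assumes u: "u \<in> borel_measurable lborel" "integrable lborel (\<lambda>t. (norm (u t :: complex))\<^sup>2)"
    and f: "f \<in> schwartz" and g: "g \<in> schwartz"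
  shows "L2_inner u (\<lambda>t. a * f t + b * g t) = cnj a * L2_inner u f + cnj b * L2_inner u g"
proof -
  have "L2_inner u (\<lambda>t. a * f t + b * g t)
      = (LINT t|lborel. cnj a * (u t * cnj (f t)) + cnj b * (u t * cnj (g t)))"
    unfolding L2_inner_def by (intro Bochner_Integration.integral_cong refl) (simp add: algebra_simps)
  also have "\<dots> = cnj a * L2_inner u f + cnj b * L2_inner u g"
    by (subst Bochner_Integration.integral_add)
       (simp_all add: L2_inner_def integrable_L2_schwartz[OF u] f g)
  finally show ?thesis .
qed

text \<open>Multiplication by t maps the span of the Hermite functions into itself, so orthogonality
  to all \<open>psi k\<close> includes orthogonality to t^n \<open>psi 0\<close>, that is, vanishing
  Gaussian moments of the real and the imaginary part.\<close>

lemma psi_complete: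
  assumes u: "u \<in> borel_measurable lborel" "integrable lborel (\<lambda>t. (norm (u t :: complex))\<^sup>2)"
    and z: "\<And>k. 0 \<le> k \<Longrightarrow> L2_inner u (psi k) = 0"
  shows "AE t in lborel. u t = 0"
proof -
  note [measurable] = u(1)
  have z': "L2_inner u (psi k) = 0" for k
  proof (cases "k < 0")
    case True
    then show ?thesis by (simp add: psi_neg L2_inner_def)
  qed (simp add: z)
  have S: "(\<lambda>t. of_real t ^ n * psi k t) \<in> schwartz" for n k
  proof (induction n)
    case (Suc n)
    show ?case using schwartz_mult_ident[OF Suc] by (simp add: mult.assoc)
  qed (simp add: psi_schwartz)
  have mom: "L2_inner u (\<lambda>t. of_real t ^ n * psi k t) = 0" for n k
  proof (induction n arbitrary: k)
    case (Suc n)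
    have "of_real t ^ Suc n * psi k t = 1 * (of_real t ^ n * psi (k - 1) t)
        + ((of_int k + 1) / 2) * (of_real t ^ n * psi (k + 1) t)" for t
    proof -
      have "of_real t ^ Suc n * psi k t = of_real t ^ n * (of_real t * psi k t)" by simp
      also have "\<dots> = 1 * (of_real t ^ n * psi (k - 1) t)
        + ((of_int k + 1) / 2) * (of_real t ^ n * psi (k + 1) t)"
        unfolding psi_mult_ident by (simp add: algebra_simps)
      finally show ?thesis .
    qed
    then show ?case
      by (simp only: L2_inner_lin_right'[OF u S S] Suc) simp
  qed (simp add: z')
  have int: "integrable lborel (\<lambda>t. u t * of_real (t ^ n * exp (- t\<^sup>2 / 2)))" for n
    using integrable_L2_schwartz[OF u S[of n 0]] by (simp add: psi_def)
  have zero: "(LINT t|lborel. u t * of_real (t ^ n * exp (- t\<^sup>2 / 2))) = 0" for n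
    using mom[of n 0] by (simp add: L2_inner_def psi_def)
  have "AE t in lborel. Re (u t) = 0"
  proof (rule gaussian_moments_zero)
    show "integrable lborel (\<lambda>t. (Re (u t))\<^sup>2)"
      by (rule Bochner_Integration.integrable_bound[OF u(2)]) (auto simp: abs_Re_le_cmod power_mono_iff cmod_power2)
    show "(LINT t|lborel. Re (u t) * (t ^ n * exp (- t\<^sup>2 / 2))) = 0" for n
      using integral_Re[OF int[of n]] zero[of n] by simp
  qed measurable
  moreover have "AE t in lborel. Im (u t) = 0"
  proof (rule gaussian_moments_zero)
    show "integrable lborel (\<lambda>t. (Im (u t))\<^sup>2)"
      by (rule Bochner_Integration.integrable_bound[OF u(2)]) (auto simp: cmod_power2)
    show "(LINT t|lborel. Im (u t) * (t ^ n * exp (- t\<^sup>2 / 2))) = 0" for n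
      using integral_Im[OF int[of n]] zero[of n] by simp
  qed measurable
  ultimately show ?thesis by eventually_elim (simp add: complex_eq_iff)
qed

lemma L2_space_component:
  assumes "u \<in> L2_space"
  shows "(\<lambda>t. u t $ i) \<in> borel_measurable lborel" "integrable lborel (\<lambda>t. (norm (u t $ i))\<^sup>2)"
proof -
  note [measurable] = L2_spaceD(1)[OF assms]
  show m: "(\<lambda>t. u t $ i) \<in> borel_measurable lborel" by measurable
  show "integrable lborel (\<lambda>t. (norm (u t $ i))\<^sup>2)"
  proof (rule Bochner_Integration.integrable_bound[OF L2_spaceD(2)[OF assms]])
    show "(\<lambda>t. (norm (u t $ i))\<^sup>2) \<in> borel_measurable lborel" using m by measurable
  qed (intro AE_I2, simp add: power_mono Finite_Cartesian_Product.norm_nth_le)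
qed

lemma psi_complete_vec:
  fixes u :: "real \<Rightarrow> complex ^ 'n"
  assumes u: "u \<in> L2_space" and z: "\<And>i k. 0 \<le> k \<Longrightarrow> L2_inner (\<lambda>t. u t $ i) (psi k) = 0"
  shows "L2_eq u (\<lambda>_. 0)"
proof -
  have "AE t in lborel. \<forall>i\<in>UNIV. u t $ i = 0"
    using psi_complete[OF L2_space_component[OF u] z] by (subst AE_finite_all) auto
  then show ?thesis by (simp add: L2_eq_def vec_eq_iff)
qed

lemma L2_ip_L2_schwartz:
  assumes u: "u \<in> L2_space" and g: "g \<in> schwartz_vec"
  shows "L2_ip u g = (\<Sum>i\<in>UNIV. L2_inner (\<lambda>t. u t $ i) (\<lambda>t. g t $ i))"
proof -
  have "(\<lambda>t. g t $ i) \<in> schwartz" for i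
    using g by (simp add: schwartz_vec_def)
  then show ?thesis
    unfolding L2_ip_def L2_inner_def cdot_def
    by (intro Bochner_Integration.integral_sum integrable_L2_schwartz L2_space_component u)
qed

section \<open>Finite Hermite expansions\<close>

text \<open>Differentiation on coefficients, with position \<open>j\<close> standing for
  \<open>psi (n + j)\<close>; \<open>seqX\<close> is multiplication by t in the same way. Positions
  are relative, so \<open>n\<close> is a parameter and statements about all blocks become polynomial
  identities in \<open>n\<close>.\<close>

definition seqD :: "int \<Rightarrow> (int \<Rightarrow> real) \<Rightarrow> int \<Rightarrow> real" where
  "seqD n c j = c (j + 1) - (of_int n + of_int j) / 2 * c (j - 1)"

definition seqX :: "int \<Rightarrow> (int \<Rightarrow> real) \<Rightarrow> int \<Rightarrow> real" where
  "seqX n c j = c (j + 1) + (of_int n + of_int j) / 2 * c (j - 1)"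

definition fin_supp :: "(int \<Rightarrow> real) \<Rightarrow> bool" where
  "fin_supp c \<longleftrightarrow> finite {j. c j \<noteq> 0}"

text \<open>\<open>c\<close> lists coefficients relative to the index \<open>n\<close>; the complex factor \<open>z\<close> is kept apart so that
  all coefficients stay real.\<close>

definition Psi :: "int \<Rightarrow> complex \<Rightarrow> (int \<Rightarrow> real) \<Rightarrow> real \<Rightarrow> complex" where
  "Psi n z c t = z * (\<Sum>j | c j \<noteq> 0. of_real (c j) * psi (n + j) t)"

lemma fin_supp_subset:
  assumes "fin_supp c" "fin_supp d" "\<And>j. e j \<noteq> 0 \<Longrightarrow> c j \<noteq> 0 \<or> d j \<noteq> 0"
  shows "fin_supp e"
  using assms unfolding fin_supp_def
  by (intro finite_subset[of "{j. e j \<noteq> 0}" "{j. c j \<noteq> 0} \<union> {j. d j \<noteq> 0}"]) auto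

lemma fin_supp_shift:
  assumes "fin_supp c"
  shows "fin_supp (\<lambda>j. c (j + d))"
proof -
  have "{j. c (j + d) \<noteq> 0} = (\<lambda>j. j - d) ` {j. c j \<noteq> 0}"
    by (force simp: image_iff)
  then show ?thesis using assms by (simp add: fin_supp_def)
qed

lemma fin_supp_add [simp]: "fin_supp c \<Longrightarrow> fin_supp d \<Longrightarrow> fin_supp (\<lambda>j. c j + d j)"
  by (rule fin_supp_subset[of c d]) auto

lemma fin_supp_diff [simp]: "fin_supp c \<Longrightarrow> fin_supp d \<Longrightarrow> fin_supp (\<lambda>j. c j - d j)"
  by (rule fin_supp_subset[of c d]) auto

lemma fin_supp_uminus [simp]: "fin_supp c \<Longrightarrow> fin_supp (\<lambda>j. - c j)"
  by (rule fin_supp_subset[of c c]) auto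

lemma fin_supp_mult [simp]: "fin_supp c \<Longrightarrow> fin_supp (\<lambda>j. a j * c j)"
  by (rule fin_supp_subset[of c c]) auto

lemma fin_supp_seqD [simp]: "fin_supp c \<Longrightarrow> fin_supp (seqD n c)"
  unfolding seqD_def[abs_def]
  using fin_supp_diff[OF fin_supp_shift[of c 1] fin_supp_mult[OF fin_supp_shift[of c "- 1"],
      of "\<lambda>j. (of_int n + of_int j) / 2"]] by simp

lemma fin_supp_seqX [simp]: "fin_supp c \<Longrightarrow> fin_supp (seqX n c)"
  unfolding seqX_def[abs_def]
  using fin_supp_add[OF fin_supp_shift[of c 1] fin_supp_mult[OF fin_supp_shift[of c "- 1"],
      of "\<lambda>j. (of_int n + of_int j) / 2"]] by simp

text \<open>Frees the sum from the exact support, so that several sequences can be summed over one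
  common finite set.\<close>

lemma Psi_superset:
  assumes "finite F" "\<And>j. j \<notin> F \<Longrightarrow> c j = 0"
  shows "Psi n z c t = z * (\<Sum>j\<in>F. of_real (c j) * psi (n + j) t)"
  unfolding Psi_def using assms
  by (intro arg_cong2[where f = "(*)"] refl sum.mono_neutral_left) auto

lemma Psi_lin:
  assumes "fin_supp c" "fin_supp d"
  shows "Psi n z (\<lambda>j. a * c j + b * d j) t = of_real a * Psi n z c t + of_real b * Psi n z d t"
proof -
  let ?F = "{j. c j \<noteq> 0} \<union> {j. d j \<noteq> 0}"
  have F: "finite ?F" using assms by (simp add: fin_supp_def)
  show ?thesis
    by (subst (1 2 3) Psi_superset[OF F])
       (auto simp: sum_distrib_left sum.distrib[symmetric] algebra_simps intro!: sum.cong)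
qed

lemma Psi_add: "fin_supp c \<Longrightarrow> fin_supp d \<Longrightarrow> Psi n z (\<lambda>j. c j + d j) t = Psi n z c t + Psi n z d t"
  using Psi_lin[of c d n z 1 1 t] by simp

lemma Psi_diff: "fin_supp c \<Longrightarrow> fin_supp d \<Longrightarrow> Psi n z (\<lambda>j. c j - d j) t = Psi n z c t - Psi n z d t"
  using Psi_lin[of c d n z 1 "- 1" t] by simp

lemma Psi_uminus: "fin_supp c \<Longrightarrow> Psi n z (\<lambda>j. - c j) t = - Psi n z c t"
  using Psi_lin[of c c n z "- 1" 0 t] by simp

lemma Psi_mult: "fin_supp c \<Longrightarrow> Psi n z (\<lambda>j. a * c j) t = of_real a * Psi n z c t"
  using Psi_lin[of c c n z a 0 t] by simp

lemma sum_shift: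
  fixes g :: "int \<Rightarrow> 'a::comm_monoid_add"
  assumes "finite F" "\<And>j. j \<notin> F \<Longrightarrow> g j = 0" "finite H" "(\<lambda>j. j - d) ` F \<subseteq> H"
  shows "(\<Sum>j\<in>H. g (j + d)) = (\<Sum>j\<in>F. g j)"
proof -
  have "(\<Sum>j\<in>H. g (j + d)) = (\<Sum>j\<in>(\<lambda>j. j - d) ` F. g (j + d))"
  proof (rule sum.mono_neutral_right[OF assms(3,4)], intro ballI)
    fix j assume "j \<in> H - (\<lambda>j. j - d) ` F"
    then have "j + d \<notin> F" by (metis DiffD2 add_diff_cancel_right' image_eqI)
    then show "g (j + d) = 0" by (rule assms(2))
  qed
  also have "\<dots> = (\<Sum>j\<in>F. g j)"
    by (subst sum.reindex) (auto simp: inj_on_def)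
  finally show ?thesis .
qed

text \<open>The two recurrences of \<open>psi\<close> differ by a sign only: \<open>s = 1\<close> is
  multiplication by t, \<open>s = - 1\<close> is differentiation.\<close>

lemma Psi_neighbours:
  assumes c: "fin_supp c"
  shows "Psi n z (\<lambda>j. c (j + 1) + s * ((of_int n + of_int j) / 2 * c (j - 1))) t
    = z * (\<Sum>j | c j \<noteq> 0. of_real (c j) * (psi (n + j - 1) t + of_real s * ((of_int (n + j) + 1) / 2 * psi (n + j + 1) t)))"
proof -
  let ?F = "{j. c j \<noteq> 0}"
  let ?H = "(\<lambda>j. j - 1) ` ?F \<union> (\<lambda>j. j + 1) ` ?F"
  have F: "finite ?F" using c by (simp add: fin_supp_def)
  have out: "c (j + 1) = 0" "c (j - 1) = 0" if "j \<notin> ?H" for j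
  proof -
    show "c (j + 1) = 0"
    proof (rule ccontr)
      assume "c (j + 1) \<noteq> 0"
      then have "(j + 1) - 1 \<in> (\<lambda>j. j - 1) ` ?F" by (intro imageI) simp
      with that show False by simp
    qed
    show "c (j - 1) = 0"
    proof (rule ccontr)
      assume "c (j - 1) \<noteq> 0"
      then have "(j - 1) + 1 \<in> (\<lambda>j. j + 1) ` ?F" by (intro imageI) simp
      with that show False by simp
    qed
  qed
  have 1: "(\<Sum>j\<in>?H. of_real (c (j + 1)) * psi (n + j) t) = (\<Sum>j\<in>?F. of_real (c j) * psi (n + j - 1) t)"
    using sum_shift[of ?F "\<lambda>j. of_real (c j) * psi (n + j - 1) t" ?H 1] F
    by (simp add: algebra_simps)
  have 2: "(\<Sum>j\<in>?H. (of_int n + of_int j) / 2 * of_real (c (j - 1)) * psi (n + j) t)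
      = (\<Sum>j\<in>?F. of_real (c j) * ((of_int (n + j) + 1) / 2 * psi (n + j + 1) t))"
    using sum_shift[of ?F "\<lambda>j. of_real (c j) * ((of_int (n + j) + 1) / 2 * psi (n + j + 1) t)" ?H "- 1"] F
    by (simp add: algebra_simps)
  have "Psi n z (\<lambda>j. c (j + 1) + s * ((of_int n + of_int j) / 2 * c (j - 1))) t
      = z * (\<Sum>j\<in>?H. of_real (c (j + 1) + s * ((of_int n + of_int j) / 2 * c (j - 1))) * psi (n + j) t)"
    using F out by (intro Psi_superset) auto
  also have "(\<Sum>j\<in>?H. of_real (c (j + 1) + s * ((of_int n + of_int j) / 2 * c (j - 1))) * psi (n + j) t)
     = (\<Sum>j\<in>?H. of_real (c (j + 1)) * psi (n + j) t)
      + of_real s * (\<Sum>j\<in>?H. (of_int n + of_int j) / 2 * of_real (c (j - 1)) * psi (n + j) t)"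
    by (simp add: sum_distrib_left sum.distrib[symmetric] algebra_simps)
  also have "\<dots> = (\<Sum>j\<in>?F. of_real (c j) * (psi (n + j - 1) t + of_real s * ((of_int (n + j) + 1) / 2 * psi (n + j + 1) t)))"
    unfolding 1 2 by (simp add: sum_distrib_left sum.distrib[symmetric] algebra_simps)
  finally show ?thesis .
qed

lemma Psi_seqX:
  assumes "fin_supp c"
  shows "Psi n z (seqX n c) t = of_real t * Psi n z c t"
proof -
  have "Psi n z (seqX n c) t = z * (\<Sum>j | c j \<noteq> 0. of_real (c j) * (of_real t * psi (n + j) t))"
    using Psi_neighbours[OF assms, of n z 1 t] unfolding psi_mult_ident seqX_def[abs_def] by simp
  then show ?thesis by (simp add: Psi_def sum_distrib_left mult_ac)
qed

lemma Psi_deriv: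
  assumes "fin_supp c"
  shows "(Psi n z c has_vector_derivative Psi n z (seqD n c) t) (at t)"
proof -
  have "((\<lambda>t. z * (\<Sum>j | c j \<noteq> 0. of_real (c j) * psi (n + j) t)) has_vector_derivative
     z * (\<Sum>j | c j \<noteq> 0. of_real (c j) * (psi (n + j - 1) t - (of_int (n + j) + 1) / 2 * psi (n + j + 1) t))) (at t)"
    by (intro has_vector_derivative_mult_right has_vector_derivative_sum psi_deriv)
  also have "z * (\<Sum>j | c j \<noteq> 0. of_real (c j) * (psi (n + j - 1) t - (of_int (n + j) + 1) / 2 * psi (n + j + 1) t))
      = Psi n z (seqD n c) t"
    using Psi_neighbours[OF assms, of n z "- 1" t] unfolding seqD_def[abs_def] by simp
  finally show ?thesis unfolding Psi_def[abs_def] .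
qed

lemma vderiv_Psi: "fin_supp c \<Longrightarrow> vderiv (Psi n z c) = Psi n z (seqD n c)"
  by (intro vderivI Psi_deriv)

lemma Psi_schwartz: "Psi n z c \<in> schwartz"
  unfolding Psi_def[abs_def] by (intro schwartz_scale schwartz_sum psi_schwartz)

lemma X1_Psi [simp]: "fin_supp c \<Longrightarrow> X1 h (Psi n z c) = Psi n (z * of_real (sqrt \<bar>h\<bar>)) (seqD n c)"
  by (simp add: X1_def vderiv_Psi fun_eq_iff Psi_def)

lemma X2_Psi [simp]:
  assumes "fin_supp c"
  shows "X2 h (Psi n z c) = Psi n (z * (\<i> * of_real (sgn h) * of_real (sqrt \<bar>h\<bar>))) (seqX n c)"
proof
  fix t
  have "Psi n (z * (\<i> * of_real (sgn h) * of_real (sqrt \<bar>h\<bar>))) (seqX n c) t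
      = (\<i> * of_real (sgn h) * of_real (sqrt \<bar>h\<bar>)) * Psi n z (seqX n c) t"
    by (simp add: Psi_def mult_ac)
  then show "X2 h (Psi n z c) t = Psi n (z * (\<i> * of_real (sgn h) * of_real (sqrt \<bar>h\<bar>))) (seqX n c) t"
    by (simp only: X2_def Psi_seqX[OF assms] of_real_mult mult_ac)
qed

lemma X3_Psi [simp]: "X3 h (Psi n z c) = Psi n (z * (\<i> * of_real h)) c"
  by (simp add: X3_def fun_eq_iff Psi_def mult_ac)

definition delta :: "int \<Rightarrow> real \<Rightarrow> int \<Rightarrow> real" where
  "delta i x j = (if j = i then x else 0)"

lemma fin_supp_delta [simp]: "fin_supp (delta i x)"
  unfolding fin_supp_def by (rule finite_subset[of _ "{i}"]) (auto simp: delta_def)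

lemma Psi_delta: "Psi n z (delta i x) t = z * (of_real x * psi (n + i) t)"
  by (subst Psi_superset[of "{i}"]) (auto simp: delta_def)

text \<open>At most three applications of \<open>seqD\<close> and \<open>seqX\<close> to sequences
  supported in [-2, 2] stay within [-5, 5]. An identity between such sequences is therefore checked
  at eleven positions, with zeros outside.\<close>

lemma int_window_cases:
  fixes j :: int
  assumes "P (- 5)" "P (- 4)" "P (- 3)" "P (- 2)" "P (- 1)" "P 0" "P 1" "P 2" "P 3" "P 4" "P 5"
    and "\<And>j. j < - 5 \<Longrightarrow> P j" "\<And>j. 5 < j \<Longrightarrow> P j"
  shows "P j"
proof -
  have "j < - 5 \<or> 5 < j \<or> j = - 5 \<or> j = - 4 \<or> j = - 3 \<or> j = - 2 \<or> j = - 1 \<or> j = 0 \<or> j = 1 \<or> j = 2 \<or> j = 3 \<or> j = 4 \<or> j = 5"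
    by arith
  with assms show ?thesis by blast
qed

lemma sgn_sqrt_facts:
  assumes "h \<noteq> (0::real)"
  shows "complex_of_real (sgn h) * of_real (sgn h) = 1"
    and "complex_of_real h = of_real (sgn h) * (of_real (sqrt \<bar>h\<bar>) * of_real (sqrt \<bar>h\<bar>))"
    and "complex_of_real \<bar>h\<bar> = of_real (sqrt \<bar>h\<bar>) * of_real (sqrt \<bar>h\<bar>)"
proof -
  show "complex_of_real (sgn h) * of_real (sgn h) = 1"
    using assms unfolding of_real_mult[symmetric] by (cases "0 < h") auto
  show r: "complex_of_real \<bar>h\<bar> = of_real (sqrt \<bar>h\<bar>) * of_real (sqrt \<bar>h\<bar>)"
    unfolding of_real_mult[symmetric] by simp
  show "complex_of_real h = of_real (sgn h) * (of_real (sqrt \<bar>h\<bar>) * of_real (sqrt \<bar>h\<bar>))"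
    unfolding r[symmetric] of_real_mult[symmetric] by (simp add: sgn_mult_abs)
qed

section \<open>The Rumin differentials on Hermite expansions\<close>

definition Xw_adj :: "real \<Rightarrow> nat list \<Rightarrow> sop" where
  "Xw_adj h js = sop_scale ((- 1) ^ length js) (Xw h (rev js))"

lemma adj_pair_Xw_adj: "adj_pair (Xw h js) (Xw_adj h js)"
  unfolding Xw_adj_def by (rule adj_pair_Xw)

lemmas adj_pair_intros =
  adj_pair_Xw_adj adj_pair_add adj_pair_diff adj_pair_uminus adj_pair_scale adj_pair_0

definition D1_adj :: "real \<Rightarrow> sop ^ 3 ^ 2" where
  "D1_adj h = vector
     [vector [- Xw_adj h [1,1,2] - Xw_adj h [1,3], sop_scale (- sqrt 2) (Xw_adj h [1,2,2]), - Xw_adj h [2,2,2]],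
      vector [Xw_adj h [1,1,1], sop_scale (sqrt 2) (Xw_adj h [2,1,1]), Xw_adj h [2,2,1] - Xw_adj h [2,3]]]"

definition D2_adj :: "real \<Rightarrow> sop ^ 3 ^ 3" where
  "D2_adj h = vector
     [vector [- Xw_adj h [1,2] - Xw_adj h [3], sop_scale (- 1 / sqrt 2) (Xw_adj h [2,2]), 0],
      vector [sop_scale (1 / sqrt 2) (Xw_adj h [1,1]), sop_scale (- 3 / 2) (Xw_adj h [3]), sop_scale (- 1 / sqrt 2) (Xw_adj h [2,2])],
      vector [0, sop_scale (1 / sqrt 2) (Xw_adj h [1,1]), Xw_adj h [2,1] - Xw_adj h [3]]]"

lemma adj_mats_D1: "adj_mats (D1 h) (D1_adj h)"
  unfolding adj_mats_def forall_2 forall_3 D1_def D1_adj_def vector_2 vector_3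
  by (intro conjI adj_pair_intros)

lemma adj_mats_D2: "adj_mats (D2 h) (D2_adj h)"
  unfolding adj_mats_def forall_2 forall_3 D2_def D2_adj_def vector_2 vector_3
  by (intro conjI adj_pair_intros)

lemmas sop_simps = sop_scale_def fun_diff_def fun_Compl_def zero_fun_def Xw_adj_def Xw_Cons Xw_Nil Xgen_def

context
  fixes h :: real and r s :: complex
  assumes h: "h \<noteq> 0"
  defines "r \<equiv> of_real (sqrt \<bar>h\<bar>)" and "s \<equiv> of_real (sgn h)"
begin

text \<open>Rewriting \<open>h\<close> as \<open>s * r * r\<close> with \<open>s * s = 1\<close>
  turns all scalars into monomials in the imaginary unit, \<open>s\<close>, \<open>r\<close> and the
  square root of 2, which can then be compared.\<close>

lemma rs_simps:
  "s * s = 1" "s * (s * x) = x" "of_real h = s * (r * r)" "\<i> * (\<i> * x) = - x"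
  "of_real (sqrt 2) * (of_real (sqrt 2) * x) = 2 * x"
  "of_real (sqrt 2) * of_real (sqrt 2) = (2 :: complex)"
  "x / of_real (sqrt 2) = of_real (sqrt 2) * x / 2"
proof -
  show s: "s * s = 1" and "of_real h = s * (r * r)"
    using sgn_sqrt_facts[OF h] by (simp_all add: r_def s_def)
  show "s * (s * x) = x" using s by (simp add: mult.assoc[symmetric])
  show "\<i> * (\<i> * x) = - x" by (simp add: mult.assoc[symmetric])
  show q: "of_real (sqrt 2) * of_real (sqrt 2) = (2 :: complex)"
    unfolding of_real_mult[symmetric] by simp
  then show "x / of_real (sqrt 2) = of_real (sqrt 2) * x / 2"
    by (simp add: field_simps)
  from q show "of_real (sqrt 2) * (of_real (sqrt 2) * x) = 2 * x"
    by (simp only: mult.assoc[symmetric])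
qed

text \<open>Each X_2 contributes a factor \<open>\<i> * s\<close>. Putting the same factor on the
  second component pulls all non-real scalars out of the sums, so the remaining coefficients are
  real.\<close>

lemma D1_Psi:
  assumes "fin_supp c1" "fin_supp c2"
  shows "opmat_apply (D1 h) (\<lambda>t. vector [Psi n Z c1 t, Psi n (Z * (\<i> * s)) c2 t]) =
    (\<lambda>t. vector
      [Psi n (Z * (\<i> * s * (r * r * r))) (\<lambda>j. - seqD n (seqD n (seqX n c1)) j - seqD n c1 j + seqD n (seqD n (seqD n c2)) j) t,
       Psi n (Z * (of_real (sqrt 2) * (r * r * r))) (\<lambda>j. seqD n (seqX n (seqX n c1)) j - seqX n (seqD n (seqD n c2)) j) t,
       Psi n (Z * (\<i> * s * (r * r * r))) (\<lambda>j. seqX n (seqX n (seqX n c1)) j - seqX n (seqX n (seqD n c2)) j + seqX n c2 j) t])"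
proof
  fix t
  show "opmat_apply (D1 h) (\<lambda>t. vector [Psi n Z c1 t, Psi n (Z * (\<i> * s)) c2 t]) t = vector
      [Psi n (Z * (\<i> * s * (r * r * r))) (\<lambda>j. - seqD n (seqD n (seqX n c1)) j - seqD n c1 j + seqD n (seqD n (seqD n c2)) j) t,
       Psi n (Z * (of_real (sqrt 2) * (r * r * r))) (\<lambda>j. seqD n (seqX n (seqX n c1)) j - seqX n (seqD n (seqD n c2)) j) t,
       Psi n (Z * (\<i> * s * (r * r * r))) (\<lambda>j. seqX n (seqX n (seqX n c1)) j - seqX n (seqX n (seqD n c2)) j + seqX n c2 j) t]"
    using assms
    by (simp add: vec_eq_iff forall_3 opmat_apply_def sum_2 D1_def sop_simps r_def[symmetric] s_def[symmetric]
        Psi_add Psi_diff Psi_uminus)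
       (simp add: Psi_def rs_simps algebra_simps)
qed

lemma D1_adj_Psi:
  assumes "fin_supp g1" "fin_supp g2" "fin_supp g3"
  shows "opmat_apply (D1_adj h) (\<lambda>t. vector [Psi n (Z * (\<i> * s)) g1 t, Psi n (Z * of_real (sqrt 2)) g2 t, Psi n (Z * (\<i> * s)) g3 t]) =
    (\<lambda>t. vector
      [Psi n (Z * (r * r * r)) (\<lambda>j. seqD n g1 j - seqX n (seqD n (seqD n g1)) j - 2 * seqX n (seqX n (seqD n g2)) j + seqX n (seqX n (seqX n g3)) j) t,
       Psi n (Z * (\<i> * s * (r * r * r))) (\<lambda>j. seqD n (seqX n (seqX n g3)) j - seqD n (seqD n (seqD n g1)) j - 2 * seqD n (seqD n (seqX n g2)) j + seqX n g3 j) t])"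
proof
  fix t
  show "opmat_apply (D1_adj h) (\<lambda>t. vector [Psi n (Z * (\<i> * s)) g1 t, Psi n (Z * of_real (sqrt 2)) g2 t, Psi n (Z * (\<i> * s)) g3 t]) t = vector
      [Psi n (Z * (r * r * r)) (\<lambda>j. seqD n g1 j - seqX n (seqD n (seqD n g1)) j - 2 * seqX n (seqX n (seqD n g2)) j + seqX n (seqX n (seqX n g3)) j) t,
       Psi n (Z * (\<i> * s * (r * r * r))) (\<lambda>j. seqD n (seqX n (seqX n g3)) j - seqD n (seqD n (seqD n g1)) j - 2 * seqD n (seqD n (seqX n g2)) j + seqX n g3 j) t]"
    using assms
    by (simp add: vec_eq_iff forall_2 forall_3 opmat_apply_def sum_2 sum_3 D1_adj_def sop_simps r_def[symmetric] s_def[symmetric]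
        Psi_add Psi_diff Psi_uminus Psi_mult)
       (simp add: Psi_def rs_simps algebra_simps)
qed

text \<open>The factor on the second component now includes the square root of 2, which also clears
  the irrational entries of the matrix.\<close>

lemma D2_Psi:
  assumes "fin_supp c1" "fin_supp c2" "fin_supp c3"
  shows "opmat_apply (D2 h) (\<lambda>t. vector [Psi n Z c1 t, Psi n (Z * (\<i> * s * of_real (sqrt 2))) c2 t, Psi n Z c3 t]) =
    (\<lambda>t. vector
      [Psi n (Z * (\<i> * s * (r * r))) (\<lambda>j. seqD n (seqD n c2) j - seqD n (seqX n c1) j - c1 j) t,
       Psi n (Z * (of_real (sqrt 2) / 2 * (r * r))) (\<lambda>j. seqX n (seqX n c1) j + 3 * c2 j + seqD n (seqD n c3) j) t,
       Psi n (Z * (\<i> * s * (r * r))) (\<lambda>j. seqX n (seqX n c2) j + seqX n (seqD n c3) j - c3 j) t])"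
proof
  fix t
  show "opmat_apply (D2 h) (\<lambda>t. vector [Psi n Z c1 t, Psi n (Z * (\<i> * s * of_real (sqrt 2))) c2 t, Psi n Z c3 t]) t = vector
      [Psi n (Z * (\<i> * s * (r * r))) (\<lambda>j. seqD n (seqD n c2) j - seqD n (seqX n c1) j - c1 j) t,
       Psi n (Z * (of_real (sqrt 2) / 2 * (r * r))) (\<lambda>j. seqX n (seqX n c1) j + 3 * c2 j + seqD n (seqD n c3) j) t,
       Psi n (Z * (\<i> * s * (r * r))) (\<lambda>j. seqX n (seqX n c2) j + seqX n (seqD n c3) j - c3 j) t]"
    using assms
    by (simp add: vec_eq_iff forall_2 forall_3 opmat_apply_def sum_2 sum_3 D2_def sop_simps r_def[symmetric] s_def[symmetric]
        Psi_add Psi_diff Psi_uminus Psi_mult)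
       (simp add: Psi_def rs_simps algebra_simps)
qed

lemma D2_adj_Psi:
  assumes "fin_supp c1" "fin_supp c2" "fin_supp c3"
  shows "opmat_apply (D2_adj h) (\<lambda>t. vector [Psi n Z c1 t, Psi n (Z * (\<i> * s * of_real (sqrt 2))) c2 t, Psi n Z c3 t]) =
    (\<lambda>t. vector
      [Psi n (Z * (\<i> * s * (r * r))) (\<lambda>j. seqX n (seqX n c2) j - seqX n (seqD n c1) j + c1 j) t,
       Psi n (Z * (of_real (sqrt 2) / 2 * (r * r))) (\<lambda>j. seqD n (seqD n c1) j - 3 * c2 j + seqX n (seqX n c3) j) t,
       Psi n (Z * (\<i> * s * (r * r))) (\<lambda>j. seqD n (seqD n c2) j + seqD n (seqX n c3) j + c3 j) t])"
proof
  fix t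
  show "opmat_apply (D2_adj h) (\<lambda>t. vector [Psi n Z c1 t, Psi n (Z * (\<i> * s * of_real (sqrt 2))) c2 t, Psi n Z c3 t]) t = vector
      [Psi n (Z * (\<i> * s * (r * r))) (\<lambda>j. seqX n (seqX n c2) j - seqX n (seqD n c1) j + c1 j) t,
       Psi n (Z * (of_real (sqrt 2) / 2 * (r * r))) (\<lambda>j. seqD n (seqD n c1) j - 3 * c2 j + seqX n (seqX n c3) j) t,
       Psi n (Z * (\<i> * s * (r * r))) (\<lambda>j. seqD n (seqD n c2) j + seqD n (seqX n c3) j + c3 j) t]"
    using assms
    by (simp add: vec_eq_iff forall_2 forall_3 opmat_apply_def sum_2 sum_3 D2_adj_def sop_simps r_def[symmetric] s_def[symmetric]
        Psi_add Psi_diff Psi_uminus Psi_mult)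
       (simp add: Psi_def rs_simps algebra_simps)
qed

end

text \<open>One half of the eigenvalue m (m^2 - 2): the differential contributes the factor m, and
  its adjoint, applied to the remaining vector in \<open>D1_adj_eigen_seq\<close>, contributes m^2 -
  2.\<close>

lemma D1_eigen_seq:
  fixes n :: int
  defines "m \<equiv> 2 * real_of_int n + 1"
  defines "c1 \<equiv> \<lambda>j. delta (- 1) 2 j + delta 1 (of_int n) j"
    and "c2 \<equiv> \<lambda>j. delta (- 1) 2 j - delta 1 (of_int n) j"
  shows "- seqD n (seqD n (seqX n c1)) j - seqD n c1 j + seqD n (seqD n (seqD n c2)) j
      = m * (delta 0 (2 * of_int n) j - delta (- 2) 2 j - delta 2 (of_int n * (of_int n + 2) / 2) j)"
    and "seqD n (seqX n (seqX n c1)) j - seqX n (seqD n (seqD n c2)) j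
      = m * (delta (- 2) 2 j - delta 2 (of_int n * (of_int n + 2) / 2) j)"
    and "seqX n (seqX n (seqX n c1)) j - seqX n (seqX n (seqD n c2)) j + seqX n c2 j
      = m * (delta (- 2) 2 j + delta 0 (2 * of_int n) j + delta 2 (of_int n * (of_int n + 2) / 2) j)"
  by (rule int_window_cases[of _ j];
      simp add: seqD_def seqX_def c1_def c2_def m_def delta_def; simp add: field_simps)+

text \<open>Up to a scalar these coefficients describe (X_1 psi_n, X_2 psi_n), a gradient, and the
  differentials form a complex.\<close>

lemma D1_kernel_seq:
  fixes n :: int
  defines "c1 \<equiv> \<lambda>j. delta (- 1) 2 j + delta 1 (- (of_int n + 1)) j"
    and "c2 \<equiv> \<lambda>j. delta (- 1) 2 j - delta 1 (- (of_int n + 1)) j"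
  shows "- seqD n (seqD n (seqX n c1)) j - seqD n c1 j + seqD n (seqD n (seqD n c2)) j = 0"
    and "seqD n (seqX n (seqX n c1)) j - seqX n (seqD n (seqD n c2)) j = 0"
    and "seqX n (seqX n (seqX n c1)) j - seqX n (seqX n (seqD n c2)) j + seqX n c2 j = 0"
  by (rule int_window_cases[of _ j];
      simp add: seqD_def seqX_def c1_def c2_def delta_def; simp add: field_simps)+

lemma D1_adj_eigen_seq:
  fixes n :: int
  defines "c1 \<equiv> \<lambda>j. delta (- 1) 2 j + delta 1 (of_int n) j"
    and "c2 \<equiv> \<lambda>j. delta (- 1) 2 j - delta 1 (of_int n) j"
    and "g1 \<equiv> \<lambda>j. delta 0 (2 * of_int n) j - delta (- 2) 2 j - delta 2 (of_int n * (of_int n + 2) / 2) j"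
    and "g2 \<equiv> \<lambda>j. delta (- 2) 2 j - delta 2 (of_int n * (of_int n + 2) / 2) j"
    and "g3 \<equiv> \<lambda>j. delta (- 2) 2 j + delta 0 (2 * of_int n) j + delta 2 (of_int n * (of_int n + 2) / 2) j"
  shows "seqD n g1 j - seqX n (seqD n (seqD n g1)) j - 2 * seqX n (seqX n (seqD n g2)) j + seqX n (seqX n (seqX n g3)) j
      = (4 * of_int n * of_int n + 4 * of_int n - 1) * c1 j"
    and "seqD n (seqX n (seqX n g3)) j - seqD n (seqD n (seqD n g1)) j - 2 * seqD n (seqD n (seqX n g2)) j + seqX n g3 j
      = (4 * of_int n * of_int n + 4 * of_int n - 1) * c2 j"
  by (rule int_window_cases[of _ j];
      simp add: seqD_def seqX_def c1_def c2_def g1_def g2_def g3_def delta_def;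
      simp add: algebra_simps add_divide_distrib diff_divide_distrib)+

text \<open>The hypotheses say that (R, W, T) is an eigenvector of a tridiagonal 3 by 3 matrix with
  characteristic polynomial \<nu> (\<nu>^2 + 10 \<nu> + 16 - 8 (2 n + 1)^2). The root 0 gives the
  kernel, the other two the nonzero spectrum.\<close>

lemma D2_eigen_seq:
  fixes n :: int and R W T \<nu> :: real
  assumes eq: "4 * n * R + 4 * W = \<nu> * R" "2 * n * (n - 1) * R - 6 * W - 8 * T = \<nu> * W"
    "- 4 * (n + 1) * T - (n + 1) * (n + 2) * W = \<nu> * T"
  defines "c1 \<equiv> \<lambda>j. delta (- 2) R j + delta 0 W j + delta 2 T j"
    and "c2 \<equiv> \<lambda>j. delta (- 2) R j - delta 2 T j"
    and "c3 \<equiv> \<lambda>j. delta 0 W j - delta (- 2) R j - delta 2 T j"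
  shows "seqD n (seqD n c2) j - seqD n (seqX n c1) j - c1 j = \<nu> / 4 * c3 j"
    and "seqX n (seqX n c1) j + 3 * c2 j + seqD n (seqD n c3) j = \<nu> / 2 * c2 j"
    and "seqX n (seqX n c2) j + seqX n (seqD n c3) j - c3 j = \<nu> / 4 * c1 j"
proof -
  show "seqD n (seqD n c2) j - seqD n (seqX n c1) j - c1 j = \<nu> / 4 * c3 j"
    using eq
    by - (rule int_window_cases[of _ j];
      simp add: seqD_def seqX_def c1_def c2_def c3_def delta_def; simp add: algebra_simps add_divide_distrib diff_divide_distrib)
  show "seqX n (seqX n c1) j + 3 * c2 j + seqD n (seqD n c3) j = \<nu> / 2 * c2 j"
    using eq
    by - (rule int_window_cases[of _ j];
      simp add: seqD_def seqX_def c1_def c2_def c3_def delta_def; simp add: algebra_simps add_divide_distrib diff_divide_distrib)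
  show "seqX n (seqX n c2) j + seqX n (seqD n c3) j - c3 j = \<nu> / 4 * c1 j"
    using eq
    by - (rule int_window_cases[of _ j];
      simp add: seqD_def seqX_def c1_def c2_def c3_def delta_def; simp add: algebra_simps add_divide_distrib diff_divide_distrib)
qed

section \<open>Block vectors as eigenvectors\<close>

definition D1_vec :: "real \<Rightarrow> int \<Rightarrow> real \<Rightarrow> real \<Rightarrow> real \<Rightarrow> complex ^ 2" where
  "D1_vec h n a b t = vector
     [of_real a * psi (n - 1) t + of_real b * psi (n + 1) t,
      (\<i> * of_real (sgn h)) * (of_real a * psi (n - 1) t - of_real b * psi (n + 1) t)]"

text \<open>The coefficients belong to the directions (1, i s q, -1), (1, 0, 1) and (1, -i s q, -1),
  where s is the sign of \<open>h\<close> and q the square root of 2. They are orthogonal and carry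
  the weights that compensate the index shifts -2, 0, 2. In \<open>D1_vec\<close> the directions are
  (1, i s) and (1, -i s).\<close>

definition D2_vec :: "real \<Rightarrow> int \<Rightarrow> real \<Rightarrow> real \<Rightarrow> real \<Rightarrow> real \<Rightarrow> complex ^ 3" where
  "D2_vec h n R W T t = vector
     [of_real R * psi (n - 2) t + of_real W * psi n t + of_real T * psi (n + 2) t,
      (\<i> * of_real (sgn h) * of_real (sqrt 2)) * (of_real R * psi (n - 2) t - of_real T * psi (n + 2) t),
      of_real W * psi n t - of_real R * psi (n - 2) t - of_real T * psi (n + 2) t]"

lemma D1_vec_Psi:
  "D1_vec h n a b = (\<lambda>t. vector
     [Psi n 1 (\<lambda>j. delta (- 1) a j + delta 1 b j) t,
      Psi n (1 * (\<i> * of_real (sgn h))) (\<lambda>j. delta (- 1) a j - delta 1 b j) t])"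
  by (simp add: fun_eq_iff D1_vec_def Psi_add Psi_diff Psi_delta algebra_simps)

lemma D2_vec_Psi:
  "D2_vec h n R W T = (\<lambda>t. vector
     [Psi n 1 (\<lambda>j. delta (- 2) R j + delta 0 W j + delta 2 T j) t,
      Psi n (1 * (\<i> * of_real (sgn h) * of_real (sqrt 2))) (\<lambda>j. delta (- 2) R j - delta 2 T j) t,
      Psi n 1 (\<lambda>j. delta 0 W j - delta (- 2) R j - delta 2 T j) t])"
  by (simp add: fun_eq_iff D2_vec_def Psi_add Psi_diff Psi_delta algebra_simps)

lemma D1_vec_schwartz: "D1_vec h n a b \<in> schwartz_vec"
  unfolding D1_vec_Psi schwartz_vec_def by (simp add: forall_2 Psi_schwartz)

lemma D2_vec_schwartz: "D2_vec h n R W T \<in> schwartz_vec"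
  unfolding D2_vec_Psi schwartz_vec_def by (simp add: forall_3 Psi_schwartz)

lemma Psi_zero: "Psi n z (\<lambda>j. 0) t = 0"
  by (simp add: Psi_def)

lemma opmat_apply_zero:
  assumes "adj_mats M N"
  shows "opmat_apply N (\<lambda>t. 0) = (\<lambda>t. 0)"
proof -
  have z: "(\<lambda>t. 0 :: complex ^ 'b) \<in> schwartz_vec" by (simp add: schwartz_vec_def schwartz_zero)
  show ?thesis using opmat_apply_lin'[OF assms z z, of 0 0] by simp
qed

lemma gram_D1_eigen:
  fixes n :: int
  assumes h: "h \<noteq> 0"
  defines "m \<equiv> 2 * real_of_int n + 1"
  shows "gram (D1 h) (D1_vec h n 2 n) = (\<lambda>t. of_real (\<bar>h\<bar> ^ 3 * (m * (m\<^sup>2 - 2))) *s D1_vec h n 2 n t)"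
proof
  fix t
  let ?r = "complex_of_real (sqrt \<bar>h\<bar>)" and ?s = "complex_of_real (sgn h)"
  let ?g1 = "\<lambda>j. delta 0 (2 * of_int n) j - delta (- 2) 2 j - delta 2 (of_int n * (of_int n + 2) / 2) j"
    and ?g2 = "\<lambda>j. delta (- 2) 2 j - delta 2 (of_int n * (of_int n + 2) / 2) j"
    and ?g3 = "\<lambda>j. delta (- 2) 2 j + delta 0 (2 * of_int n) j + delta 2 (of_int n * (of_int n + 2) / 2) j"
  let ?Z = "?r * ?r * ?r * of_real m"
  have D: "opmat_apply (D1 h) (D1_vec h n 2 n) =
      (\<lambda>t. vector [Psi n (?Z * (\<i> * ?s)) ?g1 t, Psi n (?Z * of_real (sqrt 2)) ?g2 t, Psi n (?Z * (\<i> * ?s)) ?g3 t])"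
    unfolding D1_vec_Psi
    by (subst D1_Psi[OF h]; (simp only: D1_eigen_seq)?; simp add: m_def Psi_mult; simp add: Psi_def mult_ac)
  have L: "4 * real_of_int n * of_int n + 4 * of_int n - 1 = m\<^sup>2 - 2"
    by (simp add: m_def power2_eq_square algebra_simps)
  have "gram (D1 h) (D1_vec h n 2 n) t = vector
      [Psi n (?Z * (?r * ?r * ?r)) (\<lambda>j. (m\<^sup>2 - 2) * (delta (- 1) 2 j + delta 1 (of_int n) j)) t,
       Psi n (?Z * (\<i> * ?s * (?r * ?r * ?r))) (\<lambda>j. (m\<^sup>2 - 2) * (delta (- 1) 2 j - delta 1 (of_int n) j)) t]"
    unfolding gram_eq[OF adj_mats_D1 D1_vec_schwartz] D
    by (subst D1_adj_Psi[OF h]) (simp_all only: D1_adj_eigen_seq L fin_supp_add fin_supp_diff fin_supp_delta)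
  moreover have "complex_of_real (\<bar>h\<bar> ^ 3 * (m * (m\<^sup>2 - 2))) = ?Z * (?r * ?r * ?r) * of_real (m\<^sup>2 - 2)"
    unfolding of_real_mult of_real_power sgn_sqrt_facts(3)[OF h] by (simp add: power3_eq_cube mult_ac)
  ultimately show "gram (D1 h) (D1_vec h n 2 n) t = of_real (\<bar>h\<bar> ^ 3 * (m * (m\<^sup>2 - 2))) *s D1_vec h n 2 n t"
    unfolding D1_vec_Psi
    by (simp only:) (simp add: vec_eq_iff forall_2 Psi_mult; simp add: Psi_def mult_ac)
qed

lemma gram_D1_kernel:
  fixes n :: int
  assumes h: "h \<noteq> 0"
  shows "gram (D1 h) (D1_vec h n 2 (- (of_int n + 1))) = (\<lambda>t. 0)"
proof -
  have D: "opmat_apply (D1 h) (D1_vec h n 2 (- (of_int n + 1))) = (\<lambda>t. 0)"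
    unfolding D1_vec_Psi
    by (subst D1_Psi[OF h]; (simp only: D1_kernel_seq Psi_zero)?; simp add: fun_eq_iff vec_eq_iff forall_3)
  show ?thesis
    unfolding gram_eq[OF adj_mats_D1 D1_vec_schwartz] D by (rule opmat_apply_zero[OF adj_mats_D1])
qed

text \<open>With J (x, y, z) = (z, -y, x) and s the sign of \<open>h\<close>, the equations make D_2
  v equal to i s |h| (\<nu> / 4) J v. The adjoint sends J v to -i s |h| (\<nu> / 4) v, and the two
  factors multiply to the eigenvalue.\<close>

lemma gram_D2_eigen:
  fixes n :: int and R W T \<nu> :: real
  assumes h: "h \<noteq> 0"
    and eq: "4 * n * R + 4 * W = \<nu> * R" "2 * n * (n - 1) * R - 6 * W - 8 * T = \<nu> * W"
      "- 4 * (n + 1) * T - (n + 1) * (n + 2) * W = \<nu> * T"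
  shows "gram (D2 h) (D2_vec h n R W T) = (\<lambda>t. of_real (h\<^sup>2 * (\<nu> / 4)\<^sup>2) *s D2_vec h n R W T t)"
proof
  fix t
  let ?r = "complex_of_real (sqrt \<bar>h\<bar>)" and ?s = "complex_of_real (sgn h)" and ?q = "complex_of_real (sqrt 2)"
  let ?c1 = "\<lambda>j. delta (- 2) R j + delta 0 W j + delta 2 T j"
    and ?c2 = "\<lambda>j. delta (- 2) R j - delta 2 T j"
    and ?c3 = "\<lambda>j. delta 0 W j - delta (- 2) R j - delta 2 T j"
  note seq = D2_eigen_seq[OF eq]
  let ?Z = "\<i> * ?s * (?r * ?r) * of_real (\<nu> / 4)"
  note rs = rs_simps[OF h]
  have fin: "fin_supp ?c1" "fin_supp ?c2" "fin_supp ?c3" by simp_all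
  have D: "opmat_apply (D2 h) (D2_vec h n R W T) =
      (\<lambda>t. vector [Psi n ?Z ?c3 t, Psi n (?Z * (\<i> * ?s * ?q)) (\<lambda>j. - ?c2 j) t, Psi n ?Z ?c1 t])"
    unfolding D2_vec_Psi D2_Psi[OF h fin] seq Psi_mult[OF fin(1)] Psi_mult[OF fin(2)] Psi_mult[OF fin(3)]
      Psi_uminus[OF fin(2)]
    by (simp add: fun_eq_iff vec_eq_iff forall_3 Psi_def rs mult_ac)
  have seq': "seqX n (seqX n (\<lambda>j. - ?c2 j)) j - seqX n (seqD n ?c3) j + ?c3 j = - (\<nu> / 4) * ?c1 j"
    "seqD n (seqD n ?c3) j - 3 * - ?c2 j + seqX n (seqX n ?c1) j = \<nu> / 2 * ?c2 j"
    "seqD n (seqD n (\<lambda>j. - ?c2 j)) j + seqD n (seqX n ?c1) j + ?c1 j = - (\<nu> / 4) * ?c3 j" for j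
  proof -
    have "seqX n (seqX n (\<lambda>j. - ?c2 j)) j = - seqX n (seqX n ?c2) j"
      "seqD n (seqD n (\<lambda>j. - ?c2 j)) j = - seqD n (seqD n ?c2) j"
      by (simp_all add: seqX_def seqD_def algebra_simps)
    then show "seqX n (seqX n (\<lambda>j. - ?c2 j)) j - seqX n (seqD n ?c3) j + ?c3 j = - (\<nu> / 4) * ?c1 j"
      "seqD n (seqD n ?c3) j - 3 * - ?c2 j + seqX n (seqX n ?c1) j = \<nu> / 2 * ?c2 j"
      "seqD n (seqD n (\<lambda>j. - ?c2 j)) j + seqD n (seqX n ?c1) j + ?c1 j = - (\<nu> / 4) * ?c3 j"
      using seq[of j] by linarith+
  qed
  have "gram (D2 h) (D2_vec h n R W T) t = vector
      [Psi n (?Z * (\<i> * ?s * (?r * ?r))) (\<lambda>j. - (\<nu> / 4) * ?c1 j) t,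
       Psi n (?Z * (?q / 2 * (?r * ?r))) (\<lambda>j. \<nu> / 2 * ?c2 j) t,
       Psi n (?Z * (\<i> * ?s * (?r * ?r))) (\<lambda>j. - (\<nu> / 4) * ?c3 j) t]"
    unfolding gram_eq[OF adj_mats_D2 D2_vec_schwartz] D
      D2_adj_Psi[OF h fin(3) fin_supp_uminus[OF fin(2)] fin(1)] seq' ..
  moreover have "complex_of_real (h\<^sup>2 * (\<nu> / 4)\<^sup>2) = (?r * ?r) * (?r * ?r) * (of_real \<nu> * of_real \<nu> / 16)"
    unfolding of_real_mult of_real_power rs(3) by (simp add: power2_eq_square rs mult_ac)
  ultimately show "gram (D2 h) (D2_vec h n R W T) t = of_real (h\<^sup>2 * (\<nu> / 4)\<^sup>2) *s D2_vec h n R W T t"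
    unfolding D2_vec_Psi Psi_mult[OF fin(1)] Psi_mult[OF fin(2)] Psi_mult[OF fin(3)]
    by (simp only:) (simp add: vec_eq_iff forall_3 Psi_def rs mult_ac)
qed

section \<open>Eigenbases\<close>

lemma L2_inner_lin3:
  assumes u: "u \<in> borel_measurable lborel" "integrable lborel (\<lambda>t. (norm (u t :: complex))\<^sup>2)"
    and f: "f \<in> schwartz" "g \<in> schwartz" "k \<in> schwartz"
  shows "L2_inner u (\<lambda>t. a * f t + b * g t + c * k t) = cnj a * L2_inner u f + cnj b * L2_inner u g + cnj c * L2_inner u k"
  using L2_inner_lin_right'[OF u schwartz_lin[OF f(1,2)] f(3), of 1 a b c]
  by (simp add: L2_inner_lin_right'[OF u f(1,2)])

abbreviation coef :: "(real \<Rightarrow> complex ^ 'n) \<Rightarrow> 'n \<Rightarrow> int \<Rightarrow> complex" where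
  "coef u i k \<equiv> L2_inner (\<lambda>t. u t $ i) (psi k)"

lemma L2_ip_D1_vec:
  assumes u: "u \<in> L2_space"
  shows "L2_ip u (D1_vec h n a b)
    = of_real a * (coef u 1 (n - 1) - \<i> * of_real (sgn h) * coef u 2 (n - 1))
      + of_real b * (coef u 1 (n + 1) + \<i> * of_real (sgn h) * coef u 2 (n + 1))"
proof -
  have 1: "L2_inner (\<lambda>t. u t $ 1) (\<lambda>t. of_real a * psi (n - 1) t + of_real b * psi (n + 1) t)
      = of_real a * coef u 1 (n - 1) + of_real b * coef u 1 (n + 1)"
    by (subst L2_inner_lin_right'[OF L2_space_component[OF u]]) (simp_all add: psi_schwartz)
  have "(\<lambda>t. (\<i> * of_real (sgn h)) * (of_real a * psi (n - 1) t - of_real b * psi (n + 1) t))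
      = (\<lambda>t. (\<i> * of_real (sgn h) * of_real a) * psi (n - 1) t + (- \<i> * of_real (sgn h) * of_real b) * psi (n + 1) t)"
    by (simp add: fun_eq_iff algebra_simps)
  then have 2: "L2_inner (\<lambda>t. u t $ 2) (\<lambda>t. (\<i> * of_real (sgn h)) * (of_real a * psi (n - 1) t - of_real b * psi (n + 1) t))
      = - \<i> * of_real (sgn h) * of_real a * coef u 2 (n - 1) + \<i> * of_real (sgn h) * of_real b * coef u 2 (n + 1)"
    by (simp only: L2_inner_lin_right'[OF L2_space_component[OF u] psi_schwartz psi_schwartz]) simp
  show ?thesis
    using 1 2 by (simp add: L2_ip_L2_schwartz[OF u D1_vec_schwartz] sum_2 D1_vec_def algebra_simps)
qed

lemma L2_ip_D2_vec:
  assumes u: "u \<in> L2_space"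
  shows "L2_ip u (D2_vec h n R W T)
    = of_real R * (coef u 1 (n - 2) - \<i> * of_real (sgn h) * of_real (sqrt 2) * coef u 2 (n - 2) - coef u 3 (n - 2))
      + of_real W * (coef u 1 n + coef u 3 n)
      + of_real T * (coef u 1 (n + 2) + \<i> * of_real (sgn h) * of_real (sqrt 2) * coef u 2 (n + 2) - coef u 3 (n + 2))"
proof -
  let ?c = "\<i> * of_real (sgn h) * complex_of_real (sqrt 2)"
  have 1: "L2_inner (\<lambda>t. u t $ 1) (\<lambda>t. of_real R * psi (n - 2) t + of_real W * psi n t + of_real T * psi (n + 2) t)
      = of_real R * coef u 1 (n - 2) + of_real W * coef u 1 n + of_real T * coef u 1 (n + 2)"
    by (simp add: L2_inner_lin3[OF L2_space_component[OF u]] psi_schwartz)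
  have "(\<lambda>t. ?c * (of_real R * psi (n - 2) t - of_real T * psi (n + 2) t))
      = (\<lambda>t. (?c * of_real R) * psi (n - 2) t + (- ?c * of_real T) * psi (n + 2) t)"
    by (simp add: fun_eq_iff algebra_simps)
  then have 2: "L2_inner (\<lambda>t. u t $ 2) (\<lambda>t. ?c * (of_real R * psi (n - 2) t - of_real T * psi (n + 2) t))
      = - ?c * of_real R * coef u 2 (n - 2) + ?c * of_real T * coef u 2 (n + 2)"
    by (simp only: L2_inner_lin_right'[OF L2_space_component[OF u] psi_schwartz psi_schwartz]) simp
  have "(\<lambda>t. of_real W * psi n t - of_real R * psi (n - 2) t - of_real T * psi (n + 2) t)
      = (\<lambda>t. of_real W * psi n t + (- of_real R) * psi (n - 2) t + (- of_real T) * psi (n + 2) t)"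
    by (simp add: fun_eq_iff algebra_simps)
  then have 3: "L2_inner (\<lambda>t. u t $ 3) (\<lambda>t. of_real W * psi n t - of_real R * psi (n - 2) t - of_real T * psi (n + 2) t)
      = of_real W * coef u 3 n - of_real R * coef u 3 (n - 2) - of_real T * coef u 3 (n + 2)"
    by (simp only: L2_inner_lin3[OF L2_space_component[OF u] psi_schwartz psi_schwartz psi_schwartz]) simp
  show ?thesis
    using 1 2 3 by (simp add: L2_ip_L2_schwartz[OF u D2_vec_schwartz] sum_3 D2_vec_def algebra_simps)
qed

lemma coef_D1_vec:
  shows "coef (D1_vec h n a b) 1 k = of_real a * L2_inner (psi (n - 1)) (psi k) + of_real b * L2_inner (psi (n + 1)) (psi k)"
    and "coef (D1_vec h n a b) 2 k = \<i> * of_real (sgn h) * (of_real a * L2_inner (psi (n - 1)) (psi k) - of_real b * L2_inner (psi (n + 1)) (psi k))"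
proof -
  show "coef (D1_vec h n a b) 1 k = of_real a * L2_inner (psi (n - 1)) (psi k) + of_real b * L2_inner (psi (n + 1)) (psi k)"
    by (simp add: D1_vec_def L2_inner_lin_left psi_schwartz)
  have "(\<lambda>t. (\<i> * of_real (sgn h)) * (of_real a * psi (n - 1) t - of_real b * psi (n + 1) t))
      = (\<lambda>t. (\<i> * of_real (sgn h) * of_real a) * psi (n - 1) t + (- \<i> * of_real (sgn h) * of_real b) * psi (n + 1) t)"
    by (simp add: fun_eq_iff algebra_simps)
  then have "coef (D1_vec h n a b) 2 k = L2_inner
      (\<lambda>t. (\<i> * of_real (sgn h) * of_real a) * psi (n - 1) t + (- \<i> * of_real (sgn h) * of_real b) * psi (n + 1) t) (psi k)"
    by (simp add: D1_vec_def)
  then show "coef (D1_vec h n a b) 2 k = \<i> * of_real (sgn h) * (of_real a * L2_inner (psi (n - 1)) (psi k) - of_real b * L2_inner (psi (n + 1)) (psi k))"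
    by (simp only: L2_inner_lin_left[OF psi_schwartz psi_schwartz psi_schwartz]) (simp add: algebra_simps)
qed

text \<open>The two directions of a block are orthogonal with squared length 2, so no mixed terms
  appear.\<close>

lemma L2_ip_D1_vec_D1_vec:
  assumes h: "h \<noteq> 0"
  shows "L2_ip (D1_vec h n a b) (D1_vec h n' a' b')
    = 2 * of_real (a' * a) * L2_inner (psi (n - 1)) (psi (n' - 1)) + 2 * of_real (b' * b) * L2_inner (psi (n + 1)) (psi (n' + 1))"
  unfolding L2_ip_D1_vec[OF schwartz_vec_L2[OF D1_vec_schwartz]] coef_D1_vec
  by (simp add: rs_simps[OF h] algebra_simps)

lemma coef_D2_vec:
  shows "coef (D2_vec h n R W T) 1 k = of_real R * L2_inner (psi (n - 2)) (psi k) + of_real W * L2_inner (psi n) (psi k) + of_real T * L2_inner (psi (n + 2)) (psi k)"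
    and "coef (D2_vec h n R W T) 2 k = \<i> * of_real (sgn h) * of_real (sqrt 2) * (of_real R * L2_inner (psi (n - 2)) (psi k) - of_real T * L2_inner (psi (n + 2)) (psi k))"
    and "coef (D2_vec h n R W T) 3 k = of_real W * L2_inner (psi n) (psi k) - of_real R * L2_inner (psi (n - 2)) (psi k) - of_real T * L2_inner (psi (n + 2)) (psi k)"
proof -
  let ?c = "\<i> * of_real (sgn h) * complex_of_real (sqrt 2)"
  note lin = L2_inner_lin_left[OF psi_schwartz psi_schwartz psi_schwartz]
    L2_inner_lin_left[OF schwartz_lin[OF psi_schwartz psi_schwartz] psi_schwartz psi_schwartz]
  have "(\<lambda>t. D2_vec h n R W T t $ 1) = (\<lambda>t. 1 * (of_real R * psi (n - 2) t + of_real W * psi n t) + of_real T * psi (n + 2) t)"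
    by (simp add: D2_vec_def)
  then show "coef (D2_vec h n R W T) 1 k = of_real R * L2_inner (psi (n - 2)) (psi k) + of_real W * L2_inner (psi n) (psi k) + of_real T * L2_inner (psi (n + 2)) (psi k)"
    by (simp only: lin) simp
  have "(\<lambda>t. D2_vec h n R W T t $ 2) = (\<lambda>t. (?c * of_real R) * psi (n - 2) t + (- ?c * of_real T) * psi (n + 2) t)"
    by (simp add: D2_vec_def fun_eq_iff algebra_simps)
  then show "coef (D2_vec h n R W T) 2 k = ?c * (of_real R * L2_inner (psi (n - 2)) (psi k) - of_real T * L2_inner (psi (n + 2)) (psi k))"
    by (simp only: lin) (simp add: algebra_simps)
  have "(\<lambda>t. D2_vec h n R W T t $ 3) = (\<lambda>t. 1 * (of_real W * psi n t + (- of_real R) * psi (n - 2) t) + (- of_real T) * psi (n + 2) t)"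
    by (simp add: D2_vec_def)
  then show "coef (D2_vec h n R W T) 3 k = of_real W * L2_inner (psi n) (psi k) - of_real R * L2_inner (psi (n - 2)) (psi k) - of_real T * L2_inner (psi (n + 2)) (psi k)"
    by (simp only: lin) simp
qed

text \<open>The weights 4, 2, 4 are the squared lengths of the three orthogonal directions.\<close>

lemma L2_ip_D2_vec_D2_vec:
  assumes h: "h \<noteq> 0"
  shows "L2_ip (D2_vec h n R W T) (D2_vec h n' R' W' T')
    = 4 * of_real (R' * R) * L2_inner (psi (n - 2)) (psi (n' - 2)) + 2 * of_real (W' * W) * L2_inner (psi n) (psi n')
      + 4 * of_real (T' * T) * L2_inner (psi (n + 2)) (psi (n' + 2))"
  unfolding L2_ip_D2_vec[OF schwartz_vec_L2[OF D2_vec_schwartz]] coef_D2_vec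
  by (simp add: rs_simps[OF h] algebra_simps)

text \<open>The change to components along the block directions is invertible, so their vanishing
  reaches both components of \<open>u\<close>.\<close>

lemma D1_coef_complete:
  fixes u :: "real \<Rightarrow> complex ^ 2"
  assumes h: "h \<noteq> 0" and u: "u \<in> L2_space"
    and p: "\<And>k. 0 \<le> k \<Longrightarrow> coef u 1 k - \<i> * of_real (sgn h) * coef u 2 k = 0"
    and q: "\<And>k. 0 \<le> k \<Longrightarrow> coef u 1 k + \<i> * of_real (sgn h) * coef u 2 k = 0"
  shows "L2_eq u (\<lambda>_. 0)"
proof (rule psi_complete_vec[OF u])
  fix i :: 2 and k :: int assume k: "0 \<le> k"
  have "2 * coef u 1 k = 0" "2 * (\<i> * of_real (sgn h) * coef u 2 k) = 0"
    using p[OF k] q[OF k] by (simp_all add: algebra_simps add_eq_0_iff)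
  then show "coef u i k = 0"
    using h exhaust_2[of i] by (auto simp: sgn_eq_0_iff)
qed

lemma D2_coef_complete:
  fixes u :: "real \<Rightarrow> complex ^ 3"
  assumes h: "h \<noteq> 0" and u: "u \<in> L2_space"
    and x: "\<And>k. 0 \<le> k \<Longrightarrow> coef u 1 k - \<i> * of_real (sgn h) * of_real (sqrt 2) * coef u 2 k - coef u 3 k = 0"
    and y: "\<And>k. 0 \<le> k \<Longrightarrow> coef u 1 k + coef u 3 k = 0"
    and z: "\<And>k. 0 \<le> k \<Longrightarrow> coef u 1 k + \<i> * of_real (sgn h) * of_real (sqrt 2) * coef u 2 k - coef u 3 k = 0"
  shows "L2_eq u (\<lambda>_. 0)"
proof (rule psi_complete_vec[OF u])
  fix i :: 3 and k :: int assume k: "0 \<le> k"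
  let ?c = "\<i> * of_real (sgn h) * of_real (sqrt 2) * coef u 2 k"
  have "coef u 1 k - ?c - coef u 3 k = 0" "coef u 1 k + coef u 3 k = 0" "coef u 1 k + ?c - coef u 3 k = 0"
    using x[OF k] y[OF k] z[OF k] by auto
  then have "coef u 1 k = 0" "coef u 3 k = 0" "?c = 0"
    by algebra+
  then show "coef u i k = 0"
    using h exhaust_3[of i] by (auto simp: sgn_eq_0_iff)
qed

lemma coef_neg: "k < 0 \<Longrightarrow> coef u i k = 0"
  by (simp add: psi_neg L2_inner_def)

section \<open>From an eigenbasis to the spectrum\<close>

lemma eigenvectors_orthogonal:
  assumes M: "adj_mats M N" and f: "f \<in> schwartz_vec" and g: "g \<in> schwartz_vec"
    and eig: "gram M f = (\<lambda>t. of_real a *s f t)" "gram M g = (\<lambda>t. of_real b *s g t)"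
    and ab: "a \<noteq> b"
  shows "L2_ip f g = 0"
proof -
  have "of_real a * L2_ip f g = of_real b * L2_ip f g"
    using gram_symmetric[OF M f g] by (simp add: eig L2_ip_scale_left L2_ip_scale_right)
  then show ?thesis using ab by simp
qed

text \<open>The nonzero values cannot accumulate at a finite point, and 0, which may be repeated
  infinitely often, is a single point. Hence \<open>z\<close> has positive distance from all of
  them.\<close>

lemma spectral_gap:
  fixes lam :: "nat \<Rightarrow> real" and z :: complex
  assumes fin: "\<And>B. finite {i. lam i \<noteq> 0 \<and> lam i \<le> B}"
    and z: "z \<noteq> 0" "\<And>i. z \<noteq> of_real (lam i)"
  obtains \<delta> where "0 < \<delta>" "\<And>i. \<delta> \<le> norm (of_real (lam i) - z)"
proof -
  let ?A = "{i. lam i \<noteq> 0 \<and> lam i \<le> norm z + 1}"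
  \<comment> \<open>\<open>norm z\<close> is the distance to the value 0, and 1 serves all values
    beyond \<open>norm z + 1\<close>.\<close>
  let ?D = "insert 1 (insert (norm z) ((\<lambda>i. norm (of_real (lam i) - z)) ` ?A))"
  define \<delta> where "\<delta> = Min ?D"
  have D: "finite ?D" using fin by simp
  have pos: "0 < \<delta>"
    unfolding \<delta>_def using D z by (subst Min_gr_iff) auto
  have "\<delta> \<le> norm (of_real (lam i) - z)" for i
  proof (cases "i \<in> ?A")
    case True
    then show ?thesis unfolding \<delta>_def using D by (intro Min_le) auto
  next
    case False
    show ?thesis
    proof (cases "lam i = 0")
      case True
      have "\<delta> \<le> norm z" unfolding \<delta>_def using D by (intro Min_le) auto
      with True show ?thesis by simp
    next
      case nz: False
      have "\<delta> \<le> 1" unfolding \<delta>_def using D by (intro Min_le) auto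
      also have "1 \<le> norm (complex_of_real (lam i)) - norm z"
        using False nz by simp
      also have "\<dots> \<le> norm (of_real (lam i) - z)" by (rule norm_triangle_ineq2)
      finally show ?thesis .
    qed
  qed
  with pos show thesis by (rule that)
qed

text \<open>Nonvanishing and distinctness are required only where \<open>lam\<close> is nonzero. The
  value 0 may occur infinitely often and on zero vectors.\<close>

lemma gram_spectrum:
  assumes basis: "symmetric_eigenbasis schwartz_vec (gram M) e lam"
    and fin: "\<And>B. finite {i. lam i \<noteq> 0 \<and> lam i \<le> B}"
    and nz: "\<And>i. lam i \<noteq> 0 \<Longrightarrow> L2_norm (e i) \<noteq> 0"
    and inj: "\<And>i j. lam i \<noteq> 0 \<Longrightarrow> lam j = lam i \<Longrightarrow> j = i"
  shows "op_spectrum (adjoint_comp_graph M) - {0} = of_real ` (range lam - {0})"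
    and "\<And>i. lam i \<noteq> 0 \<Longrightarrow> simple_eigenvalue (adjoint_comp_graph M) (of_real (lam i))"
proof -
  interpret symmetric_eigenbasis schwartz_vec "gram M" e lam by (rule basis)
  have G: "adjoint_comp_graph M = G"
    unfolding adjoint_comp_graph_def gram_def[abs_def] ..
  show "simple_eigenvalue (adjoint_comp_graph M) (of_real (lam i))" if "lam i \<noteq> 0" for i
    unfolding G using nz[OF that] inj[OF that] by (intro simple_eigenvalueI) auto
  show "op_spectrum (adjoint_comp_graph M) - {0} = of_real ` (range lam - {0})"
  proof (intro equalityI subsetI)
    fix z :: complex assume "z \<in> of_real ` (range lam - {0})"
    then obtain i where i: "z = of_real (lam i)" "lam i \<noteq> 0" by auto
    show "z \<in> op_spectrum (adjoint_comp_graph M) - {0}"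
      unfolding G i(1) using in_op_spectrum[OF nz[OF i(2)]] i(2) by simp
  next
    fix z assume z: "z \<in> op_spectrum (adjoint_comp_graph M) - {0}"
    show "z \<in> of_real ` (range lam - {0})"
    proof (rule ccontr)
      assume no: "z \<notin> of_real ` (range lam - {0})"
      have "z \<noteq> of_real (lam i)" for i
        using no z by (cases "lam i = 0") auto
      then obtain \<delta> where "0 < \<delta>" "\<And>i. \<delta> \<le> norm (of_real (lam i) - z)"
        using spectral_gap[OF fin] z by blast
      then have "z \<in> resolvent_set G" by (rule in_resolvent_set)
      with z show False by (simp add: G op_spectrum_def)
    qed
  qed
qed

text \<open>Applied with a test vector \<open>v\<close> that isolates one Hermite coefficient of
  \<open>u\<close> known to be nonzero.\<close>

lemma L2_norm_neq_0I:
  assumes "u \<in> L2_space" "v \<in> L2_space" "L2_ip u v \<noteq> 0"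
  shows "L2_norm u \<noteq> 0"
  using norm_L2_ip_le[OF assms(1,2)] assms(3) by auto

lemma finite_linear_bound:
  fixes c :: real
  assumes "0 < c" "\<And>i. P i \<Longrightarrow> c * real i \<le> B"
  shows "finite {i. P i}"
proof (rule finite_subset)
  show "{i. P i} \<subseteq> {.. nat \<lceil>B / c\<rceil>}"
  proof
    fix i assume "i \<in> {i. P i}"
    then have "real i \<le> B / c" using assms by (simp add: field_simps)
    then show "i \<in> {.. nat \<lceil>B / c\<rceil>}" by simp linarith
  qed
qed simp

section \<open>The spectrum of the first operator\<close>

definition D1_eval :: "real \<Rightarrow> nat \<Rightarrow> real" where
  "D1_eval h n = \<bar>h\<bar> ^ 3 * (2 * real n + 1) * \<bar>(2 * real n + 1)\<^sup>2 - 2\<bar>"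

lemma odd_sq_minus_2_ge: "1 \<le> \<bar>(2 * real n + 1)\<^sup>2 - 2\<bar>"
proof (cases "n = 0")
  case False
  then have "3\<^sup>2 \<le> (2 * real n + 1)\<^sup>2" by (intro power_mono) auto
  then show ?thesis by simp
qed simp

text \<open>The absolute value is not monotone near the square root of 2, but the larger odd number
  is at least 3, where m^2 - 2 exceeds 1 and is increasing.\<close>

lemma odd_sq_minus_2_less:
  assumes "n < k"
  shows "(2 * real n + 1) * \<bar>(2 * real n + 1)\<^sup>2 - 2\<bar> < (2 * real k + 1) * \<bar>(2 * real k + 1)\<^sup>2 - 2\<bar>"
proof -
  have "3\<^sup>2 \<le> (2 * real k + 1)\<^sup>2" "(2 * real n + 1)\<^sup>2 \<le> (2 * real k + 1)\<^sup>2"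
    using assms by (intro power_mono; simp)+
  moreover have "(3::real)\<^sup>2 = 9" by simp
  ultimately have "\<bar>(2 * real n + 1)\<^sup>2 - 2\<bar> \<le> \<bar>(2 * real k + 1)\<^sup>2 - 2\<bar>"
    using zero_le_power2[of "2 * real n + 1"] by linarith
  then show ?thesis
    using assms odd_sq_minus_2_ge[of n] by (intro mult_less_le_imp_less) auto
qed

lemma D1_eval_ge: "\<bar>h\<bar> ^ 3 * (2 * real n + 1) \<le> D1_eval h n"
proof -
  have "\<bar>h\<bar> ^ 3 * (2 * real n + 1) * 1 \<le> \<bar>h\<bar> ^ 3 * (2 * real n + 1) * \<bar>(2 * real n + 1)\<^sup>2 - 2\<bar>"
    by (intro mult_left_mono odd_sq_minus_2_ge) auto
  then show ?thesis by (simp add: D1_eval_def)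
qed

lemma D1_eval_pos: "h \<noteq> 0 \<Longrightarrow> 0 < D1_eval h n"
  by (rule order_less_le_trans[OF _ D1_eval_ge]) simp

lemma inj_D1_eval:
  assumes h: "h \<noteq> 0"
  shows "inj (D1_eval h)"
proof (rule linorder_injI)
  fix n k :: nat assume "n < k"
  then have "\<bar>h\<bar> ^ 3 * ((2 * real n + 1) * \<bar>(2 * real n + 1)\<^sup>2 - 2\<bar>) < \<bar>h\<bar> ^ 3 * ((2 * real k + 1) * \<bar>(2 * real k + 1)\<^sup>2 - 2\<bar>)"
    using h by (intro mult_strict_left_mono odd_sq_minus_2_less) auto
  then show "D1_eval h n \<noteq> D1_eval h k" unfolding D1_eval_def mult.assoc by linarith
qed

text \<open>The block \<open>n = 0\<close> consists of kernel vectors only; the lowest eigenvalue comes from the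
  block \<open>n = - 1\<close>.\<close>

definition D1_block :: "nat \<Rightarrow> int" where
  "D1_block n = (if n = 0 then - 1 else int n)"

definition D1_basis :: "real \<Rightarrow> nat \<Rightarrow> real \<Rightarrow> complex ^ 2" where
  "D1_basis h i = (if even i then D1_vec h (D1_block (i div 2)) 2 (of_int (D1_block (i div 2)))
     else D1_vec h (int (i div 2)) 2 (- (of_int (int (i div 2)) + 1)))"

definition D1_lam :: "real \<Rightarrow> nat \<Rightarrow> real" where
  "D1_lam h i = (if even i then D1_eval h (i div 2) else 0)"

lemma D1_basis_schwartz: "D1_basis h i \<in> schwartz_vec"
  by (simp add: D1_basis_def D1_vec_schwartz)

lemma D1_basis_eigen:
  assumes h: "h \<noteq> 0"
  shows "gram (D1 h) (D1_basis h i) = (\<lambda>t. of_real (D1_lam h i) *s D1_basis h i t)"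
proof (cases "even i")
  case True
  let ?n = "i div 2" and ?b = "D1_block (i div 2)"
  let ?m = "2 * real_of_int ?b + 1"
  \<comment> \<open>In block -1 both m = -1 and m^2 - 2 = -1 are negative and the signs cancel; in
    the other blocks used here both factors are positive.\<close>
  have "?m * (?m\<^sup>2 - 2) = (2 * real ?n + 1) * \<bar>(2 * real ?n + 1)\<^sup>2 - 2\<bar>"
  proof (cases "?n = 0")
    case False
    then have "1 \<le> real ?n" by linarith
    then have "3\<^sup>2 \<le> (2 * real ?n + 1)\<^sup>2" by (intro power_mono) auto
    then show ?thesis using False by (simp add: D1_block_def)
  qed (simp add: D1_block_def)
  then have "D1_lam h i = \<bar>h\<bar> ^ 3 * (?m * (?m\<^sup>2 - 2))"
    using True by (simp add: D1_lam_def D1_eval_def)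
  then show ?thesis
    using gram_D1_eigen[OF h, of ?b] True by (simp add: D1_basis_def)
next
  case False
  then show ?thesis
    using gram_D1_kernel[OF h, of "int (i div 2)"] by (simp add: D1_basis_def D1_lam_def)
qed

lemma D1_lam_inj:
  assumes h: "h \<noteq> 0" and "D1_lam h i \<noteq> 0" "D1_lam h j = D1_lam h i"
  shows "j = i"
proof -
  have e: "even i" "even j"
    using assms D1_eval_pos[OF h] by (auto simp: D1_lam_def split: if_splits)
  then have "j div 2 = i div 2"
    using assms(3) inj_D1_eval[OF h] by (simp add: D1_lam_def inj_eq)
  with e show ?thesis by (metis dvd_mult_div_cancel)
qed

lemma D1_basis_orth:
  assumes h: "h \<noteq> 0" and ij: "i \<noteq> j"
  shows "L2_ip (D1_basis h i) (D1_basis h j) = 0"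
proof (cases "D1_lam h i = D1_lam h j")
  case False
  show ?thesis
    by (rule eigenvectors_orthogonal[OF adj_mats_D1 D1_basis_schwartz D1_basis_schwartz
          D1_basis_eigen[OF h] D1_basis_eigen[OF h] False])
next
  case True
  then have "D1_lam h i = 0" "D1_lam h j = 0" using D1_lam_inj[OF h, of i j] ij by metis+
  then have o: "odd i" "odd j"
    using D1_eval_pos[OF h] by (metis D1_lam_def less_irrefl)+
  then have "int (i div 2) \<noteq> int (j div 2)" using ij by presburger
  then show ?thesis
    using o by (simp add: D1_basis_def L2_ip_D1_vec_D1_vec[OF h] psi_orth)
qed

lemma D1_basis_complete:
  assumes h: "h \<noteq> 0" and u: "u \<in> L2_space" and z: "\<And>i. L2_ip u (D1_basis h i) = 0"
  shows "L2_eq u (\<lambda>_. 0)"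
proof -
  let ?p = "\<lambda>k. coef u 1 k - \<i> * of_real (sgn h) * coef u 2 k"
  let ?q = "\<lambda>k. coef u 1 k + \<i> * of_real (sgn h) * coef u 2 k"
  have E: "2 * ?p (D1_block n - 1) + of_int (D1_block n) * ?q (D1_block n + 1) = 0" for n
    using z[of "2 * n"] by (simp add: D1_basis_def L2_ip_D1_vec[OF u])
  have K: "2 * ?p (int n - 1) - (of_nat n + 1) * ?q (int n + 1) = 0" for n
    using z[of "2 * n + 1"] by (simp add: D1_basis_def L2_ip_D1_vec[OF u] algebra_simps)
  \<comment> \<open>Eigenvector and kernel vector of block \<open>n\<close> give two equations whose
    difference is (2 n + 1) times the second unknown.\<close>
  have pq: "?p (int n - 1) = 0 \<and> ?q (int n + 1) = 0" if n: "n \<noteq> 0" for n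
  proof -
    have "2 * ?p (int n - 1) + of_nat n * ?q (int n + 1) = 0"
      using E[of n] n by (simp add: D1_block_def)
    then have "of_nat (2 * n + 1) * ?q (int n + 1) = 0"
      using K[of n] by (simp add: algebra_simps)
    then have "?q (int n + 1) = 0" by (simp only: mult_eq_0_iff of_nat_eq_0_iff) simp
    with K[of n] show ?thesis by simp
  qed
  show ?thesis
  proof (rule D1_coef_complete[OF h u])
    fix k :: int assume k: "0 \<le> k"
    show "?p k = 0" using pq[of "nat (k + 1)"] k by simp
    \<comment> \<open>The positions 0 and 1 lie in the one-dimensional blocks -1 and 0: the first is
      settled by the lowest eigenvector, the second by the kernel vector of block 0.\<close>
    consider "k = 0" | "k = 1" | "2 \<le> k" using k by linarith
    then show "?q k = 0"
    proof cases
      case 1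
      then show ?thesis
        using E[of 0] by (simp add: D1_block_def coef_neg) (metis add.right_inverse)
    next
      case 2
      then show ?thesis
        using K[of 0] by (simp add: coef_neg) (metis add.right_inverse)
    next
      case 3
      then show ?thesis using pq[of "nat (k - 1)"] by simp
    qed
  qed
qed

lemma D1_spectrum:
  assumes h: "h \<noteq> 0"
  shows "op_spectrum (adjoint_comp_graph (D1 h)) - {0} = range (\<lambda>n. complex_of_real (D1_eval h n))"
    and "simple_eigenvalue (adjoint_comp_graph (D1 h)) (complex_of_real (D1_eval h n))"
proof -
  have basis: "symmetric_eigenbasis schwartz_vec (gram (D1 h)) (D1_basis h) (D1_lam h)"
    by (intro symmetric_eigenbasis_gram[OF adj_mats_D1] D1_basis_schwartz D1_basis_eigen[OF h]
        D1_basis_orth[OF h] D1_basis_complete[OF h])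
  have fin: "finite {i. D1_lam h i \<noteq> 0 \<and> D1_lam h i \<le> B}" for B
  proof (rule finite_linear_bound)
    show "0 < \<bar>h\<bar> ^ 3" using h by simp
    fix i assume i: "D1_lam h i \<noteq> 0 \<and> D1_lam h i \<le> B"
    then have e: "even i" by (auto simp: D1_lam_def split: if_splits)
    have "\<bar>h\<bar> ^ 3 * real i \<le> \<bar>h\<bar> ^ 3 * (2 * real (i div 2) + 1)"
      using e by (intro mult_left_mono) auto
    also have "\<dots> \<le> B" using D1_eval_ge[of h "i div 2"] i e by (simp add: D1_lam_def)
    finally show "\<bar>h\<bar> ^ 3 * real i \<le> B" .
  qed
  have nz: "L2_norm (D1_basis h i) \<noteq> 0" if "D1_lam h i \<noteq> 0" for i
  proof (rule L2_norm_neq_0I)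
    have e: "even i" using that by (auto simp: D1_lam_def split: if_splits)
    \<comment> \<open>The test vector isolates the coefficient at \<open>psi (n + 1)\<close>, which
      is the block number; \<open>D1_block\<close> avoids 0 and keeps the index n + 1
      nonnegative.\<close>
    show "L2_ip (D1_basis h i) (D1_vec h (D1_block (i div 2)) 0 1) \<noteq> 0"
      using e by (simp add: D1_basis_def L2_ip_D1_vec_D1_vec[OF h] psi_norm_neq_0 D1_block_def)
  qed (intro schwartz_vec_L2 D1_basis_schwartz D1_vec_schwartz)+
  have simple: "simple_eigenvalue (adjoint_comp_graph (D1 h)) (of_real (D1_lam h i))" if "D1_lam h i \<noteq> 0" for i
    by (rule gram_spectrum(2)[OF basis fin nz D1_lam_inj[OF h] that])
  have ev: "D1_lam h (2 * n) = D1_eval h n" for n by (simp add: D1_lam_def)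
  have pos: "D1_lam h (2 * n) \<noteq> 0" for n using D1_eval_pos[OF h, of n] by (simp add: ev)
  show "simple_eigenvalue (adjoint_comp_graph (D1 h)) (complex_of_real (D1_eval h n))"
    using simple[OF pos[of n]] by (simp add: ev)
  have range: "range (D1_lam h) - {0} = range (D1_eval h)"
  proof (intro equalityI subsetI)
    fix x assume "x \<in> range (D1_eval h)"
    then obtain n where "x = D1_lam h (2 * n)" by (auto simp: ev)
    then show "x \<in> range (D1_lam h) - {0}" using pos by auto
  qed (auto simp: D1_lam_def split: if_splits)
  have "op_spectrum (adjoint_comp_graph (D1 h)) - {0} = of_real ` (range (D1_lam h) - {0})"
    by (rule gram_spectrum(1)[OF basis fin nz D1_lam_inj[OF h]])
  then show "op_spectrum (adjoint_comp_graph (D1 h)) - {0} = range (\<lambda>n. complex_of_real (D1_eval h n))"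
    unfolding range image_image .
qed

section \<open>The spectrum of the second operator\<close>

definition D2_root :: "nat \<Rightarrow> real" where
  "D2_root n = sqrt (8 * (2 * real n + 1)\<^sup>2 + 9)"

lemma D2_root_sq: "(D2_root n)\<^sup>2 = 8 * (2 * real n + 1)\<^sup>2 + 9"
  unfolding D2_root_def by (simp add: add_nonneg_nonneg)

text \<open>The first two roots are sqrt 17 and 9. These bounds exclude the accidental coincidences
  of small eigenvalues, and the linear bound gives growth.\<close>

lemma D2_root_ge: "2 * (2 * real n + 1) \<le> D2_root n" "4 < D2_root n" "n \<noteq> 0 \<Longrightarrow> 9 \<le> D2_root n"
proof -
  show "2 * (2 * real n + 1) \<le> D2_root n"
  proof -
    have "(2 * m)\<^sup>2 \<le> 8 * m\<^sup>2 + 9" for m :: real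
      using zero_le_power2[of m] by (simp add: power_mult_distrib)
    then show ?thesis unfolding D2_root_def by (rule real_le_rsqrt)
  qed
  have "1 \<le> (2 * real n + 1)\<^sup>2" by (intro one_le_power) simp
  then have "4\<^sup>2 < 8 * (2 * real n + 1)\<^sup>2 + 9" unfolding power2_eq_square[of 4] by linarith
  then show "4 < D2_root n"
    unfolding D2_root_def by (rule real_less_rsqrt)
  assume "n \<noteq> 0"
  then have "3\<^sup>2 \<le> (2 * real n + 1)\<^sup>2" by (intro power_mono) auto
  then have "9\<^sup>2 \<le> 8 * (2 * real n + 1)\<^sup>2 + 9"
    unfolding power2_eq_square[of 9] power2_eq_square[of 3] by linarith
  then show "9 \<le> D2_root n"
    unfolding D2_root_def by (rule real_le_rsqrt)
qed

lemma D2_root_inj: "D2_root n = D2_root k \<Longrightarrow> n = k"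
proof -
  assume "D2_root n = D2_root k"
  then have "(D2_root n)\<^sup>2 = (D2_root k)\<^sup>2" by (rule arg_cong)
  then have "(2 * real n + 1)\<^sup>2 = (2 * real k + 1)\<^sup>2"
    unfolding D2_root_sq by linarith
  then have "2 * real n + 1 = 2 * real k + 1"
    by (rule power2_eq_imp_eq) auto
  then show "n = k" by simp
qed

lemma D2_root_neq_5: "D2_root n \<noteq> 5"
proof
  assume 5: "D2_root n = 5"
  then have "n = 0" using D2_root_ge(3)[of n] by force
  then show False using D2_root_sq[of n] 5 by simp
qed

text \<open>A difference of ten would force both roots to be rational, and then
  \<open>8 a\<^sup>2 + 9 = x\<^sup>2\<close>, \<open>8 b\<^sup>2 + 9 = (x + 10)\<^sup>2\<close> with odd \<open>a\<close>, \<open>b\<close> has no solution modulo \<open>16\<close>.\<close>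

lemma D2_root_diff: "D2_root k \<noteq> D2_root n + 10"
proof
  assume eq: "D2_root k = D2_root n + 10"
  \<comment> \<open>Triangular numbers encode that 2 i + 1 is odd: (2 i + 1)^2 = 8 p + 1, so the
    squared root is 64 p + 17.\<close>
  define p where "p i = int i * (int i + 1) div 2" for i :: nat
  have p: "real_of_int (p i) * 2 = real i * (real i + 1)" for i
  proof -
    have "p i * 2 = int i * (int i + 1)" unfolding p_def by simp
    from arg_cong[where f = real_of_int, OF this] show ?thesis by simp
  qed
  have sq: "(D2_root i)\<^sup>2 = 64 * p i + 17" for i
    unfolding D2_root_sq using p[of i] by (simp add: power2_eq_square algebra_simps)
  let ?d = "p k - p n"
  have "20 * D2_root n = 64 * ?d - 100"
    using sq[of k] sq[of n] unfolding eq by (simp add: power2_eq_square algebra_simps)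
  then have "5 * D2_root n = 16 * ?d - 25" by simp
  then have "(5 * D2_root n)\<^sup>2 = (16 * real_of_int ?d - 25)\<^sup>2" by simp
  then have "25 * (64 * p n + 17) = (16 * real_of_int ?d - 25)\<^sup>2"
    by (simp add: power_mult_distrib sq)
  then have "real_of_int (25 * (64 * p n + 17)) = real_of_int ((16 * ?d - 25)\<^sup>2)" by simp
  then have "25 * (64 * p n + 17) = (16 * ?d - 25)\<^sup>2" by (simp only: of_int_eq_iff)
  also have "(16 * ?d - 25)\<^sup>2 = 256 * (?d * ?d) - 800 * ?d + 625"
    by algebra
  finally have "25 * (64 * p n + 17) = 256 * (?d * ?d) - 800 * ?d + 625" .
  \<comment> \<open>Division by 8 leaves an even number on the left and 25 on the right.\<close>
  moreover have "2 * (100 * a - 16 * b + 50 * d) = 25" if "25 * (64 * a + 17) = 256 * b - 800 * d + 625"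
    for a b d :: int using that by simp
  ultimately have "2 * (100 * p n - 16 * (?d * ?d) + 50 * ?d) = 25" by blast
  moreover have "2 * x \<noteq> 25" for x :: int by presburger
  ultimately show False by blast
qed

definition D2_eval :: "real \<Rightarrow> bool \<Rightarrow> nat \<Rightarrow> real" where
  "D2_eval h up n = h\<^sup>2 * ((D2_root n + (if up then 5 else - 5)) / 4)\<^sup>2"

lemma D2_eval_neq_0: "h \<noteq> 0 \<Longrightarrow> D2_eval h up n \<noteq> 0"
  using D2_root_neq_5[of n] D2_root_ge(2)[of n] by (auto simp: D2_eval_def)

text \<open>Equal squares mean equal or opposite bases. Mixed signs would force a difference of ten
  between two roots or a vanishing sum. Two lower eigenvalues with opposite bases would have roots
  adding up to 10, which leaves only n = k = 0, since every other root is at least 9.\<close>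

lemma D2_eval_inj:
  assumes h: "h \<noteq> 0" and eq: "D2_eval h p n = D2_eval h q k"
  shows "p = q \<and> n = k"
proof -
  let ?c = "\<lambda>p. if p then 5 else - 5 :: real"
  have "(D2_root n + ?c p)\<^sup>2 = (D2_root k + ?c q)\<^sup>2"
    using eq h by (simp add: D2_eval_def power_divide)
  then have cases: "D2_root n + ?c p = D2_root k + ?c q \<or> D2_root n + ?c p = - (D2_root k + ?c q)"
    by (simp only: power2_eq_iff)
  note ge = D2_root_ge(2)[of n] D2_root_ge(2)[of k] D2_root_ge(3)[of n] D2_root_ge(3)[of k]
  show ?thesis
  proof (cases p; cases q)
    assume "p" "q"
    then have "D2_root n = D2_root k" using cases ge by auto
    with \<open>p\<close> \<open>q\<close> show ?thesis using D2_root_inj by blast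
  next
    assume "p" "\<not> q"
    then have "D2_root k = D2_root n + 10" using cases ge by auto
    then show ?thesis using D2_root_diff by blast
  next
    assume "\<not> p" "q"
    then have "D2_root n = D2_root k + 10" using cases ge by auto
    then show ?thesis using D2_root_diff by blast
  next
    assume pq: "\<not> p" "\<not> q"
    then consider "D2_root n = D2_root k" | "D2_root n + D2_root k = 10" using cases by force
    then have "n = k"
    proof cases
      case 2
      then have "n = 0" "k = 0" using ge by force+
      then show ?thesis by simp
    qed (rule D2_root_inj)
    with pq show ?thesis by simp
  qed
qed

text \<open>A linear lower bound from y^2 >= 2 y - 1, enough for finitely many eigenvalues below any
  given bound.\<close>

lemma D2_eval_ge: "h\<^sup>2 * (2 * real n - 5 / 2) \<le> D2_eval h up n"
proof -
  let ?y = "(D2_root n + (if up then 5 else - 5)) / 4"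
  have "2 * y - 1 \<le> y\<^sup>2" for y :: real
    using zero_le_power2[of "y - 1"] by (simp add: power2_diff)
  note this[of ?y]
  moreover have "2 * real n - 5 / 2 \<le> 2 * ?y - 1"
    using D2_root_ge(1)[of n] by (cases up; simp add: field_simps)
  ultimately have "2 * real n - 5 / 2 \<le> ?y\<^sup>2" by linarith
  then show ?thesis unfolding D2_eval_def by (intro mult_left_mono) auto
qed

text \<open>The two roots of the quadratic equation of block \<open>n\<close>. Only the square of
  \<nu> enters the eigenvalue, so the larger eigenvalue belongs to the negative root.\<close>

definition D2_nu :: "bool \<Rightarrow> nat \<Rightarrow> real" where
  "D2_nu up n = - 5 - (if up then D2_root n else - D2_root n)"

lemma D2_nu_quadratic: "(D2_nu up n)\<^sup>2 + 10 * D2_nu up n + 16 = 8 * (2 * real n + 1)\<^sup>2"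
proof -
  have "(D2_nu up n)\<^sup>2 + 10 * D2_nu up n + 16 = (D2_root n)\<^sup>2 - 9"
    by (simp add: D2_nu_def power2_eq_square algebra_simps)
  then show ?thesis by (simp add: D2_root_sq)
qed

text \<open>These are the denominators of the eigenvector. Substituted into the quadratic equation,
  the excluded values give (2 n + 1)(n - 1) = 0 and (2 n + 1)(n + 2) = 0, so the only exception is n
  = 1 with \<nu> = 4.\<close>

lemma D2_nu_neq:
  assumes n: "up \<or> n \<noteq> 1"
  shows "D2_nu up n \<noteq> 4 * real n" "D2_nu up n \<noteq> - 4 * real n - 4"
proof
  assume e: "D2_nu up n = 4 * real n"
  then have "(2 * real n + 1) * (real n - 1) = 0"
    using D2_nu_quadratic[of up n] by (simp add: power2_eq_square algebra_simps)
  then have "n = 1" by auto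
  moreover from this have "\<not> up" using e D2_root_ge(2)[of n] by (auto simp: D2_nu_def)
  ultimately show False using n by simp
next
  show "D2_nu up n \<noteq> - 4 * real n - 4"
  proof
    assume e: "D2_nu up n = - 4 * real n - 4"
    have "(2 * real n + 1) * (real n + 2) = 0"
      using D2_nu_quadratic[of up n] unfolding e by (simp add: power2_eq_square algebra_simps)
    then show False by auto
  qed
qed

definition D2_R :: "bool \<Rightarrow> nat \<Rightarrow> real" where
  "D2_R up n = 4 / (D2_nu up n - 4 * real n)"

definition D2_T :: "bool \<Rightarrow> nat \<Rightarrow> real" where
  "D2_T up n = - ((real n + 1) * (real n + 2)) / (D2_nu up n + 4 * real n + 4)"

text \<open>With the middle coefficient set to 1, the first and third equations determine
  \<open>D2_R\<close> and \<open>D2_T\<close>; the second, cleared of denominators, is then the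
  quadratic equation for \<nu>.\<close>

lemma D2_RT_eqs:
  assumes n: "up \<or> n \<noteq> 1"
  shows "4 * real n * D2_R up n + 4 = D2_nu up n * D2_R up n"
    and "2 * real n * (real n - 1) * D2_R up n - 6 - 8 * D2_T up n = D2_nu up n"
    and "- 4 * (real n + 1) * D2_T up n - (real n + 1) * (real n + 2) = D2_nu up n * D2_T up n"
proof -
  let ?v = "D2_nu up n" and ?n = "real n"
  have nz: "?v - 4 * ?n \<noteq> 0" "?v + 4 * ?n + 4 \<noteq> 0" using D2_nu_neq[OF n] by auto
  have R: "D2_R up n * (?v - 4 * ?n) = 4"
    by (rule nonzero_eq_divide_eq[OF nz(1), THEN iffD1, OF D2_R_def])
  have T: "D2_T up n * (?v + 4 * ?n + 4) = - ((?n + 1) * (?n + 2))"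
    by (rule nonzero_eq_divide_eq[OF nz(2), THEN iffD1, OF D2_T_def])
  show "4 * ?n * D2_R up n + 4 = ?v * D2_R up n" using R by (simp add: algebra_simps)
  show "- 4 * (?n + 1) * D2_T up n - (?n + 1) * (?n + 2) = ?v * D2_T up n"
    using T by (simp add: algebra_simps)
  have quad: "?v * ?v = - 10 * ?v - 8 + 32 * ?n * ?n + 32 * ?n"
    using D2_nu_quadratic[of up n] by (simp add: power2_eq_square algebra_simps)
  have "(2 * ?n * (?n - 1) * D2_R up n - 6 - 8 * D2_T up n - ?v) * ((?v - 4 * ?n) * (?v + 4 * ?n + 4))
      = 2 * ?n * (?n - 1) * (D2_R up n * (?v - 4 * ?n)) * (?v + 4 * ?n + 4)
        - 8 * (D2_T up n * (?v + 4 * ?n + 4)) * (?v - 4 * ?n)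
        - (6 + ?v) * ((?v - 4 * ?n) * (?v + 4 * ?n + 4))"
    by algebra
  also have "\<dots> = 0"
    unfolding R T using quad by algebra
  finally show "2 * ?n * (?n - 1) * D2_R up n - 6 - 8 * D2_T up n = ?v" using nz by simp
qed

text \<open>For \<open>n = 1\<close> the root \<open>\<nu> = 4\<close> belongs to a vanishing vector of block \<open>1\<close>; the eigenvector for
  this root lives in block \<open>- 2\<close>, where only the third coefficient matters because \<open>psi\<close> vanishes at
  \<open>- 4\<close> and \<open>- 2\<close>.\<close>

definition D2_pm :: "real \<Rightarrow> bool \<Rightarrow> nat \<Rightarrow> real \<Rightarrow> complex ^ 3" where
  "D2_pm h up n = (if up \<or> n \<noteq> 1 then D2_vec h (int n) (D2_R up n) 1 (D2_T up n)
     else D2_vec h (- 2) (- 4) (- 12) 9)"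

text \<open>Up to a nonzero scalar this is D_1 applied to \<open>D1_vec h k 2 k\<close>, which D_2
  annihilates. For \<open>k = 0\<close> it is the zero vector, since the D_1 eigenvector of block 0
  vanishes.\<close>

definition D2_ker :: "real \<Rightarrow> int \<Rightarrow> real \<Rightarrow> complex ^ 3" where
  "D2_ker h k = D2_vec h k 4 (- 4 * of_int k) (of_int k * (of_int k + 2))"

lemma D2_pm_eigen:
  assumes h: "h \<noteq> 0"
  shows "gram (D2 h) (D2_pm h up n) = (\<lambda>t. of_real (D2_eval h up n) *s D2_pm h up n t)"
proof -
  have v: "(D2_nu up n / 4)\<^sup>2 = ((D2_root n + (if up then 5 else - 5)) / 4)\<^sup>2"
    by (simp add: D2_nu_def power2_eq_square algebra_simps)
  show ?thesis
  proof (cases "up \<or> n \<noteq> 1")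
    case True
    have "gram (D2 h) (D2_vec h (int n) (D2_R up n) 1 (D2_T up n))
        = (\<lambda>t. of_real (h\<^sup>2 * (D2_nu up n / 4)\<^sup>2) *s D2_vec h (int n) (D2_R up n) 1 (D2_T up n) t)"
      by (rule gram_D2_eigen[OF h]) (use D2_RT_eqs[OF True] in simp_all)
    then show ?thesis using True by (simp add: D2_pm_def D2_eval_def v)
  next
    case False
    have "D2_root 1 = sqrt (9\<^sup>2)" by (simp add: D2_root_def)
    then have r: "D2_root (Suc 0) = 9" by simp
    have "gram (D2 h) (D2_vec h (- 2) (- 4) (- 12) 9)
        = (\<lambda>t. of_real (h\<^sup>2 * (4 / 4)\<^sup>2) *s D2_vec h (- 2) (- 4) (- 12) 9 t)"
      \<comment> \<open>For n = -2 and \<nu> = 4 the third equation is an identity, the first gives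
        W = 3 R, and the second then gives T = 9 for R = -4.\<close>
      by (rule gram_D2_eigen[OF h]) simp_all
    then show ?thesis using False by (simp add: D2_pm_def D2_eval_def r)
  qed
qed

lemma D2_ker_eigen:
  assumes h: "h \<noteq> 0"
  shows "gram (D2 h) (D2_ker h k) = (\<lambda>t. of_real 0 *s D2_ker h k t)"
  using gram_D2_eigen[OF h, of k 4 "- 4 * of_int k" 0 "of_int k * (of_int k + 2)"]
  by (simp add: D2_ker_def algebra_simps)

text \<open>After clearing denominators, the quadratic equation reduces each orthogonality relation
  to the form v l + k = 0 with l and k independent of the root. Two different roots force both to
  vanish, which removes the roots from the system.\<close>

lemma D2_block_injective:
  fixes n v w a b c :: real
  assumes v: "v\<^sup>2 + 10 * v + 16 = 8 * (2 * n + 1)\<^sup>2" "v \<noteq> 4 * n" "v \<noteq> - 4 * n - 4"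
    and w: "w\<^sup>2 + 10 * w + 16 = 8 * (2 * n + 1)\<^sup>2" "w \<noteq> 4 * n" "w \<noteq> - 4 * n - 4"
    and vw: "v \<noteq> w"
    and ev: "4 / (v - 4 * n) * a + b - (n + 1) * (n + 2) / (v + 4 * n + 4) * c = 0"
    and ew: "4 / (w - 4 * n) * a + b - (n + 1) * (n + 2) / (w + 4 * n + 4) * c = 0"
  shows "4 * a - 6 * b - (n + 1) * (n + 2) * c = 0"
    and "4 * (n + 1) * a + (4 * n * (n + 1) - 2) * b + n * (n + 1) * (n + 2) * c = 0"
proof -
  let ?l = "4 * a - 6 * b - (n + 1) * (n + 2) * c"
  let ?k = "16 * (n + 1) * a + (16 * n * (n + 1) - 8) * b + 4 * n * (n + 1) * (n + 2) * c"
  have lin: "v * ?l + ?k = 0"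
    if v: "v\<^sup>2 + 10 * v + 16 = 8 * (2 * n + 1)\<^sup>2" "v \<noteq> 4 * n" "v \<noteq> - 4 * n - 4"
      and e: "4 / (v - 4 * n) * a + b - (n + 1) * (n + 2) / (v + 4 * n + 4) * c = 0" for v
  proof -
    have nz: "v - 4 * n \<noteq> 0" "v + 4 * n + 4 \<noteq> 0" using v by auto
    define x where "x = 1 / (v - 4 * n)"
    define y where "y = 1 / (v + 4 * n + 4)"
    have x: "x * (v - 4 * n) = 1" and y: "y * (v + 4 * n + 4) = 1"
      using nz by (simp_all add: x_def y_def)
    have "4 * x * a + b - (n + 1) * (n + 2) * y * c = 0" using e by (simp add: x_def y_def)
    then have "4 * a * (v + 4 * n + 4) + b * ((v - 4 * n) * (v + 4 * n + 4)) - (n + 1) * (n + 2) * c * (v - 4 * n) = 0"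
      using x y by algebra
    then show ?thesis using v(1) by algebra
  qed
  have "(v - w) * ?l = 0" using lin[OF v ev] lin[OF w ew] by (simp add: algebra_simps)
  then show l: "?l = 0" using vw by simp
  then have "?k = 0" using lin[OF v ev] by simp
  then show "4 * (n + 1) * a + (4 * n * (n + 1) - 2) * b + n * (n + 1) * (n + 2) * c = 0"
    by algebra
qed

text \<open>The third equation is orthogonality to the kernel vector. Eliminating \<open>a\<close>
  from the first two leaves the factor (2 n + 1)(n + 2), and the last elimination leaves 4 n^2 + 4 n
  - 1; neither is zero.\<close>

lemma D2_block_injective_kernel:
  fixes n a b c :: real
  assumes n: "2 \<le> n"
    and e: "4 * a - 6 * b - (n + 1) * (n + 2) * c = 0"
      "4 * (n + 1) * a + (4 * n * (n + 1) - 2) * b + n * (n + 1) * (n + 2) * c = 0"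
      "4 * a - 4 * n * b + n * (n + 2) * c = 0"
  shows "a = 0 \<and> b = 0 \<and> c = 0"
proof -
  have "(2 * n + 1) * (n + 2) * (2 * b + (n + 1) * c) = 0"
    using e(1,2) by algebra
  then have b: "2 * b + (n + 1) * c = 0" using n by auto
  then have "(4 * n * n + 4 * n - 1) * c = 0" using e(1,3) by algebra
  moreover have "0 < 4 * n * n + 4 * n - 1"
    using n mult_mono[of 2 n 2 n] by simp
  ultimately have c: "c = 0" by simp
  with b have "b = 0" by simp
  with c e(1) show ?thesis by simp
qed

text \<open>The shift by one starts the kernel vectors in block -1, where only the coefficient at
  \<open>psi 1\<close> survives.\<close>

definition D2_basis :: "real \<Rightarrow> nat \<Rightarrow> real \<Rightarrow> complex ^ 3" where
  "D2_basis h i = (if i mod 3 = 2 then D2_ker h (int (i div 3) - 1) else D2_pm h (i mod 3 = 0) (i div 3))"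

definition D2_lam :: "real \<Rightarrow> nat \<Rightarrow> real" where
  "D2_lam h i = (if i mod 3 = 2 then 0 else D2_eval h (i mod 3 = 0) (i div 3))"

lemma D2_basis_schwartz: "D2_basis h i \<in> schwartz_vec"
  by (simp add: D2_basis_def D2_pm_def D2_ker_def D2_vec_schwartz)

lemma D2_basis_eigen:
  assumes h: "h \<noteq> 0"
  shows "gram (D2 h) (D2_basis h i) = (\<lambda>t. of_real (D2_lam h i) *s D2_basis h i t)"
  unfolding D2_basis_def D2_lam_def by (simp add: D2_pm_eigen[OF h] D2_ker_eigen[OF h])

lemma D2_lam_inj:
  assumes h: "h \<noteq> 0" and i: "D2_lam h i \<noteq> 0" and eq: "D2_lam h j = D2_lam h i"
  shows "j = i"
proof -
  have m: "i mod 3 \<noteq> 2" "j mod 3 \<noteq> 2" using i eq by (auto simp: D2_lam_def)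
  then have "D2_eval h (j mod 3 = 0) (j div 3) = D2_eval h (i mod 3 = 0) (i div 3)"
    using eq by (simp add: D2_lam_def)
  from D2_eval_inj[OF h this] have e: "(j mod 3 = 0) = (i mod 3 = 0)" "j div 3 = i div 3" by auto
  have "i mod 3 < 3" "j mod 3 < 3" by simp_all
  then have "j mod 3 = i mod 3" using m e(1) by linarith
  then show ?thesis using e(2) by (metis div_mult_mod_eq)
qed

lemma D2_basis_orth:
  assumes h: "h \<noteq> 0" and ij: "i \<noteq> j"
  shows "L2_ip (D2_basis h i) (D2_basis h j) = 0"
proof (cases "D2_lam h i = D2_lam h j")
  case False
  show ?thesis
    by (rule eigenvectors_orthogonal[OF adj_mats_D2 D2_basis_schwartz D2_basis_schwartz
          D2_basis_eigen[OF h] D2_basis_eigen[OF h] False])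
next
  case True
  then have "D2_lam h i = 0" "D2_lam h j = 0" using D2_lam_inj[OF h, of i j] ij by metis+
  then have m: "i mod 3 = 2" "j mod 3 = 2"
    using D2_eval_neq_0[OF h] by (metis D2_lam_def)+
  then have "int (i div 3) \<noteq> int (j div 3)" using ij by presburger
  then show ?thesis
    using m by (simp add: D2_basis_def D2_ker_def L2_ip_D2_vec_D2_vec[OF h] psi_orth)
qed

text \<open>Completeness is checked block by block: a function orthogonal to all eigenvectors satisfies
  in each block a linear system whose only solution is zero. All coefficients being real, real and
  imaginary parts can be treated separately.\<close>

lemma D2_basis_complete:
  assumes h: "h \<noteq> 0" and u: "u \<in> L2_space" and z: "\<And>i. L2_ip u (D2_basis h i) = 0"
  shows "L2_eq u (\<lambda>_. 0)"
proof -
  \<comment> \<open>\<open>a\<close>, \<open>b\<close>, \<open>c\<close> are the components along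
    the three block directions, so block \<open>n\<close> sees exactly \<open>a (n - 2)\<close>,
    \<open>b n\<close> and \<open>c (n + 2)\<close>.\<close>
  define a where "a k = coef u 1 k - \<i> * of_real (sgn h) * of_real (sqrt 2) * coef u 2 k - coef u 3 k" for k
  define b where "b k = coef u 1 k + coef u 3 k" for k
  define c where "c k = coef u 1 k + \<i> * of_real (sgn h) * of_real (sqrt 2) * coef u 2 k - coef u 3 k" for k
  have ip: "L2_ip u (D2_vec h n R W T) = of_real R * a (n - 2) + of_real W * b n + of_real T * c (n + 2)" for n R W T
    unfolding L2_ip_D2_vec[OF u] a_def b_def c_def ..
  have neg: "a k = 0" "b k = 0" "c k = 0" if "k < 0" for k
    using that by (simp_all add: a_def b_def c_def coef_neg)
  have P: "L2_ip u (D2_pm h True n) = 0" for n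
    using z[of "3 * n"] by (simp add: D2_basis_def)
  have "Suc (3 * n) div 3 = n" "Suc (3 * n) mod 3 = 1" for n by presburger+
  then have M: "L2_ip u (D2_pm h False n) = 0" for n
    using z[of "Suc (3 * n)"] by (simp add: D2_basis_def)
  have "Suc (Suc (3 * n)) div 3 = n" "Suc (Suc (3 * n)) mod 3 = 2" for n by presburger+
  then have K: "L2_ip u (D2_ker h (int n - 1)) = 0" for n
    using z[of "Suc (Suc (3 * n))"] by (simp add: D2_basis_def)
  have pm: "of_real (D2_R up n) * a (int n - 2) + b (int n) + of_real (D2_T up n) * c (int n + 2) = 0"
    if "up \<or> n \<noteq> 1" for up n
    using P[of n] M[of n] that by (cases up) (simp_all add: D2_pm_def ip)
  have ker: "4 * a (k - 2) - 4 * of_int k * b k + of_int k * (of_int k + 2) * c (k + 2) = 0" if "- 1 \<le> k" for k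
    using K[of "nat (k + 1)"] that by (simp add: D2_ker_def ip)
  have RT: "D2_R up n = 4 / (D2_nu up n - 4 * real n)"
    "D2_T up n = - ((real n + 1) * (real n + 2) / (D2_nu up n + 4 * real n + 4))" for up n
    by (simp_all add: D2_R_def D2_T_def)
  have nu: "D2_nu True n \<noteq> D2_nu False n" for n
    using D2_root_ge(2)[of n] by (simp add: D2_nu_def)
  have lin: "4 * A - 6 * B - (real n + 1) * (real n + 2) * C = 0 \<and>
      4 * (real n + 1) * A + (4 * real n * (real n + 1) - 2) * B + real n * (real n + 1) * (real n + 2) * C = 0"
    if n: "n \<noteq> 1" and e: "\<And>up. D2_R up n * A + B + D2_T up n * C = 0" for n A B C
  proof -
    have e': "4 / (D2_nu up n - 4 * real n) * A + B - (real n + 1) * (real n + 2) / (D2_nu up n + 4 * real n + 4) * C = 0" for up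
      using e[of up] unfolding RT by simp
    show ?thesis
      using D2_block_injective[OF D2_nu_quadratic D2_nu_neq[of True n] D2_nu_quadratic D2_nu_neq[of False n] nu e' e'] n by simp
  qed
  have generic: "a (int n - 2) = 0 \<and> b (int n) = 0 \<and> c (int n + 2) = 0" if n: "2 \<le> n" for n
  proof -
    have zero: "A = 0 \<and> B = 0 \<and> C = 0"
      if "\<And>up. D2_R up n * A + B + D2_T up n * C = 0" "4 * A - 4 * real n * B + real n * (real n + 2) * C = 0" for A B C
      using lin[OF _ that(1)] that(2) n by (intro D2_block_injective_kernel[of "real n"]) auto
    have k: "4 * a (int n - 2) - 4 * of_nat n * b (int n) + of_nat n * (of_nat n + 2) * c (int n + 2) = 0"
      using ker[of "int n"] by simp
    have "Re (a (int n - 2)) = 0 \<and> Re (b (int n)) = 0 \<and> Re (c (int n + 2)) = 0"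
    proof (rule zero)
      show "D2_R up n * Re (a (int n - 2)) + Re (b (int n)) + D2_T up n * Re (c (int n + 2)) = 0" for up
        using arg_cong[where f = Re, OF pm[of up n]] n by simp
      show "4 * Re (a (int n - 2)) - 4 * real n * Re (b (int n)) + real n * (real n + 2) * Re (c (int n + 2)) = 0"
        using arg_cong[where f = Re, OF k] by simp
    qed
    moreover have "Im (a (int n - 2)) = 0 \<and> Im (b (int n)) = 0 \<and> Im (c (int n + 2)) = 0"
    proof (rule zero)
      show "D2_R up n * Im (a (int n - 2)) + Im (b (int n)) + D2_T up n * Im (c (int n + 2)) = 0" for up
        using arg_cong[where f = Im, OF pm[of up n]] n by simp
      show "4 * Im (a (int n - 2)) - 4 * real n * Im (b (int n)) + real n * (real n + 2) * Im (c (int n + 2)) = 0"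
        using arg_cong[where f = Im, OF k] by simp
    qed
    ultimately show ?thesis by (simp add: complex_eq_iff)
  qed
  \<comment> \<open>The component at index -2 is absent, so the two eigenvectors match the two
    remaining unknowns; the kernel vector of this block is zero.\<close>
  have block0: "b 0 = 0 \<and> c 2 = 0"
  proof -
    have zero: "B = 0 \<and> C = 0" if "\<And>up. B + D2_T up 0 * C = 0" for B C
      using lin[of 0 0 B C] that by simp
    have e: "b 0 + of_real (D2_T up 0) * c 2 = 0" for up
      using pm[of up 0] by (simp add: neg)
    have "Re (b 0) = 0 \<and> Re (c 2) = 0"
      by (rule zero) (use arg_cong[where f = Re, OF e] in simp)
    moreover have "Im (b 0) = 0 \<and> Im (c 2) = 0"
      by (rule zero) (use arg_cong[where f = Im, OF e] in simp)
    ultimately show ?thesis by (simp add: complex_eq_iff)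
  qed
  \<comment> \<open>The root is 9, so the upper eigenvector has \<nu> = -14 and third coefficient 1;
    the kernel vector gives the second equation.\<close>
  have block1: "b 1 = 0 \<and> c 3 = 0"
  proof -
    have "D2_root 1 = sqrt (9\<^sup>2)" by (simp add: D2_root_def)
    then have "D2_T True 1 = 1" by (simp add: D2_T_def D2_nu_def)
    then have 1: "b 1 + c 3 = 0" using pm[of True 1] by (simp add: neg)
    have "- 4 * b 1 + 3 * c 3 = 0" using ker[of 1] by (simp add: neg)
    with 1 have "7 * c 3 = 0" by algebra
    with 1 show ?thesis by simp
  qed
  \<comment> \<open>Blocks -1 and -2 are one-dimensional, spanned by the third direction at
    \<open>psi 1\<close> and \<open>psi 0\<close>. The first is a kernel vector, the second the
    relocated eigenvector.\<close>
  have c1: "c 1 = 0" using ker[of "- 1"] by (simp add: neg)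
  have c0: "c 0 = 0" using M[of 1] by (simp add: D2_pm_def ip neg)
  have abc: "a k = 0" "b k = 0" "c k = 0" if k: "0 \<le> k" for k
  proof -
    show "a k = 0" using generic[of "nat (k + 2)"] k by simp
    consider "k = 0" | "k = 1" | "2 \<le> k" using k by linarith
    then show "b k = 0"
    proof cases
      case 3
      then show ?thesis using generic[of "nat k"] by simp
    qed (use block0 block1 in auto)
    consider "k = 0" | "k = 1" | "k = 2" | "k = 3" | "4 \<le> k" using k by linarith
    then show "c k = 0"
    proof cases
      case 5
      then show ?thesis using generic[of "nat (k - 2)"] by simp
    qed (use block0 block1 c0 c1 in auto)
  qed
  show ?thesis
    by (rule D2_coef_complete[OF h u]) (use abc in \<open>simp_all only: a_def b_def c_def\<close>)
qed

lemma D2_spectrum: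
  assumes h: "h \<noteq> 0"
  shows "op_spectrum (adjoint_comp_graph (D2 h)) - {0}
      = range (\<lambda>n. complex_of_real (D2_eval h True n)) \<union> range (\<lambda>n. complex_of_real (D2_eval h False n))"
    and "simple_eigenvalue (adjoint_comp_graph (D2 h)) (complex_of_real (D2_eval h up n))"
proof -
  have basis: "symmetric_eigenbasis schwartz_vec (gram (D2 h)) (D2_basis h) (D2_lam h)"
    by (intro symmetric_eigenbasis_gram[OF adj_mats_D2] D2_basis_schwartz D2_basis_eigen[OF h]
        D2_basis_orth[OF h] D2_basis_complete[OF h])
  have fin: "finite {i. D2_lam h i \<noteq> 0 \<and> D2_lam h i \<le> B}" for B
  proof (rule finite_linear_bound)
    show "0 < h\<^sup>2 * (2 / 3)" using h by simp
    fix i assume i: "D2_lam h i \<noteq> 0 \<and> D2_lam h i \<le> B"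
    have "i = 3 * (i div 3) + i mod 3" "i mod 3 \<le> 2" by simp_all
    then have "real i \<le> 3 * real (i div 3) + 2" by linarith
    \<comment> \<open>The loss 4/3 + 5/2 is rounded up to 4.\<close>
    then have "2 / 3 * real i - 4 \<le> 2 * real (i div 3) - 5 / 2" by simp
    then have "h\<^sup>2 * (2 / 3 * real i - 4) \<le> h\<^sup>2 * (2 * real (i div 3) - 5 / 2)"
      by (intro mult_left_mono) auto
    also have "\<dots> \<le> D2_lam h i"
      using i D2_eval_ge[of h "i div 3"] by (auto simp: D2_lam_def)
    also have "\<dots> \<le> B" using i by simp
    finally show "h\<^sup>2 * (2 / 3) * real i \<le> B + 4 * h\<^sup>2" by (simp add: algebra_simps)
  qed
  have nz: "L2_norm (D2_basis h i) \<noteq> 0" if "D2_lam h i \<noteq> 0" for i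
  proof -
    let ?up = "i mod 3 = 0" and ?n = "i div 3"
    have "i mod 3 \<noteq> 2" using that by (metis D2_lam_def)
    then have b: "D2_basis h i = D2_pm h ?up ?n" by (simp add: D2_basis_def)
    \<comment> \<open>The test vector isolates the middle coefficient, normalized to 1, or in the
      exceptional block the coefficient at \<open>psi 0\<close>.\<close>
    let ?v = "if ?up \<or> ?n \<noteq> 1 then D2_vec h (int ?n) 0 1 0 else D2_vec h (- 2) 0 0 1"
    show ?thesis
    proof (rule L2_norm_neq_0I)
      show "L2_ip (D2_basis h i) ?v \<noteq> 0"
        unfolding b by (simp add: D2_pm_def L2_ip_D2_vec_D2_vec[OF h] psi_norm_neq_0)
    qed (auto intro!: schwartz_vec_L2 D2_basis_schwartz D2_vec_schwartz)
  qed
  have simple: "simple_eigenvalue (adjoint_comp_graph (D2 h)) (of_real (D2_lam h i))" if "D2_lam h i \<noteq> 0" for i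
    by (rule gram_spectrum(2)[OF basis fin nz D2_lam_inj[OF h] that])
  have ev: "D2_lam h (3 * n + (if up then 0 else 1)) = D2_eval h up n" for up n
    by (simp add: D2_lam_def)
  show "simple_eigenvalue (adjoint_comp_graph (D2 h)) (complex_of_real (D2_eval h up n))"
    using simple[of "3 * n + (if up then 0 else 1)"] unfolding ev using D2_eval_neq_0[OF h] by blast
  have range: "range (D2_lam h) - {0} = range (D2_eval h True) \<union> range (D2_eval h False)"
  proof (intro equalityI subsetI)
    fix x assume "x \<in> range (D2_eval h True) \<union> range (D2_eval h False)"
    then obtain up n where x: "x = D2_eval h up n" by blast
    have "x \<in> range (D2_lam h)"
      by (rule range_eqI[of _ _ "3 * n + (if up then 0 else 1)"], unfold ev, rule x)
    moreover have "x \<noteq> 0" unfolding x by (rule D2_eval_neq_0[OF h])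
    ultimately show "x \<in> range (D2_lam h) - {0}" by simp
  next
    fix x assume "x \<in> range (D2_lam h) - {0}"
    then obtain i where i: "x = D2_lam h i" "D2_lam h i \<noteq> 0" by blast
    then have "x = D2_eval h (i mod 3 = 0) (i div 3)" by (metis D2_lam_def)
    then show "x \<in> range (D2_eval h True) \<union> range (D2_eval h False)"
      by (cases "i mod 3 = 0") simp_all
  qed
  have "op_spectrum (adjoint_comp_graph (D2 h)) - {0} = of_real ` (range (D2_lam h) - {0})"
    by (rule gram_spectrum(1)[OF basis fin nz D2_lam_inj[OF h]])
  then show "op_spectrum (adjoint_comp_graph (D2 h)) - {0}
      = range (\<lambda>n. complex_of_real (D2_eval h True n)) \<union> range (\<lambda>n. complex_of_real (D2_eval h False n))"
    unfolding range image_Un image_image .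
qed

theorem mainTheorem5:
  fixes h :: real
    and \<mu> lam_plus lam_minus :: "nat \<Rightarrow> real"
  assumes h: "h \<noteq> 0"
    and mu: "\<And>n. \<mu> n = \<bar>h\<bar> ^ 3 * (2 * real n + 1) * \<bar>(2 * real n + 1)\<^sup>2 - 2\<bar>"
    and lp: "\<And>n. lam_plus n = h\<^sup>2 * ((sqrt (8 * (2 * real n + 1)\<^sup>2 + 9) + 5) / 4)\<^sup>2"
    and lm: "\<And>n. lam_minus n = h\<^sup>2 * ((sqrt (8 * (2 * real n + 1)\<^sup>2 + 9) - 5) / 4)\<^sup>2"
  shows "op_spectrum (adjoint_comp_graph (D1 h)) - {0} = range (\<lambda>n. complex_of_real (\<mu> n)) \<and>
         inj \<mu> \<and>
         (\<forall>n. simple_eigenvalue (adjoint_comp_graph (D1 h)) (complex_of_real (\<mu> n))) \<and>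
         op_spectrum (adjoint_comp_graph (D2 h)) - {0} =
           range (\<lambda>n. complex_of_real (lam_plus n)) \<union> range (\<lambda>n. complex_of_real (lam_minus n)) \<and>
         inj lam_plus \<and> inj lam_minus \<and> range lam_plus \<inter> range lam_minus = {} \<and>
         (\<forall>n. simple_eigenvalue (adjoint_comp_graph (D2 h)) (complex_of_real (lam_plus n)) \<and>
              simple_eigenvalue (adjoint_comp_graph (D2 h)) (complex_of_real (lam_minus n)))"
proof -
  have eqs: "\<mu> = D1_eval h" "lam_plus = D2_eval h True" "lam_minus = D2_eval h False"
    by (simp_all add: fun_eq_iff mu lp lm D1_eval_def D2_eval_def D2_root_def)
  have "inj (D2_eval h up)" for up
    using D2_eval_inj[OF h] by (auto intro: injI)
  moreover have "range (D2_eval h True) \<inter> range (D2_eval h False) = {}"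
    using D2_eval_inj[OF h, of True _ False] by auto
  ultimately show ?thesis
    unfolding eqs using D1_spectrum[OF h] D2_spectrum[OF h] inj_D1_eval[OF h] by blast
qed

end
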